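(* The metric space $(\mathcal D,d_\tau)$ is geodesic. More precisely, for every $X,Y\in\mathcal D$, there is a path $(X_t)_{t\in[0,1]}$ in $\mathcal D$ such that $X_0=X$, $X_1=Y$, and \[d_\tau(X_s,X_t)=|s-t|\,d_\tau(X,Y)\] for all $s,t\in[0,1]$.
   Context: A geometric data set is a triple $(X,F_X,\mu_X)$ where $F_X$ is a nonempty family of real-valued functions (features) on $X$ such that $d_X(x,x'):=\sup_{f\in F_X}|f(x)-f(x')|$ is a (finite) complete separable metric on $X$, and $\mu_X$ is a Borel probability measure on $(X,d_X)$ with full support. $\overline{F_X}$ denotes the closure of $F_X$ in the set of real-valued functions on $X$ under pointwise convergence. $X$ and $Y$ are isomorphic if there is a Borel map $\phi:X\to Y$ with $\phi_*\mu_X=\mu_Y$ and $\overline{F_Y}\circ\phi=\overline{F_X}$. Isomorphic geometric data sets are identified; $\mathcal D$ is the set of isomorphism classes. $\mathcal T(\mu,\nu)$ is the set of couplings of $\mu,\nu$ (Borel probability measures on the product with marginals $\mu,\nu$); $\mathrm{pr}_1,\mathrm{pr}_2$ are the coordinate projections; $(d)_H$ is the Hausdorff distance induced by $d$. Compactified observable distance. $\tau:\mathbb R\to(-1/2,1/2)$, $\tau(r)=\frac12\tanh r$. $\mathsf K_\tau(X)$ is the closure of $\{\tau\circ f\mid f\in F_X\}$ under pointwise convergence on $X$. With $d_{1,\pi}(u,v)=\int|u-v|\,d\pi$, set \[D_\tau^\pi(X,Y):=(d_{1,\pi})_H(\mathsf K_\tau(X)\circ\mathrm{pr}_1,\mathsf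 K_\tau(Y)\circ\mathrm{pr}_2)\quad(\pi\in\mathcal T(\mu_X,\mu_Y)),\qquad d_\tau(X,Y):=\inf_{\pi\in\mathcal T(\mu_X,\mu_Y)}D^\pi_\tau(X,Y).\] This $d_\tau$ is a metric on $\mathcal D$. *)

theory Defs
  imports "HOL-Probability.Probability"
begin

definition borel_sets :: "'a topology \<Rightarrow> 'a set set" where
  "borel_sets T = sigma_sets (topspace T) {U. openin T U}"

text \<open>
  Functions on a set \<open>A\<close> are represented by members of \<open>extensional A\<close>, so that the set of real-valued
  functions on \<open>A\<close> with pointwise convergence is the product space below.
\<close>

abbreviation pointwise_topology :: "'a set \<Rightarrow> ('a \<Rightarrow> real) topology" where
  "pointwise_topology A \<equiv> product_topology (\<lambda>_. euclideanreal) A"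

definition hausdorff_distance :: "('a \<Rightarrow> 'a \<Rightarrow> real) \<Rightarrow> 'a set \<Rightarrow> 'a set \<Rightarrow> real" where
  "hausdorff_distance d A B = max (SUP a\<in>A. INF b\<in>B. d a b) (SUP b\<in>B. INF a\<in>A. d a b)"


subsection \<open>Geometric data sets\<close>

record 'a gds =
  gds_carrier :: "'a set"
  gds_features :: "('a \<Rightarrow> real) set"
  gds_measure :: "'a measure"

text \<open>
  The locale \<^locale>\<open>Metric_space\<close> demands nonnegativity on the whole type, hence the value \<open>0\<close>
  off the carrier.
\<close>

definition gds_dist :: "'a gds \<Rightarrow> 'a \<Rightarrow> 'a \<Rightarrow> real" where
  "gds_dist X x x' =
     (if x \<in> gds_carrier X \<and> x' \<in> gds_carrier X then SUP f\<in>gds_features X. \<bar>f x - f x'\<bar> else 0)"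

abbreviation gds_topology :: "'a gds \<Rightarrow> 'a topology" where
  "gds_topology X \<equiv> Metric_space.mtopology (gds_carrier X) (gds_dist X)"

definition geometric_data_set :: "'a gds \<Rightarrow> bool" where
  "geometric_data_set X \<longleftrightarrow>
     gds_features X \<noteq> {} \<and>
     gds_features X \<subseteq> extensional (gds_carrier X) \<and>
     (\<forall>x\<in>gds_carrier X. \<forall>x'\<in>gds_carrier X. bdd_above ((\<lambda>f. \<bar>f x - f x'\<bar>) ` gds_features X)) \<and>
     Metric_space (gds_carrier X) (gds_dist X) \<and>
     Metric_space.mcomplete (gds_carrier X) (gds_dist X) \<and>
     separable_space (gds_topology X) \<and>
     prob_space (gds_measure X) \<and>
     space (gds_measure X) = gds_carrier X \<and>
     sets (gds_measure X) = borel_sets (gds_topology X) \<and>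
     (\<forall>U. openin (gds_topology X) U \<and> U \<noteq> {} \<longrightarrow> emeasure (gds_measure X) U > 0)"

definition gds_feature_closure :: "'a gds \<Rightarrow> ('a \<Rightarrow> real) set" where
  "gds_feature_closure X = pointwise_topology (gds_carrier X) closure_of gds_features X"

definition gds_isomorphism :: "'a gds \<Rightarrow> 'b gds \<Rightarrow> ('a \<Rightarrow> 'b) \<Rightarrow> bool" where
  "gds_isomorphism X Y \<phi> \<longleftrightarrow>
     \<phi> \<in> measurable (gds_measure X) (gds_measure Y) \<and>
     distr (gds_measure X) (gds_measure Y) \<phi> = gds_measure Y \<and>
     (\<lambda>g. compose (gds_carrier X) g \<phi>) ` gds_feature_closure Y = gds_feature_closure X"

definition gds_isomorphic :: "'a gds \<Rightarrow> 'b gds \<Rightarrow> bool" where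
  "gds_isomorphic X Y \<longleftrightarrow> (\<exists>\<phi>. gds_isomorphism X Y \<phi>)"


subsection \<open>The compactified observable distance\<close>

definition gds_couplings :: "'a gds \<Rightarrow> 'b gds \<Rightarrow> ('a \<times> 'b) measure set" where
  "gds_couplings X Y =
     {\<pi>. prob_space \<pi> \<and>
         space \<pi> = gds_carrier X \<times> gds_carrier Y \<and>
         sets \<pi> = borel_sets (prod_topology (gds_topology X) (gds_topology Y)) \<and>
         distr \<pi> (gds_measure X) fst = gds_measure X \<and>
         distr \<pi> (gds_measure Y) snd = gds_measure Y}"

definition tau :: "real \<Rightarrow> real" where
  "tau r = tanh r / 2"

definition K_tau :: "'a gds \<Rightarrow> ('a \<Rightarrow> real) set" where
  "K_tau X = pointwise_topology (gds_carrier X) closure_of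
     ((\<lambda>f. compose (gds_carrier X) tau f) ` gds_features X)"

definition L1_dist :: "'a measure \<Rightarrow> ('a \<Rightarrow> real) \<Rightarrow> ('a \<Rightarrow> real) \<Rightarrow> real" where
  "L1_dist \<pi> u v = (\<integral>p. \<bar>u p - v p\<bar> \<partial>\<pi>)"

definition D_tau :: "('a \<times> 'b) measure \<Rightarrow> 'a gds \<Rightarrow> 'b gds \<Rightarrow> real" where
  "D_tau \<pi> X Y =
     hausdorff_distance (L1_dist \<pi>) ((\<lambda>u. u \<circ> fst) ` K_tau X) ((\<lambda>v. v \<circ> snd) ` K_tau Y)"

definition d_tau :: "'a gds \<Rightarrow> 'b gds \<Rightarrow> real" where
  "d_tau X Y = (INF \<pi>\<in>gds_couplings X Y. D_tau \<pi> X Y)"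


subsection \<open>The space of isomorphism classes\<close>

text \<open>
  A separable metric space has at most the cardinality of the continuum, so carriers inside
  \<^typ>\<open>real\<close> represent every isomorphism class (lemma \<open>gds_isomorphic_to_real\<close> below).
\<close>

definition gds_iso_rel :: "(real gds \<times> real gds) set" where
  "gds_iso_rel = {(X, Y). geometric_data_set X \<and> geometric_data_set Y \<and> gds_isomorphic X Y}"

definition gds_classes :: "real gds set set" where
  "gds_classes = {X. geometric_data_set X} // gds_iso_rel"

text \<open>Independence of the representatives is lemma \<open>d_tau_class_eq\<close> below.\<close>

definition d_tau_class :: "real gds set \<Rightarrow> real gds set \<Rightarrow> real" where
  "d_tau_class A B = d_tau (SOME X. X \<in> A) (SOME Y. Y \<in> B)"


subsection \<open>Adequacy of the encoding\<close>

lemma gdsD: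
  assumes "geometric_data_set X"
  shows "Metric_space (gds_carrier X) (gds_dist X)"
    and "Metric_space.mcomplete (gds_carrier X) (gds_dist X)"
    and "separable_space (gds_topology X)"
    and "prob_space (gds_measure X)"
    and "space (gds_measure X) = gds_carrier X"
    and "sets (gds_measure X) = borel_sets (gds_topology X)"
    and "topspace (gds_topology X) = gds_carrier X"
    and "gds_features X \<subseteq> extensional (gds_carrier X)"
    and "gds_features X \<noteq> {}"
  using assms Metric_space.topspace_mtopology by (auto simp: geometric_data_set_def)

lemma borel_sets_subset: "borel_sets T \<subseteq> Pow (topspace T)"
  unfolding borel_sets_def using sigma_sets_into_sp[of "{U. openin T U}" "topspace T"]
  by (auto dest: openin_subset)

lemma openin_borel_sets: "openin T U \<Longrightarrow> U \<in> borel_sets T"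
  by (simp add: borel_sets_def sigma_sets.Basic)

lemma continuous_map_measurable:
  assumes "continuous_map S T f"
    and "space M = topspace S" "sets M = borel_sets S"
    and "space N = topspace T" "sets N = borel_sets T"
  shows "f \<in> measurable M N"
proof (rule measurable_sigma_sets[where \<Omega> = "topspace T" and A = "{U. openin T U}"])
  show "sets N = sigma_sets (topspace T) {U. openin T U}"
    using assms by (simp add: borel_sets_def)
  show "{U. openin T U} \<subseteq> Pow (topspace T)"
    by (auto dest: openin_subset)
  show "f \<in> space M \<rightarrow> topspace T"
    using continuous_map_funspace[OF assms(1)] assms by simp
  fix U assume "U \<in> {U. openin T U}"
  then have "openin S {x \<in> topspace S. f x \<in> U}"
    using assms(1) by (simp add: openin_continuous_map_preimage)
  moreover have "f -` U \<inter> space M = {x \<in> topspace S. f x \<in> U}"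
    using assms by auto
  ultimately show "f -` U \<inter> space M \<in> sets M"
    using assms openin_borel_sets by metis
qed

lemma gds_second_countable:
  assumes "geometric_data_set X"
  shows "second_countable (gds_topology X)"
proof -
  interpret Metric_space "gds_carrier X" "gds_dist X" by (rule gdsD[OF assms])
  obtain S where S: "countable S" "S \<subseteq> gds_carrier X" "mtopology closure_of S = gds_carrier X"
    using gdsD(3)[OF assms] by (auto simp: separable_space_def)
  let ?B = "(\<lambda>(s, n). mball s (1 / Suc n)) ` (S \<times> (UNIV :: nat set))"
  show ?thesis
    unfolding second_countable_def
  proof (intro exI[of _ ?B] conjI allI impI ballI)
    show "countable ?B" using S by simp
    show "openin mtopology V" if "V \<in> ?B" for V using that by auto
    fix U x assume U: "openin mtopology U \<and> x \<in> U"
    then obtain r where r: "r > 0" "mball x r \<subseteq> U" by (auto simp: openin_mtopology)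
    have x: "x \<in> gds_carrier X" using U openin_subset by fastforce
    obtain n where n: "1 / Suc n < r / 2"
      using r nat_approx_posE[of "r/2"] by auto
    have "x \<in> mtopology closure_of S" using x S by simp
    then have "\<forall>r>0. \<exists>y\<in>S. y \<in> mball x r" by (simp add: metric_closure_of)
    then have "\<exists>y\<in>S. y \<in> mball x (1 / Suc n)" by (simp del: in_mball)
    then obtain s where s: "s \<in> S" "gds_dist X x s < 1 / Suc n" by auto
    have "mball s (1 / Suc n) \<subseteq> mball x r"
    proof
      fix y assume "y \<in> mball s (1 / Suc n)"
      then have y: "y \<in> gds_carrier X" "s \<in> gds_carrier X" "gds_dist X s y < 1 / Suc n" by auto
      then have "gds_dist X x y \<le> gds_dist X x s + gds_dist X s y" using x triangle by blast
      then show "y \<in> mball x r" using x y s n by auto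
    qed
    moreover have "x \<in> mball s (1 / Suc n)" using s x S commute by auto
    ultimately show "\<exists>V\<in>?B. x \<in> V \<and> V \<subseteq> U" using r s by blast
  qed
qed

lemma sets_pair_gds:
  assumes X: "geometric_data_set X" and Y: "geometric_data_set Y"
  shows "sets (gds_measure X \<Otimes>\<^sub>M gds_measure Y) =
         borel_sets (prod_topology (gds_topology X) (gds_topology Y))"
proof
  let ?T = "prod_topology (gds_topology X) (gds_topology Y)"
  let ?P = "gds_measure X \<Otimes>\<^sub>M gds_measure Y"
  let ?B = "measure_of (topspace ?T) (borel_sets ?T) (\<lambda>_. 0)"
  have sB: "space ?B = topspace ?T" "sets ?B = borel_sets ?T"
    using borel_sets_subset[of ?T]
    by (auto simp: space_measure_of_conv borel_sets_def sigma_sets_sigma_sets_eq openin_subset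
             dest: openin_subset intro!: sigma_sets_sigma_sets_eq)
  have f1: "fst \<in> measurable ?B (gds_measure X)"
    by (rule continuous_map_measurable[OF continuous_map_fst]) (use sB gdsD[OF X] in auto)
  have f2: "snd \<in> measurable ?B (gds_measure Y)"
    by (rule continuous_map_measurable[OF continuous_map_snd]) (use sB gdsD[OF Y] in auto)
  have id: "(\<lambda>p. (fst p, snd p)) \<in> measurable ?B ?P"
    using f1 f2 by (rule measurable_Pair)
  show "sets ?P \<subseteq> borel_sets ?T"
  proof
    fix A assume A: "A \<in> sets ?P"
    then have "(\<lambda>p. (fst p, snd p)) -` A \<inter> space ?B \<in> sets ?B"
      using id measurable_sets by blast
    moreover have "A \<subseteq> space ?B"
      unfolding sB(1) using sets.sets_into_space[OF A]
      by (simp add: space_pair_measure gdsD[OF X] gdsD[OF Y])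
    ultimately show "A \<in> borel_sets ?T" unfolding sB(2) by (simp add: Int_absorb2)
  qed
  have spP: "topspace ?T = space ?P" by (simp add: space_pair_measure gdsD[OF X] gdsD[OF Y])
  obtain BX where BX: "countable BX" "\<forall>V\<in>BX. openin (gds_topology X) V"
     "\<And>U x. openin (gds_topology X) U \<Longrightarrow> x \<in> U \<Longrightarrow> \<exists>V\<in>BX. x \<in> V \<and> V \<subseteq> U"
    using gds_second_countable[OF X] unfolding second_countable_def by metis
  obtain BY where BY: "countable BY" "\<forall>V\<in>BY. openin (gds_topology Y) V"
     "\<And>U x. openin (gds_topology Y) U \<Longrightarrow> x \<in> U \<Longrightarrow> \<exists>V\<in>BY. x \<in> V \<and> V \<subseteq> U"
    using gds_second_countable[OF Y] unfolding second_countable_def by metis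
  show "borel_sets ?T \<subseteq> sets ?P"
    unfolding borel_sets_def spP
  proof (rule sets.sigma_sets_subset, rule subsetI)
    fix U assume "U \<in> {U. openin ?T U}"
    then have U: "openin ?T U" by simp
    let ?C = "{(V, W). V \<in> BX \<and> W \<in> BY \<and> V \<times> W \<subseteq> U}"
    have U_eq: "U = (\<Union>p\<in>?C. fst p \<times> snd p)"
    proof (intro equalityI subsetI)
      fix p assume p: "p \<in> U"
      obtain V W where VW: "openin (gds_topology X) V" "openin (gds_topology Y) W"
          "fst p \<in> V" "snd p \<in> W" "V \<times> W \<subseteq> U"
        using U p unfolding openin_prod_topology_alt by (metis prod.collapse)
      obtain V' W' where "V' \<in> BX" "fst p \<in> V'" "V' \<subseteq> V" "W' \<in> BY" "snd p \<in> W'" "W' \<subseteq> W"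
        using BX(3)[OF VW(1,3)] BY(3)[OF VW(2,4)] by blast
      then show "p \<in> (\<Union>p\<in>?C. fst p \<times> snd p)"
        using VW by (intro UN_I[of "(V', W')"]) (auto simp: mem_Times_iff)
    qed auto
    have "countable ?C"
      by (rule countable_subset[of _ "BX \<times> BY"]) (use BX BY in auto)
    moreover have "fst p \<times> snd p \<in> sets ?P" if "p \<in> ?C" for p
    proof (rule pair_measureI)
      have "openin (gds_topology X) (fst p)" "openin (gds_topology Y) (snd p)"
        using that BX(2) BY(2) by auto
      then show "fst p \<in> sets (gds_measure X)" "snd p \<in> sets (gds_measure Y)"
        by (simp_all add: gdsD(6)[OF X] gdsD(6)[OF Y] openin_borel_sets)
    qed
    ultimately have "(\<Union>p\<in>?C. fst p \<times> snd p) \<in> sets ?P"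
      by (rule sets.countable_UN'')
    then show "U \<in> sets ?P" by (subst U_eq)
  qed
qed

lemma feature_subset_closure:
  assumes "geometric_data_set X"
  shows "gds_features X \<subseteq> gds_feature_closure X"
  unfolding gds_feature_closure_def
  by (rule closure_of_subset) (use gdsD(8)[OF assms] in \<open>simp add: PiE_UNIV_domain PiE_def\<close>)

lemma feature_closure_extensional: "gds_feature_closure X \<subseteq> extensional (gds_carrier X)"
  unfolding gds_feature_closure_def
  using closure_of_subset_topspace[of "pointwise_topology (gds_carrier X)"] by (auto simp: PiE_def)

lemma K_tau_extensional: "K_tau X \<subseteq> extensional (gds_carrier X)"
  unfolding K_tau_def
  using closure_of_subset_topspace[of "pointwise_topology (gds_carrier X)"] by (auto simp: PiE_def)

lemma closedin_pointwise_le: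
  assumes "x \<in> A" "x' \<in> A"
  shows "closedin (pointwise_topology A) {f \<in> topspace (pointwise_topology A). \<bar>f x - f x'\<bar> \<le> r}"
proof -
  have "continuous_map (pointwise_topology A) euclideanreal (\<lambda>f. \<bar>f x - f x'\<bar>)"
    using assms by (intro continuous_intros continuous_map_real_abs continuous_map_product_projection)
  then have "closedin (pointwise_topology A)
      {f \<in> topspace (pointwise_topology A). \<bar>f x - f x'\<bar> \<in> {..r}}"
    by (rule closedin_continuous_map_preimage) simp
  then show ?thesis by simp
qed

lemma feature_le_dist:
  assumes "geometric_data_set X" "f \<in> gds_features X" "x \<in> gds_carrier X" "x' \<in> gds_carrier X"
  shows "\<bar>f x - f x'\<bar> \<le> gds_dist X x x'"
  unfolding gds_dist_def using assms by (auto simp: geometric_data_set_def intro: cSUP_upper)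

lemma feature_closure_le_dist:
  assumes X: "geometric_data_set X" and f: "f \<in> gds_feature_closure X"
    and x: "x \<in> gds_carrier X" "x' \<in> gds_carrier X"
  shows "\<bar>f x - f x'\<bar> \<le> gds_dist X x x'"
proof -
  let ?T = "pointwise_topology (gds_carrier X)"
  have "gds_feature_closure X \<subseteq> {f \<in> topspace ?T. \<bar>f x - f x'\<bar> \<le> gds_dist X x x'}"
    unfolding gds_feature_closure_def
    by (rule closure_of_minimal[OF _ closedin_pointwise_le[OF x]])
      (use feature_le_dist[OF X _ x] gdsD(8)[OF X] in \<open>auto simp: PiE_def\<close>)
  then show ?thesis using f by auto
qed

lemma tau_lipschitz: "\<bar>tau a - tau b\<bar> \<le> \<bar>a - b\<bar>"
proof -
  have *: "\<bar>tau a - tau b\<bar> \<le> \<bar>a - b\<bar>" if "a < b" for a b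
  proof -
    have "\<exists>z. a < z \<and> z < b \<and> tanh b - tanh a = (b - a) * (1 - tanh z ^ 2)"
      by (rule MVT2[OF that]) (auto intro!: derivative_eq_intros)
    then obtain z where z: "tanh b - tanh a = (b - a) * (1 - tanh z ^ 2)" by auto
    have "tanh z ^ 2 < 1" using tanh_real_bounds[of z] by (auto simp: abs_square_less_1 abs_less_iff)
    then have "0 \<le> (b - a) * (1 - tanh z ^ 2)" "(b - a) * (1 - tanh z ^ 2) \<le> (b - a) * 1"
      using that by (intro mult_nonneg_nonneg mult_left_mono; simp)+
    then have "0 \<le> tanh b - tanh a" "tanh b - tanh a \<le> b - a" unfolding z by simp_all
    then show ?thesis using that by (auto simp: tau_def abs_if)
  qed
  show ?thesis using *[of a b] *[of b a] by (cases a b rule: linorder_cases) auto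
qed

lemma continuous_map_tau: "continuous_map euclideanreal euclideanreal tau"
  unfolding tau_def by (auto intro!: continuous_intros)

lemma K_tau_le_dist:
  assumes X: "geometric_data_set X" and f: "f \<in> K_tau X"
    and x: "x \<in> gds_carrier X" "x' \<in> gds_carrier X"
  shows "\<bar>f x - f x'\<bar> \<le> gds_dist X x x'"
proof -
  let ?T = "pointwise_topology (gds_carrier X)"
  have "K_tau X \<subseteq> {f \<in> topspace ?T. \<bar>f x - f x'\<bar> \<le> gds_dist X x x'}"
    unfolding K_tau_def
    by (rule closure_of_minimal[OF _ closedin_pointwise_le[OF x]])
      (use order_trans[OF tau_lipschitz feature_le_dist[OF X _ x]] x in \<open>auto simp: compose_def\<close>)
  then show ?thesis using f by auto
qed

lemma K_tau_measurable:
  assumes X: "geometric_data_set X" and f: "f \<in> K_tau X"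
  shows "f \<in> borel_measurable (gds_measure X)"
proof (rule continuous_map_measurable[where S = "gds_topology X" and T = euclideanreal])
  interpret Metric_space "gds_carrier X" "gds_dist X" by (rule gdsD[OF X])
  have "continuous_map mtopology (Metric_space.mtopology UNIV dist) f"
    unfolding metric_continuous_map[OF Met_TC.Metric_space_axioms]
    using K_tau_le_dist[OF X f] by (auto simp: dist_real_def) (meson le_less_trans)
  then show "continuous_map (gds_topology X) euclideanreal f" by simp
qed (use gdsD[OF X] in \<open>auto simp: borel_sets_def borel_def\<close>)

lemma continuous_map_precompose:
  assumes "\<phi> ` A \<subseteq> B"
  shows "continuous_map (pointwise_topology B) (pointwise_topology A) (\<lambda>g. compose A g \<phi>)"
  unfolding continuous_map_componentwise
proof (intro conjI ballI)
  show "(\<lambda>g. compose A g \<phi>) ` topspace (pointwise_topology B) \<subseteq> extensional A"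
    by (auto simp: compose_def)
  fix k assume k: "k \<in> A"
  then have "continuous_map (pointwise_topology B) euclideanreal (\<lambda>g. g (\<phi> k))"
    using assms by (intro continuous_map_product_projection) auto
  then show "continuous_map (pointwise_topology B) euclideanreal (\<lambda>g. compose A g \<phi> k)"
    using k by (simp add: compose_def)
qed

lemma continuous_map_postcompose:
  "continuous_map (pointwise_topology A) (pointwise_topology A) (\<lambda>g. compose A tau g)"
  unfolding continuous_map_componentwise
proof (intro conjI ballI)
  show "(\<lambda>g. compose A tau g) ` topspace (pointwise_topology A) \<subseteq> extensional A"
    by (auto simp: compose_def)
  fix k assume k: "k \<in> A"
  then have "continuous_map (pointwise_topology A) euclideanreal (tau \<circ> (\<lambda>g. g k))"
    by (intro continuous_map_compose[OF _ continuous_map_tau] continuous_map_product_projection)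
  then show "continuous_map (pointwise_topology A) euclideanreal (\<lambda>g. compose A tau g k)"
    using k by (simp add: compose_def o_def)
qed

lemma tau_feature_closure:
  assumes "f \<in> gds_feature_closure X"
  shows "compose (gds_carrier X) tau f \<in> K_tau X"
  using continuous_map_image_closure_subset[OF continuous_map_postcompose, of "gds_carrier X" "gds_features X"] assms
  unfolding gds_feature_closure_def K_tau_def by auto

context
  fixes X :: "'a gds" and Y :: "'b gds" and \<phi> :: "'a \<Rightarrow> 'b"
  assumes X: "geometric_data_set X" and Y: "geometric_data_set Y" and iso: "gds_isomorphism X Y \<phi>"
begin

lemma gds_iso_maps: "x \<in> gds_carrier X \<Longrightarrow> \<phi> x \<in> gds_carrier Y"
  using iso gdsD(5)[OF X] gdsD(5)[OF Y] measurable_space[of \<phi> "gds_measure X" "gds_measure Y" x]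
  by (auto simp: gds_isomorphism_def)

lemma gds_iso_closure:
  "(\<lambda>g. compose (gds_carrier X) g \<phi>) ` gds_feature_closure Y = gds_feature_closure X"
  using iso by (simp add: gds_isomorphism_def)

lemma gds_iso_dist:
  assumes x: "x \<in> gds_carrier X" "x' \<in> gds_carrier X"
  shows "gds_dist Y (\<phi> x) (\<phi> x') = gds_dist X x x'"
proof (rule antisym)
  have y: "\<phi> x \<in> gds_carrier Y" "\<phi> x' \<in> gds_carrier Y" using gds_iso_maps x by auto
  show "gds_dist Y (\<phi> x) (\<phi> x') \<le> gds_dist X x x'"
  proof (subst gds_dist_def, simp add: y, rule cSUP_least)
    show "gds_features Y \<noteq> {}" by (rule gdsD(9)[OF Y])
    fix g assume "g \<in> gds_features Y"
    then have "compose (gds_carrier X) g \<phi> \<in> gds_feature_closure X"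
      using gds_iso_closure feature_subset_closure[OF Y] by blast
    from feature_closure_le_dist[OF X this x]
    show "\<bar>g (\<phi> x) - g (\<phi> x')\<bar> \<le> gds_dist X x x'" using x by (simp add: compose_def)
  qed
  show "gds_dist X x x' \<le> gds_dist Y (\<phi> x) (\<phi> x')"
  proof (subst gds_dist_def, simp add: x, rule cSUP_least)
    show "gds_features X \<noteq> {}" by (rule gdsD(9)[OF X])
    fix f assume "f \<in> gds_features X"
    then have "f \<in> (\<lambda>g. compose (gds_carrier X) g \<phi>) ` gds_feature_closure Y"
      using gds_iso_closure feature_subset_closure[OF X] by blast
    then obtain g where g: "g \<in> gds_feature_closure Y" "f = compose (gds_carrier X) g \<phi>" by auto
    show "\<bar>f x - f x'\<bar> \<le> gds_dist Y (\<phi> x) (\<phi> x')"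
      using feature_closure_le_dist[OF Y g(1) y] x g(2) by (simp add: compose_def)
  qed
qed

lemma gds_iso_surj: "\<phi> ` gds_carrier X = gds_carrier Y"
proof (intro equalityI subsetI)
  interpret MX: Metric_space "gds_carrier X" "gds_dist X" by (rule gdsD[OF X])
  interpret MY: Metric_space "gds_carrier Y" "gds_dist Y" by (rule gdsD[OF Y])
  fix y assume y: "y \<in> gds_carrier Y"
  have "\<exists>x\<in>gds_carrier X. gds_dist Y y (\<phi> x) < 1 / Suc n" for n
  proof (rule ccontr)
    assume no: "\<not> ?thesis"
    let ?B = "MY.mball y (1 / Suc n)"
    have "openin MY.mtopology ?B" "?B \<noteq> {}"
      using y by (auto simp: MY.mball_eq_empty)
    then have "emeasure (gds_measure Y) ?B > 0" "?B \<in> sets (gds_measure Y)"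
      using Y gdsD(6)[OF Y] openin_borel_sets by (auto simp: geometric_data_set_def)
    moreover have "emeasure (gds_measure Y) ?B
        = emeasure (gds_measure X) (\<phi> -` ?B \<inter> space (gds_measure X))"
      using iso calculation(2) emeasure_distr unfolding gds_isomorphism_def by metis
    moreover have "\<phi> -` ?B \<inter> space (gds_measure X) = {}"
      using no gdsD(5)[OF X] by auto
    ultimately show False by simp
  qed
  then obtain x where x: "\<And>n. x n \<in> gds_carrier X" "\<And>n. gds_dist Y y (\<phi> (x n)) < 1 / Suc n"
    by metis
  have "MY.MCauchy (\<lambda>n. \<phi> (x n))"
  proof (rule MY.convergent_imp_MCauchy)
    show "limitin MY.mtopology (\<lambda>n. \<phi> (x n)) y sequentially"
      unfolding MY.limit_metric_sequentially
    proof (intro conjI allI impI y)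
      fix e :: real assume "e > 0"
      then obtain N where N: "1 / real (Suc N) < e" using nat_approx_posE by blast
      have "gds_dist Y (\<phi> (x n)) y < e" if "N \<le> n" for n
      proof -
        have "gds_dist Y (\<phi> (x n)) y < 1 / Suc n" using x(2)[of n] by (simp add: MY.commute)
        also have "\<dots> \<le> 1 / Suc N" using that by (simp add: frac_le)
        finally show ?thesis using N by simp
      qed
      then show "\<exists>N. \<forall>n\<ge>N. \<phi> (x n) \<in> gds_carrier Y \<and> gds_dist Y (\<phi> (x n)) y < e"
        using gds_iso_maps x(1) by blast
    qed
  qed (use gds_iso_maps x(1) in auto)
  then have "MX.MCauchy x"
    using x(1) by (auto simp: MX.MCauchy_def MY.MCauchy_def gds_iso_dist)
  then obtain a where "limitin MX.mtopology x a sequentially"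
    using gdsD(2)[OF X] by (auto simp: MX.mcomplete_def)
  then have a: "a \<in> gds_carrier X" "\<And>e. e > 0 \<Longrightarrow> \<exists>N. \<forall>n\<ge>N. gds_dist X (x n) a < e"
    unfolding MX.limit_metric_sequentially by (simp, meson)
  have "gds_dist Y y (\<phi> a) \<le> 0 + e" if "e > 0" for e
  proof -
    obtain N where N: "\<And>n. n \<ge> N \<Longrightarrow> gds_dist X (x n) a < e / 2" using a(2)[of "e/2"] \<open>e > 0\<close> by auto
    obtain M where M: "1 / real (Suc M) < e / 2" using nat_approx_posE[of "e/2"] \<open>e > 0\<close> by auto
    let ?n = "max N M"
    have "1 / real (Suc ?n) \<le> 1 / Suc M" by (intro frac_le) auto
    moreover have "gds_dist Y y (\<phi> a) \<le> gds_dist Y y (\<phi> (x ?n)) + gds_dist Y (\<phi> (x ?n)) (\<phi> a)"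
      using y a(1) x(1) gds_iso_maps by (intro MY.triangle) auto
    moreover have "gds_dist Y (\<phi> (x ?n)) (\<phi> a) < e / 2"
      using N[of ?n] gds_iso_dist x(1) a(1) by simp
    ultimately show ?thesis using x(2)[of ?n] M by simp
  qed
  then have "gds_dist Y y (\<phi> a) \<le> 0" by (rule field_le_epsilon)
  then have "gds_dist Y y (\<phi> a) = 0" using MY.nonneg[of y "\<phi> a"] by linarith
  then have "y = \<phi> a" using y gds_iso_maps[OF a(1)] by simp
  then show "y \<in> \<phi> ` gds_carrier X" using a(1) by simp
qed (use gds_iso_maps in auto)

lemma gds_iso_inj: "inj_on \<phi> (gds_carrier X)"
proof (rule inj_onI)
  interpret MX: Metric_space "gds_carrier X" "gds_dist X" by (rule gdsD[OF X])
  interpret MY: Metric_space "gds_carrier Y" "gds_dist Y" by (rule gdsD[OF Y])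
  fix x x' assume "x \<in> gds_carrier X" "x' \<in> gds_carrier X" "\<phi> x = \<phi> x'"
  then show "x = x'" using gds_iso_dist[of x x'] gds_iso_maps[of x'] by simp
qed

lemma gds_iso_inverse: "gds_isomorphism Y X (inv_into (gds_carrier X) \<phi>)"
  unfolding gds_isomorphism_def
proof (intro conjI)
  let ?\<psi> = "inv_into (gds_carrier X) \<phi>"
  interpret M: Metric_space12 "gds_carrier X" "gds_dist X" "gds_carrier Y" "gds_dist Y"
    by (simp add: Metric_space12_def gdsD[OF X] gdsD[OF Y])
  have maps: "?\<psi> y \<in> gds_carrier X" "\<phi> (?\<psi> y) = y" if "y \<in> gds_carrier Y" for y
    using that gds_iso_surj by (auto simp: inv_into_into f_inv_into_f)
  have "continuous_map (gds_topology Y) (gds_topology X) ?\<psi>"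
    unfolding M.M2.metric_continuous_map[OF M.M1.Metric_space_axioms]
  proof (intro conjI ballI allI impI)
    fix a \<epsilon> assume "a \<in> gds_carrier Y" "(0::real) < \<epsilon>"
    then show "\<exists>\<delta>>0. \<forall>x. x \<in> gds_carrier Y \<and> gds_dist Y a x < \<delta> \<longrightarrow> gds_dist X (?\<psi> a) (?\<psi> x) < \<epsilon>"
      by (intro exI[of _ \<epsilon>]) (metis gds_iso_dist maps)
  qed (use maps in auto)
  then show meas: "?\<psi> \<in> measurable (gds_measure Y) (gds_measure X)"
    by (rule continuous_map_measurable) (use gdsD[OF X] gdsD[OF Y] in auto)
  have \<phi>: "\<phi> \<in> measurable (gds_measure X) (gds_measure Y)"
    and dY: "distr (gds_measure X) (gds_measure Y) \<phi> = gds_measure Y"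
    using iso by (auto simp: gds_isomorphism_def)
  have "distr (gds_measure Y) (gds_measure X) ?\<psi>
      = distr (gds_measure X) (gds_measure X) (?\<psi> \<circ> \<phi>)"
    using distr_distr[OF meas \<phi>] dY by simp
  also have "\<dots> = distr (gds_measure X) (gds_measure X) (\<lambda>x. x)"
    by (rule distr_cong) (auto simp: gdsD(5)[OF X] gds_iso_inj)
  finally show "distr (gds_measure Y) (gds_measure X) ?\<psi> = gds_measure X"
    by (simp add: distr_id)
  have "compose (gds_carrier Y) (compose (gds_carrier X) g \<phi>) ?\<psi> = g"
    if "g \<in> gds_feature_closure Y" for g
    using that feature_closure_extensional[of Y] maps
    by (auto simp: compose_def fun_eq_iff extensional_def subset_iff)
  then show "(\<lambda>g. compose (gds_carrier Y) g ?\<psi>) ` gds_feature_closure X = gds_feature_closure Y"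
    unfolding gds_iso_closure[symmetric] image_image by simp
qed

lemma K_tau_iso_subset: "u \<in> K_tau Y \<Longrightarrow> compose (gds_carrier X) u \<phi> \<in> K_tau X"
proof -
  assume u: "u \<in> K_tau Y"
  let ?p = "\<lambda>g. compose (gds_carrier X) g \<phi>"
  have cont: "continuous_map (pointwise_topology (gds_carrier Y)) (pointwise_topology (gds_carrier X)) ?p"
    by (rule continuous_map_precompose) (use gds_iso_maps in auto)
  have "?p (compose (gds_carrier Y) tau g) \<in> K_tau X" if "g \<in> gds_features Y" for g
  proof -
    have "?p g \<in> gds_feature_closure X"
      using that gds_iso_closure feature_subset_closure[OF Y] by blast
    then have "compose (gds_carrier X) tau (?p g) \<in> K_tau X" by (rule tau_feature_closure)
    moreover have "?p (compose (gds_carrier Y) tau g) = compose (gds_carrier X) tau (?p g)"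
      by (auto simp: compose_def fun_eq_iff gds_iso_maps)
    ultimately show ?thesis by simp
  qed
  then have "?p ` (\<lambda>g. compose (gds_carrier Y) tau g) ` gds_features Y \<subseteq> K_tau X" by auto
  then have "pointwise_topology (gds_carrier X) closure_of
      (?p ` (\<lambda>g. compose (gds_carrier Y) tau g) ` gds_features Y) \<subseteq> K_tau X"
    by (rule closure_of_minimal) (simp add: K_tau_def)
  then show ?thesis
    using continuous_map_image_closure_subset[OF cont] u unfolding K_tau_def[of Y] by blast
qed

end

lemma gds_isomorphic_refl: "gds_isomorphic X X" if X: "geometric_data_set X"
  unfolding gds_isomorphic_def gds_isomorphism_def
proof (intro exI[of _ "\<lambda>x. x"] conjI)
  have "compose (gds_carrier X) g (\<lambda>x. x) = g" if "g \<in> gds_feature_closure X" for g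
    using that feature_closure_extensional[of X]
    by (auto simp: compose_def fun_eq_iff extensional_def subset_iff)
  then show "(\<lambda>g. compose (gds_carrier X) g (\<lambda>x. x)) ` gds_feature_closure X = gds_feature_closure X"
    by simp
qed (auto simp: distr_id)

lemma gds_isomorphic_sym:
  "gds_isomorphic Y X" if "geometric_data_set X" "geometric_data_set Y" "gds_isomorphic X Y"
  using that gds_iso_inverse unfolding gds_isomorphic_def by blast

lemma gds_isomorphic_trans:
  assumes X: "geometric_data_set X" and Y: "geometric_data_set Y" and Z: "geometric_data_set Z"
    and XY: "gds_isomorphic X Y" and YZ: "gds_isomorphic Y Z"
  shows "gds_isomorphic X Z"
proof -
  obtain \<phi> \<psi> where \<phi>: "gds_isomorphism X Y \<phi>" and \<psi>: "gds_isomorphism Y Z \<psi>"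
    using XY YZ by (auto simp: gds_isomorphic_def)
  have m: "\<phi> \<in> measurable (gds_measure X) (gds_measure Y)" "\<psi> \<in> measurable (gds_measure Y) (gds_measure Z)"
    using \<phi> \<psi> by (auto simp: gds_isomorphism_def)
  have "distr (gds_measure X) (gds_measure Z) (\<psi> \<circ> \<phi>) = gds_measure Z"
    using distr_distr[OF m(2,1)] \<phi> \<psi> by (simp add: gds_isomorphism_def)
  moreover have "compose (gds_carrier X) g (\<psi> \<circ> \<phi>)
      = compose (gds_carrier X) (compose (gds_carrier Y) g \<psi>) \<phi>" for g :: "_ \<Rightarrow> real"
    by (auto simp: compose_def fun_eq_iff gds_iso_maps[OF X Y \<phi>])
  then have "(\<lambda>g. compose (gds_carrier X) g (\<psi> \<circ> \<phi>)) ` gds_feature_closure Z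
      = (\<lambda>g. compose (gds_carrier X) g \<phi>) ` (\<lambda>g. compose (gds_carrier Y) g \<psi>) ` gds_feature_closure Z"
    by (simp add: image_image)
  then have "(\<lambda>g. compose (gds_carrier X) g (\<psi> \<circ> \<phi>)) ` gds_feature_closure Z = gds_feature_closure X"
    by (simp only: gds_iso_closure[OF X Y \<phi>] gds_iso_closure[OF Y Z \<psi>])
  ultimately show ?thesis
    using measurable_comp[OF m] unfolding gds_isomorphic_def gds_isomorphism_def by blast
qed

lemma equiv_gds_iso_rel: "equiv {X. geometric_data_set X} gds_iso_rel"
proof (rule equivI)
  show "gds_iso_rel \<subseteq> {X. geometric_data_set X} \<times> {X. geometric_data_set X}"
    by (auto simp: gds_iso_rel_def)
  show "refl_on {X. geometric_data_set X} gds_iso_rel"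
    by (auto simp: refl_on_def gds_iso_rel_def gds_isomorphic_refl)
  show "sym gds_iso_rel"
    by (auto simp: sym_def gds_iso_rel_def gds_isomorphic_sym)
  show "trans gds_iso_rel"
    unfolding trans_def gds_iso_rel_def using gds_isomorphic_trans by blast
qed

lemma K_tau_iso_eq:
  assumes X: "geometric_data_set X" and Y: "geometric_data_set Y" and iso: "gds_isomorphism X Y \<phi>"
  shows "(\<lambda>u. compose (gds_carrier X) u \<phi>) ` K_tau Y = K_tau X"
proof (intro equalityI subsetI)
  fix u assume u: "u \<in> K_tau X"
  let ?\<psi> = "inv_into (gds_carrier X) \<phi>"
  have "compose (gds_carrier Y) u ?\<psi> \<in> K_tau Y"
    by (rule K_tau_iso_subset[OF Y X gds_iso_inverse[OF X Y iso] u])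
  moreover have "compose (gds_carrier X) (compose (gds_carrier Y) u ?\<psi>) \<phi> = u"
    using u K_tau_extensional[of X] gds_iso_maps[OF X Y iso] gds_iso_inj[OF X Y iso]
    by (auto simp: compose_def fun_eq_iff extensional_def subset_iff)
  ultimately show "u \<in> (\<lambda>u. compose (gds_carrier X) u \<phi>) ` K_tau Y" by (metis image_eqI)
qed (use K_tau_iso_subset[OF X Y iso] in auto)

lemma coupling_push:
  assumes X: "geometric_data_set X" and Y: "geometric_data_set Y"
    and X': "geometric_data_set X'" and Y': "geometric_data_set Y'"
    and \<phi>: "gds_isomorphism X X' \<phi>" and \<psi>: "gds_isomorphism Y Y' \<psi>"
    and \<pi>: "\<pi> \<in> gds_couplings X Y"
  shows "\<exists>\<pi>'\<in>gds_couplings X' Y'. D_tau \<pi>' X' Y' = D_tau \<pi> X Y"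
proof -
  let ?N = "gds_measure X' \<Otimes>\<^sub>M gds_measure Y'"
  let ?h = "\<lambda>p. (\<phi> (fst p), \<psi> (snd p))"
  define \<pi>' where "\<pi>' = distr \<pi> ?N ?h"
  have sp: "space \<pi> = gds_carrier X \<times> gds_carrier Y"
    and [measurable_cong]: "sets \<pi> = sets (gds_measure X \<Otimes>\<^sub>M gds_measure Y)"
    and prob: "prob_space \<pi>"
    and marg: "distr \<pi> (gds_measure X) fst = gds_measure X" "distr \<pi> (gds_measure Y) snd = gds_measure Y"
    using \<pi> by (auto simp: gds_couplings_def sets_pair_gds[OF X Y])
  have [measurable]: "\<phi> \<in> measurable (gds_measure X) (gds_measure X')"
    "\<psi> \<in> measurable (gds_measure Y) (gds_measure Y')"
    and dist: "distr (gds_measure X) (gds_measure X') \<phi> = gds_measure X'"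
      "distr (gds_measure Y) (gds_measure Y') \<psi> = gds_measure Y'"
    using \<phi> \<psi> by (auto simp: gds_isomorphism_def)
  have h[measurable]: "?h \<in> measurable \<pi> ?N" by measurable
  have "distr \<pi>' (gds_measure X') fst = distr (distr \<pi> (gds_measure X) fst) (gds_measure X') \<phi>"
    unfolding \<pi>'_def by (simp add: distr_distr o_def)
  moreover have "distr \<pi>' (gds_measure Y') snd = distr (distr \<pi> (gds_measure Y) snd) (gds_measure Y') \<psi>"
    unfolding \<pi>'_def by (simp add: distr_distr o_def)
  ultimately have "\<pi>' \<in> gds_couplings X' Y'"
    using prob_space.prob_space_distr[OF prob h]
    by (simp add: gds_couplings_def marg dist \<pi>'_def sets_pair_gds[OF X' Y'] space_pair_measure
        gdsD(5)[OF X'] gdsD(5)[OF Y'])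
  moreover have "D_tau \<pi>' X' Y' = D_tau \<pi> X Y"
  proof -
    have L: "L1_dist \<pi>' (u \<circ> fst) (v \<circ> snd)
        = L1_dist \<pi> (compose (gds_carrier X) u \<phi> \<circ> fst) (compose (gds_carrier Y) v \<psi> \<circ> snd)"
      if "u \<in> K_tau X'" "v \<in> K_tau Y'" for u v
    proof -
      have [measurable]: "u \<in> borel_measurable (gds_measure X')" "v \<in> borel_measurable (gds_measure Y')"
        using that K_tau_measurable X' Y' by auto
      show ?thesis
        unfolding L1_dist_def \<pi>'_def
        by (subst integral_distr) (auto simp: compose_def sp intro!: Bochner_Integration.integral_cong)
    qed
    have L': "L1_dist \<pi>' (v \<circ> snd) (u \<circ> fst)
        = L1_dist \<pi> (compose (gds_carrier Y) v \<psi> \<circ> snd) (compose (gds_carrier X) u \<phi> \<circ> fst)"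
      if "u \<in> K_tau X'" "v \<in> K_tau Y'" for u v
      using L[OF that] by (simp add: L1_dist_def abs_minus_commute)
    show ?thesis
      unfolding D_tau_def hausdorff_distance_def
        K_tau_iso_eq[OF X X' \<phi>, symmetric] K_tau_iso_eq[OF Y Y' \<psi>, symmetric] image_image
      by (intro arg_cong2[where f = max] SUP_cong INF_cong refl L)
  qed
  ultimately show ?thesis by blast
qed

lemma d_tau_cong:
  assumes X: "geometric_data_set X" and Y: "geometric_data_set Y"
    and X': "geometric_data_set X'" and Y': "geometric_data_set Y'"
    and XX': "gds_isomorphic X X'" and YY': "gds_isomorphic Y Y'"
  shows "d_tau X Y = d_tau X' Y'"
proof -
  obtain \<phi> \<psi> where iso: "gds_isomorphism X X' \<phi>" "gds_isomorphism Y Y' \<psi>"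
    using XX' YY' by (auto simp: gds_isomorphic_def)
  have "(\<lambda>\<pi>. D_tau \<pi> X Y) ` gds_couplings X Y = (\<lambda>\<pi>. D_tau \<pi> X' Y') ` gds_couplings X' Y'"
    using coupling_push[OF X Y X' Y' iso]
      coupling_push[OF X' Y' X Y gds_iso_inverse[OF X X' iso(1)] gds_iso_inverse[OF Y Y' iso(2)]]
    by (auto simp: image_iff) metis+
  then show ?thesis by (simp add: d_tau_def)
qed

lemma d_tau_class_eq:
  assumes "A \<in> gds_classes" "B \<in> gds_classes" "X \<in> A" "Y \<in> B"
  shows "d_tau_class A B = d_tau X Y"
proof -
  have A: "(SOME X. X \<in> A) \<in> A" and B: "(SOME Y. Y \<in> B) \<in> B"
    using assms someI by metis+
  have "((SOME X. X \<in> A), X) \<in> gds_iso_rel" "((SOME Y. Y \<in> B), Y) \<in> gds_iso_rel"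
    using quotient_eq_iff[OF equiv_gds_iso_rel] assms A B unfolding gds_classes_def by blast+
  then show ?thesis
    unfolding d_tau_class_def by (intro d_tau_cong) (auto simp: gds_iso_rel_def)
qed

lemma gds_inj_real:
  assumes X: "geometric_data_set (X :: 'a gds)"
  shows "\<exists>h :: 'a \<Rightarrow> real. inj_on h (gds_carrier X)"
proof -
  interpret Metric_space "gds_carrier X" "gds_dist X" by (rule gdsD[OF X])
  obtain B where B: "countable B" "\<And>U x. openin mtopology U \<Longrightarrow> x \<in> U \<Longrightarrow> \<exists>V\<in>B. x \<in> V \<and> V \<subseteq> U"
    using gds_second_countable[OF X] unfolding second_countable_def by metis
  let ?g = "\<lambda>x. to_nat_on B ` {V \<in> B. x \<in> V}"
  have g: "inj_on ?g (gds_carrier X)"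
  proof (rule inj_onI, rule ccontr)
    fix x y assume xy: "x \<in> gds_carrier X" "y \<in> gds_carrier X" "?g x = ?g y" "x \<noteq> y"
    have eq: "{V \<in> B. x \<in> V} = {V \<in> B. y \<in> V}"
      by (rule iffD1[OF inj_on_image_eq_iff[OF inj_on_to_nat_on[OF B(1)]] xy(3)]) auto
    have "x \<in> mball x (gds_dist X x y)" using xy by simp
    from B(2)[OF openin_mball this]
    obtain V where V: "V \<in> B" "x \<in> V" "V \<subseteq> mball x (gds_dist X x y)" by (elim bexE conjE)
    have "V \<in> {V \<in> B. y \<in> V}" unfolding eq[symmetric] using V by simp
    then have "y \<in> mball x (gds_dist X x y)" using V(3) by (simp add: subsetD del: in_mball)
    then show False by simp
  qed
  obtain k :: "nat set \<Rightarrow> real" where "bij k"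
    using nat_sets_eqpoll_reals unfolding eqpoll_def by (elim exE)
  then have "inj k" by (rule bij_is_inj)
  then have "inj_on (k \<circ> ?g) (gds_carrier X)"
    using g by (intro comp_inj_on) (auto intro: inj_on_subset)
  then show ?thesis by blast
qed

lemma gds_isomorphic_to_real:
  assumes X: "geometric_data_set (X :: 'a gds)"
  shows "\<exists>Z :: real gds. geometric_data_set Z \<and> gds_isomorphic X Z"
proof -
  obtain h :: "'a \<Rightarrow> real" where h: "inj_on h (gds_carrier X)" using gds_inj_real[OF X] by blast
  define g where "g = inv_into (gds_carrier X) h"
  have gh[simp]: "g (h x) = x" if "x \<in> gds_carrier X" for x using h that by (simp add: g_def)
  define C where "C = h ` gds_carrier X"
  define F where "F = (\<lambda>f. compose C f g) ` gds_features X"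
  have gC: "z \<in> C \<Longrightarrow> g z \<in> gds_carrier X" "z \<in> C \<Longrightarrow> h (g z) = z" for z by (auto simp: C_def)
  have hC: "x \<in> gds_carrier X \<Longrightarrow> h x \<in> C" for x by (simp add: C_def)
  define T where "T = gds_topology (\<lparr>gds_carrier = C, gds_features = F, gds_measure = undefined\<rparr>)"
  define Z where "Z = \<lparr>gds_carrier = C, gds_features = F,
     gds_measure = distr (gds_measure X) (sigma C (borel_sets T)) h\<rparr>"
  have [simp]: "gds_carrier Z = C" "gds_features Z = F" by (simp_all add: Z_def)
  have "gds_dist Z = gds_dist \<lparr>gds_carrier = C, gds_features = F, gds_measure = undefined\<rparr>"
    by (auto simp: fun_eq_iff gds_dist_def)
  then have T: "gds_topology Z = T" by (simp add: T_def)
  have im: "(\<lambda>f. \<bar>f (h x) - f (h x')\<bar>) ` F = (\<lambda>f. \<bar>f x - f x'\<bar>) ` gds_features X"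
    if "x \<in> gds_carrier X" "x' \<in> gds_carrier X" for x x'
    using that hC by (auto simp: F_def image_image compose_def)
  have dZ: "gds_dist Z (h x) (h x') = gds_dist X x x'"
    if "x \<in> gds_carrier X" "x' \<in> gds_carrier X" for x x'
    unfolding gds_dist_def using that hC im by simp
  have dX: "gds_dist Z z z' = gds_dist X (g z) (g z')" if "z \<in> C" "z' \<in> C" for z z'
    using dZ[of "g z" "g z'"] gC that by simp
  have dout: "gds_dist Z z z' = 0" if "\<not> (z \<in> C \<and> z' \<in> C)" for z z'
    using that by (auto simp: gds_dist_def)
  interpret MX: Metric_space "gds_carrier X" "gds_dist X" by (rule gdsD[OF X])
  interpret MZ: Metric_space C "gds_dist Z"
  proof
    show "0 \<le> gds_dist Z x y" for x y by (cases "x \<in> C \<and> y \<in> C") (auto simp: dX dout)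
    show "gds_dist Z x y = gds_dist Z y x" for x y
      by (cases "x \<in> C \<and> y \<in> C") (auto simp: dX dout MX.commute)
    show "gds_dist Z x y = 0 \<longleftrightarrow> x = y" if "x \<in> C" "y \<in> C" for x y
      using that gC by (simp add: dX) metis
    show "gds_dist Z x z \<le> gds_dist Z x y + gds_dist Z y z" if "x \<in> C" "y \<in> C" "z \<in> C" for x y z
      using that gC by (simp add: dX MX.triangle)
  qed
  interpret M: Metric_space12 "gds_carrier X" "gds_dist X" C "gds_dist Z" ..
  have homeo: "homeomorphic_map MX.mtopology MZ.mtopology h"
    by (rule M.isometry_imp_homeomorphic_map) (auto simp: C_def dZ)
  have Tm: "MZ.mtopology = T" using T by simp
  have contg: "continuous_map MX.mtopology T h"
    using homeo homeomorphic_imp_continuous_map Tm by metis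
  have spT: "topspace T = C" using MZ.topspace_mtopology Tm by simp
  have sg: "space (sigma C (borel_sets T)) = C" "sets (sigma C (borel_sets T)) = borel_sets T"
    using borel_sets_subset[of T] spT
    by (auto simp: space_measure_of_conv borel_sets_def intro!: sigma_sets_sigma_sets_eq dest: openin_subset)
  have mh: "h \<in> measurable (gds_measure X) (sigma C (borel_sets T))"
    by (rule continuous_map_measurable[OF contg]) (use gdsD[OF X] spT sg in auto)
  have spZ: "space (gds_measure Z) = C" "sets (gds_measure Z) = borel_sets T"
    using sg by (simp_all add: Z_def)
  have "MZ.mcomplete"
    unfolding MZ.mcomplete_def
  proof (intro allI impI)
    fix \<sigma> assume s: "MZ.MCauchy \<sigma>"
    then have "\<sigma> n \<in> C" for n by (auto simp: MZ.MCauchy_def)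
    then have sC: "g (\<sigma> n) \<in> gds_carrier X" "h (g (\<sigma> n)) = \<sigma> n" "\<sigma> n \<in> C" for n using gC by auto
    have "MX.MCauchy (\<lambda>n. g (\<sigma> n))"
      using s sC by (auto simp: MZ.MCauchy_def MX.MCauchy_def dX)
    then obtain a where "limitin MX.mtopology (\<lambda>n. g (\<sigma> n)) a sequentially"
      using gdsD(2)[OF X] by (auto simp: MX.mcomplete_def)
    then have "limitin T (h \<circ> (\<lambda>n. g (\<sigma> n))) (h a) sequentially"
      by (rule continuous_map_limit[OF contg])
    then show "\<exists>x. limitin MZ.mtopology \<sigma> x sequentially"
      using sC Tm by (auto simp: o_def)
  qed
  moreover have "separable_space T"
    using separable_space_continuous_map_image[OF gdsD(3)[OF X] contg] spT by (simp add: C_def)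
  moreover have "prob_space (gds_measure Z)"
    using prob_space.prob_space_distr[OF gdsD(4)[OF X] mh] by (simp add: Z_def)
  moreover have "emeasure (gds_measure Z) U > 0" if U: "openin T U" "U \<noteq> {}" for U
  proof -
    have "U \<subseteq> C" using openin_subset[OF U(1)] spT by simp
    have "openin MX.mtopology {x \<in> gds_carrier X. h x \<in> U}"
      using openin_continuous_map_preimage[OF contg U(1)] by simp
    moreover have "{x \<in> gds_carrier X. h x \<in> U} \<noteq> {}"
      using U(2) \<open>U \<subseteq> C\<close> by (auto simp: C_def)
    ultimately have "emeasure (gds_measure X) {x \<in> gds_carrier X. h x \<in> U} > 0"
      using X by (auto simp: geometric_data_set_def)
    moreover have "h -` U \<inter> space (gds_measure X) = {x \<in> gds_carrier X. h x \<in> U}"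
      using gdsD(5)[OF X] by auto
    ultimately show ?thesis
      using emeasure_distr[OF mh, of U] openin_borel_sets[OF U(1)] sg by (simp add: Z_def)
  qed
  moreover have "bdd_above ((\<lambda>f. \<bar>f z - f z'\<bar>) ` F)" if "z \<in> C" "z' \<in> C" for z z'
    using im[of "g z" "g z'"] gC that X by (simp add: geometric_data_set_def)
  moreover have "F \<noteq> {}" "F \<subseteq> extensional C"
    using gdsD(9)[OF X] by (auto simp: F_def compose_def)
  ultimately have Z: "geometric_data_set Z"
    unfolding geometric_data_set_def using MZ.Metric_space_axioms spZ Tm by simp
  have mh': "h \<in> measurable (gds_measure X) (gds_measure Z)"
    using mh by (simp add: Z_def)
  have "distr (gds_measure X) (gds_measure Z) h = gds_measure Z"
  proof -
    have "distr (gds_measure X) (gds_measure Z) h = distr (gds_measure X) (sigma C (borel_sets T)) h"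
      by (rule distr_cong) (simp_all add: spZ sg)
    then show ?thesis by (simp add: Z_def)
  qed
  moreover have "(\<lambda>u. compose (gds_carrier X) u h) ` gds_feature_closure Z = gds_feature_closure X"
  proof -
    let ?PX = "pointwise_topology (gds_carrier X)" and ?PZ = "pointwise_topology C"
    let ?p = "\<lambda>u. compose (gds_carrier X) u h" and ?q = "\<lambda>u. compose C u g"
    have cp: "continuous_map ?PZ ?PX ?p" by (rule continuous_map_precompose) (auto simp: C_def)
    have cq: "continuous_map ?PX ?PZ ?q" by (rule continuous_map_precompose) (use gC in auto)
    have pq: "?p (?q u) = u" if "u \<in> extensional (gds_carrier X)" for u :: "'a \<Rightarrow> real"
      using that hC by (auto simp: compose_def fun_eq_iff extensional_def)
    have "?p ` F = gds_features X"
      unfolding F_def image_image using pq gdsD(8)[OF X] by (simp add: subset_iff)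
    then have "?p ` gds_feature_closure Z \<subseteq> gds_feature_closure X"
      using continuous_map_image_closure_subset[OF cp, of F] by (simp add: gds_feature_closure_def)
    moreover have "?q ` gds_feature_closure X \<subseteq> gds_feature_closure Z"
      using continuous_map_image_closure_subset[OF cq, of "gds_features X"]
      by (simp add: gds_feature_closure_def F_def)
    moreover have "?p ` ?q ` gds_feature_closure X = gds_feature_closure X"
      unfolding image_image using pq feature_closure_extensional[of X] by (simp add: subset_iff)
    ultimately show ?thesis by blast
  qed
  ultimately have "gds_isomorphic X Z"
    using mh' by (auto simp: gds_isomorphic_def gds_isomorphism_def)
  then show ?thesis using Z by blast
qed

end

theory Submission
  imports Defs
begin

text \<open>
  An optimal coupling exists: along a filter for which all values \<open>\<pi>\<^sub>n(E)\<close> of a minimising sequence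
  converge, the limit is countably additive because the marginals are tight, and the families
  \<open>K_tau\<close> are compact in \<open>L\<^sup>1\<close>. For an optimal coupling \<open>\<pi>\<close> every \<open>u\<close> in one family has a partner
  \<open>v\<close> in the other with \<open>\<integral>|u - v| d\<pi> \<le> d_tau X Y\<close>. The point \<open>X\<^sub>t\<close> of the geodesic is \<open>X \<times> Y\<close> with
  the measure \<open>\<pi>\<close> and the features \<open>\<tau>\<^sup>-\<^sup>1 ((1 - t) u + t v)\<close> (identifying points, completing, and
  restricting to the support). Moving from \<open>s\<close> to \<open>t\<close> costs at most \<open>|s - t| d_tau X Y\<close>, and the
  triangle inequality forces equality. The latter holds without disintegration of measures: since
  the members of \<open>K_tau\<close> are 1-Lipschitz, it suffices to glue couplings along a countable partition
  of the middle space into small pieces.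
\<close>

subsection \<open>The functions in K_tau and their compactness\<close>

text \<open>Two obstacles shape the construction. The limit values +1/2 and -1/2 in
  \<open>K_tau\<close> have no preimage under \<open>tau\<close>, so a convex combination of
  \<open>u\<close> and \<open>v\<close> gives a real-valued feature only if it stays strictly inside
  the interval. Moreover the inverse of \<open>tau\<close> has unbounded derivative near the ends,
  so the 1-Lipschitz bound on \<open>u\<close> and \<open>v\<close> does not make the supremum
  metric of the new features finite. What does is the multiplicative estimate 1/2 + u x \<le> exp (2
  D) (1/2 + u x'), with its mirror image for 1/2 - u, where D bounds the distance of x and x'. It
  holds because 1/2 + tau is a logistic function, passes to pointwise limits and to convex
  combinations, and becomes an additive bound 2 D once \<open>tau\<close> is inverted. An optimal
  coupling rather than a nearly optimal one is used because a single probability space and a single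
  family of pairs have to serve all t with the exact cost. Limits are taken along filters, since the
  compact products involved may have uncountably many factors and need not be sequentially
  compact.\<close>

lemma gds_carrier_nonempty:
  assumes X: "geometric_data_set X"
  shows "gds_carrier X \<noteq> {}"
  using prob_space.not_empty[OF gdsD(4)[OF X]] gdsD(5)[OF X] by simp

lemma gds_dense_sequence:
  assumes X: "geometric_data_set X"
  obtains q :: "nat \<Rightarrow> 'a" where "\<And>n. q n \<in> gds_carrier X"
    and "\<And>x e. x \<in> gds_carrier X \<Longrightarrow> e > 0 \<Longrightarrow> \<exists>n. gds_dist X (q n) x < e"
proof -
  interpret Metric_space "gds_carrier X" "gds_dist X" by (rule gdsD[OF X])
  obtain S where S: "countable S" "S \<subseteq> gds_carrier X" "mtopology closure_of S = gds_carrier X"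
    using gdsD(3)[OF X] by (auto simp: separable_space_def)
  then have "S \<noteq> {}" using gds_carrier_nonempty[OF X] by auto
  show ?thesis
  proof
    show "from_nat_into S n \<in> gds_carrier X" for n
      using from_nat_into[OF \<open>S \<noteq> {}\<close>] S(2) by blast
    fix x and e :: real assume x: "x \<in> gds_carrier X" and "e > 0"
    then have "\<exists>y\<in>S. y \<in> mball x e" using S(3) by (auto simp: metric_closure_of)
    then obtain y where "y \<in> S" "gds_dist X y x < e" by (auto simp: commute)
    then show "\<exists>n. gds_dist X (from_nat_into S n) x < e"
      using from_nat_into_surj[OF S(1)] by metis
  qed
qed

lemma gds_dist_measurable:
  assumes X: "geometric_data_set X" and q: "q \<in> gds_carrier X"
  shows "{x \<in> space (gds_measure X). gds_dist X q x < e} \<in> sets (gds_measure X)"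
proof -
  interpret Metric_space "gds_carrier X" "gds_dist X" by (rule gdsD[OF X])
  have "{x \<in> space (gds_measure X). gds_dist X q x < e} = mball q e"
    unfolding mball_def gdsD(5)[OF X] using q by blast
  then show ?thesis using openin_borel_sets[OF openin_mball[of q e]] gdsD(6)[OF X] by simp
qed

text \<open>Each point gets the index of the first ball of radius \<open>e / 2\<close> around a
  dense sequence that contains it. Such countable measurable partitions serve three times: for L1
  compactness of \<open>K_tau\<close>, for tightness, and for gluing couplings.\<close>

lemma gds_fine_partition:
  assumes X: "geometric_data_set X" and e: "e > 0"
  obtains i :: "'a \<Rightarrow> nat" where "i \<in> measurable (gds_measure X) (count_space UNIV)"
    and "\<And>x x'. x \<in> gds_carrier X \<Longrightarrow> x' \<in> gds_carrier X \<Longrightarrow> i x = i x' \<Longrightarrow> gds_dist X x x' < e"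
proof -
  interpret Metric_space "gds_carrier X" "gds_dist X" by (rule gdsD[OF X])
  obtain q :: "nat \<Rightarrow> 'a" where q: "\<And>n. q n \<in> gds_carrier X"
     "\<And>x e. x \<in> gds_carrier X \<Longrightarrow> e > 0 \<Longrightarrow> \<exists>n. gds_dist X (q n) x < e"
    using gds_dense_sequence[OF X] by blast
  let ?i = "\<lambda>x. LEAST n. gds_dist X (q n) x < e / 2"
  show ?thesis
  proof
    have "Measurable.pred (gds_measure X) (\<lambda>x. gds_dist X (q n) x < e / 2)" for n
      unfolding pred_def using gds_dist_measurable[OF X q(1)] .
    then show "?i \<in> measurable (gds_measure X) (count_space UNIV)"
      by (rule measurable_Least)
    fix x x' assume x: "x \<in> gds_carrier X" "x' \<in> gds_carrier X" and eq: "?i x = ?i x'"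
    have "\<exists>n. gds_dist X (q n) z < e / 2" if "z \<in> gds_carrier X" for z
      using q(2)[of z "e/2"] that e by simp
    then have *: "gds_dist X (q (?i z)) z < e / 2" if "z \<in> gds_carrier X" for z
      using that LeastI_ex[of "\<lambda>n. gds_dist X (q n) z < e / 2"] by blast
    have "gds_dist X x x' \<le> gds_dist X x (q (?i x)) + gds_dist X (q (?i x)) x'"
      using x q by (intro triangle) auto
    also have "\<dots> < e" using *[OF x(1)] *[OF x(2)] commute[of x] eq by simp
    finally show "gds_dist X x x' < e" .
  qed
qed

lemma tau_bounds: "\<bar>tau r\<bar> < 1/2"
  using tanh_real_bounds[of r] by (auto simp: tau_def abs_less_iff)

lemma closedin_pointwise_affine_le:
  assumes "x \<in> A" "x' \<in> A"
  shows "closedin (pointwise_topology A)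
    {f \<in> topspace (pointwise_topology A). a * f x + b * f x' \<le> c}"
proof -
  have "continuous_map (pointwise_topology A) euclideanreal (\<lambda>f. a * f x + b * f x')"
    using assms by (intro continuous_intros continuous_map_product_projection)
  then have "closedin (pointwise_topology A)
      {f \<in> topspace (pointwise_topology A). a * f x + b * f x' \<in> {..c}}"
    by (rule closedin_continuous_map_preimage) simp
  then show ?thesis by simp
qed

text \<open>An affine inequality between the values at two points is a closed condition for
  pointwise convergence, so it passes from \<open>tau\<close> of the features to the closure. The
  quantitative estimates below are all read off from it.\<close>

lemma K_tau_affine_le:
  assumes x: "x \<in> gds_carrier X" "x' \<in> gds_carrier X" and u: "u \<in> K_tau X"
    and f: "\<And>f. f \<in> gds_features X \<Longrightarrow> a * tau (f x) + b * tau (f x') \<le> c"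
  shows "a * u x + b * u x' \<le> c"
proof -
  let ?T = "pointwise_topology (gds_carrier X)"
  have "K_tau X \<subseteq> {f \<in> topspace ?T. a * f x + b * f x' \<le> c}"
    unfolding K_tau_def
    by (rule closure_of_minimal[OF _ closedin_pointwise_affine_le[OF x]])
      (use f x in \<open>auto simp: compose_def\<close>)
  then show ?thesis using u by auto
qed

text \<open>The strict bound on \<open>tau\<close> weakens to a non-strict one in the closure:
  limits may reach 1/2 or -1/2.\<close>

lemma K_tau_bounds:
  assumes "u \<in> K_tau X" "x \<in> gds_carrier X"
  shows "\<bar>u x\<bar> \<le> 1/2"
proof -
  have b: "tau r \<le> 1/2" "- (1/2) \<le> tau r" for r using tau_bounds[of r] by linarith+
  have "1 * u x + 0 * u x \<le> 1/2" "-1 * u x + 0 * u x \<le> 1/2"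
    by (rule K_tau_affine_le[OF assms(2,2,1)]; use b in \<open>simp add: minus_le_iff\<close>)+
  then show ?thesis by linarith
qed

text \<open>The logistic function at 2 r; in this form a shift of the argument is a factor on one
  summand of the denominator.\<close>

lemma half_plus_tau: "1/2 + tau r = 1 / (1 + exp (-2 * r))"
proof -
  have "1 + exp (-2 * r) \<noteq> 0" by (metis add_pos_pos exp_gt_zero less_irrefl zero_less_one)
  then show ?thesis by (simp add: tau_def tanh_real_altdef field_simps)
qed

lemma tau_minus: "tau (- r) = - tau r"
  by (simp add: tau_def)

text \<open>Shifting the argument by at most \<open>D\<close> changes 1 + exp (-2 r) by a factor of
  at most exp (2 D). The control is relative, so it does not degenerate where \<open>tau\<close>
  approaches -1/2.\<close>

lemma half_plus_tau_le:
  assumes "\<bar>r - r'\<bar> \<le> D"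
  shows "1/2 + tau r \<le> exp (2 * D) * (1/2 + tau r')"
proof -
  have "exp (-2 * r') \<le> exp (2 * D + -2 * r)" using assms by simp
  then have e: "exp (-2 * r') \<le> exp (2 * D) * exp (-2 * r)" by (simp only: exp_add)
  have "1 \<le> exp (2 * D)" using assms by simp
  with e have "1 + exp (-2 * r') \<le> exp (2 * D) * (1 + exp (-2 * r))"
    unfolding distrib_left by linarith
  moreover have "1 + exp (-2 * r) > 0" "1 + exp (-2 * r') > 0" by (simp_all add: add_pos_pos)
  ultimately show ?thesis unfolding half_plus_tau by (simp add: field_simps)
qed

text \<open>A Harnack-type inequality for both gaps 1/2 + u and 1/2 - u. The second estimate is the
  first for the negated features, because \<open>tau\<close> is odd.\<close>

lemma K_tau_half_le:
  assumes X: "geometric_data_set X" and u: "u \<in> K_tau X"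
    and x: "x \<in> gds_carrier X" "x' \<in> gds_carrier X" and D: "gds_dist X x x' \<le> D"
  shows "1/2 + u x \<le> exp (2 * D) * (1/2 + u x')" "1/2 - u x \<le> exp (2 * D) * (1/2 - u x')"
proof -
  let ?E = "exp (2 * D)"
  have f: "\<bar>f x - f x'\<bar> \<le> D" if "f \<in> gds_features X" for f
    using feature_le_dist[OF X that x] D by linarith
  have "1 * u x + - ?E * u x' \<le> ?E * (1/2) - 1/2"
  proof (rule K_tau_affine_le[OF x u])
    fix f assume "f \<in> gds_features X"
    from half_plus_tau_le[OF f[OF this]]
    show "1 * tau (f x) + - ?E * tau (f x') \<le> ?E * (1/2) - 1/2"
      by (simp add: algebra_simps)
  qed
  then show "1/2 + u x \<le> exp (2 * D) * (1/2 + u x')" by (simp add: algebra_simps)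
  have "-1 * u x + ?E * u x' \<le> ?E * (1/2) - 1/2"
  proof (rule K_tau_affine_le[OF x u])
    fix f assume "f \<in> gds_features X"
    from f[OF this] have "\<bar>- f x - - f x'\<bar> \<le> D" by simp
    from half_plus_tau_le[OF this]
    show "-1 * tau (f x) + ?E * tau (f x') \<le> ?E * (1/2) - 1/2"
      by (simp add: tau_minus algebra_simps)
  qed
  then show "1/2 - u x \<le> exp (2 * D) * (1/2 - u x')" by (simp add: algebra_simps)
qed

lemma K_tau_continuous:
  assumes X: "geometric_data_set X" and f: "f \<in> K_tau X"
  shows "continuous_map (gds_topology X) euclideanreal f"
proof -
  interpret Metric_space "gds_carrier X" "gds_dist X" by (rule gdsD[OF X])
  have "continuous_map mtopology (Metric_space.mtopology UNIV dist) f"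
    unfolding metric_continuous_map[OF Met_TC.Metric_space_axioms]
    using K_tau_le_dist[OF X f] by (auto simp: dist_real_def) (meson le_less_trans)
  then show "continuous_map (gds_topology X) euclideanreal f" by simp
qed

text \<open>One representative in each of finitely many small cells controls the L1 distance. Off
  the remaining cells, two Lipschitz errors and the error at the representative add up to at most 3
  e; on them the difference is at most 1 and their mass is below \<open>e\<close>.\<close>

lemma K_tau_L1_le:
  assumes X: "geometric_data_set X" and e: "e > 0"
  obtains P where "finite P" "P \<subseteq> gds_carrier X"
    "\<And>u v. u \<in> K_tau X \<Longrightarrow> v \<in> K_tau X \<Longrightarrow> (\<forall>p\<in>P. \<bar>u p - v p\<bar> < e) \<Longrightarrow> L1_dist (gds_measure X) u v < e * 4"
proof -
  interpret prob_space "gds_measure X" by (rule gdsD[OF X])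
  interpret Metric_space "gds_carrier X" "gds_dist X" by (rule gdsD[OF X])
  obtain i :: "'a \<Rightarrow> nat" where [measurable]: "i \<in> measurable (gds_measure X) (count_space UNIV)"
    and i: "\<And>x x'. x \<in> gds_carrier X \<Longrightarrow> x' \<in> gds_carrier X \<Longrightarrow> i x = i x' \<Longrightarrow> gds_dist X x x' < e"
    using gds_fine_partition[OF X e] by blast
  define A where "A n = {x \<in> space (gds_measure X). n \<le> i x}" for n
  have [measurable]: "A n \<in> sets (gds_measure X)" for n unfolding A_def by measurable
  have "(\<lambda>n. prob (A n)) \<longlonglongrightarrow> prob (\<Inter>n. A n)"
    by (rule finite_Lim_measure_decseq) (auto simp: A_def decseq_def)
  moreover have "(\<Inter>n. A n) = {}" by (auto simp: A_def) (metis not_less_eq_eq)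
  ultimately have "(\<lambda>n. prob (A n)) \<longlonglongrightarrow> 0" by simp
  then obtain N where N: "prob (A N) < e"
    using e by (metis (no_types, lifting) order_tendstoD(2) eventually_sequentially order_refl)
  define r where "r k = (SOME x. x \<in> gds_carrier X \<and> i x = k)" for k
  have r: "r (i x) \<in> gds_carrier X" "i (r (i x)) = i x" if "x \<in> gds_carrier X" for x
    using someI[of "\<lambda>y. y \<in> gds_carrier X \<and> i y = i x" x] that unfolding r_def by auto
  \<comment> \<open>The representative of an empty cell is an arbitrary value, hence the
    intersection with the carrier.\<close>
  define P where "P = r ` {..<N} \<inter> gds_carrier X"
  show ?thesis
  proof
    show "finite P" "P \<subseteq> gds_carrier X" by (auto simp: P_def)
    fix u v assume u: "u \<in> K_tau X" and v: "v \<in> K_tau X" and P: "\<forall>p\<in>P. \<bar>u p - v p\<bar> < e"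
    have [measurable]: "u \<in> borel_measurable (gds_measure X)" "v \<in> borel_measurable (gds_measure X)"
      using K_tau_measurable[OF X] u v by auto
    have le: "\<bar>u x - v x\<bar> \<le> 3 * e + indicator (A N) x" if x: "x \<in> space (gds_measure X)" for x
    proof (cases "x \<in> A N")
      case True
      then show ?thesis
        using K_tau_bounds[OF u, of x] K_tau_bounds[OF v, of x] x e gdsD(5)[OF X] by simp
    next
      case False
      have xc: "x \<in> gds_carrier X" using x gdsD(5)[OF X] by simp
      let ?p = "r (i x)"
      have "?p \<in> P" using False x r[OF xc] by (auto simp: P_def A_def)
      then have "\<bar>u ?p - v ?p\<bar> < e" using P by blast
      moreover have "gds_dist X x ?p < e" using i[OF xc r(1)[OF xc]] r(2)[OF xc] by simp
      moreover have "\<bar>u x - u ?p\<bar> \<le> gds_dist X x ?p" "\<bar>v x - v ?p\<bar> \<le> gds_dist X x ?p"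
        using K_tau_le_dist[OF X u xc r(1)[OF xc]] K_tau_le_dist[OF X v xc r(1)[OF xc]] by auto
      ultimately show ?thesis using False by (simp add: abs_if split: if_splits)
    qed
    have "L1_dist (gds_measure X) u v \<le> (\<integral>x. 3 * e + indicator (A N) x \<partial>gds_measure X)"
      unfolding L1_dist_def
    proof (rule integral_mono_AE)
      show "integrable (gds_measure X) (\<lambda>x. \<bar>u x - v x\<bar>)"
        by (rule integrable_const_bound[where B = "3 * e + 1"])
          (use le in \<open>auto intro!: AE_I2 order_trans[OF le] simp: indicator_def\<close>)
      show "integrable (gds_measure X) (\<lambda>x. 3 * e + indicat_real (A N) x)"
        by (intro Bochner_Integration.integrable_add integrable_const integrable_real_indicator)
          (auto simp: less_top[symmetric])
    qed (use le in auto)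
    also have "\<dots> = 3 * e + prob (A N)"
      by (subst Bochner_Integration.integral_add) (auto simp: less_top[symmetric] prob_space)
    also have "\<dots> < e * 4" using N by simp
    finally show "L1_dist (gds_measure X) u v < e * 4" .
  qed
qed

lemma closure_of_pointwise_approx:
  assumes u: "u \<in> pointwise_topology A closure_of S" and P: "finite P" "P \<subseteq> A" and e: "e > 0"
  shows "\<exists>s\<in>S. \<forall>p\<in>P. \<bar>u p - s p\<bar> < e"
proof -
  let ?T = "pointwise_topology A"
  let ?U = "topspace ?T \<inter> (\<Inter>p\<in>P. {s \<in> topspace ?T. s p \<in> {u p - e<..<u p + e}})"
  have "openin ?T ?U"
  proof (cases "P = {}")
    case False
    have "openin ?T {s \<in> topspace ?T. s p \<in> {u p - e<..<u p + e}}" if "p \<in> P" for p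
      using that P by (intro openin_continuous_map_preimage[OF continuous_map_product_projection]) auto
    then show ?thesis by (intro openin_Int openin_topspace openin_INT2 P(1) False)
  next
    case True
    then show ?thesis using openin_topspace[of ?T] by (simp del: topspace_product_topology)
  qed
  moreover have "u \<in> ?U"
    using u e closure_of_subset_topspace[of ?T S] by auto
  ultimately obtain s where s: "s \<in> S" "s \<in> ?U"
    using u unfolding in_closure_of by blast
  have "\<bar>u p - s p\<bar> < e" if "p \<in> P" for p using s(2) that by (auto simp: abs_less_iff)
  then show ?thesis using s(1) by blast
qed

lemma tau_feature_K_tau: "geometric_data_set Z \<Longrightarrow> f \<in> gds_features Z \<Longrightarrow>
  compose (gds_carrier Z) tau f \<in> K_tau Z"
  using tau_feature_closure feature_subset_closure by blast

text \<open>Pointwise closeness at finitely many points is all that membership in the closure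
  provides, and by \<open>K_tau_L1_le\<close> that is enough for L1. Hence density arguments only
  have to treat genuine features.\<close>

lemma K_tau_L1_approx:
  assumes X: "geometric_data_set X" and u: "u \<in> K_tau X" and e: "e > 0"
  shows "\<exists>f\<in>gds_features X. L1_dist (gds_measure X) u (compose (gds_carrier X) tau f) < e"
proof -
  obtain P where P: "finite P" "P \<subseteq> gds_carrier X"
    "\<And>u v. u \<in> K_tau X \<Longrightarrow> v \<in> K_tau X \<Longrightarrow> (\<forall>p\<in>P. \<bar>u p - v p\<bar> < e/4) \<Longrightarrow>
       L1_dist (gds_measure X) u v < e/4 * 4"
    using K_tau_L1_le[OF X, of "e/4"] e by auto
  obtain f where f: "f \<in> gds_features X" "\<forall>p\<in>P. \<bar>u p - compose (gds_carrier X) tau f p\<bar> < e/4"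
    using closure_of_pointwise_approx[OF u[unfolded K_tau_def] P(1,2), of "e/4"] e by auto
  from P(3)[OF u tau_feature_K_tau[OF X f(1)] f(2)] show ?thesis using f(1) by auto
qed

text \<open>Tychonoff in filter form: the image filter has a cluster point \<open>c\<close> in the
  product of the compact sets. The index set may be uncountable, so a subsequence cannot be expected
  and the conclusion offers a finer filter instead.\<close>

lemma filter_cluster_point_pointwise:
  fixes p :: "'n \<Rightarrow> 'i \<Rightarrow> 'b::topological_space"
  assumes F: "F \<noteq> bot" and C: "\<And>i. compact (C i)" and p: "\<And>n i. p n i \<in> C i"
  obtains G c where "G \<le> F" "G \<noteq> bot" "\<And>i. c i \<in> C i" "\<And>i. ((\<lambda>n. p n i) \<longlongrightarrow> c i) G"
proof -
  have "compactin (product_topology (\<lambda>i. euclidean) UNIV) (Pi\<^sub>E UNIV C)"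
    using C by (subst compactin_PiE) simp
  then have "compact (Pi\<^sub>E UNIV C)" by (simp add: euclidean_product_topology)
  moreover have "filtermap p F \<noteq> bot" using F by (simp add: filtermap_bot_iff)
  moreover have "eventually (\<lambda>x. x \<in> Pi\<^sub>E UNIV C) (filtermap p F)"
    using p by (simp add: eventually_filtermap PiE_def)
  ultimately obtain c where c: "c \<in> Pi\<^sub>E UNIV C" "inf (nhds c) (filtermap p F) \<noteq> bot"
    unfolding compact_filter by blast
  \<comment> \<open>This restricts \<open>F\<close> to indices \<open>n\<close> with
    \<open>p n\<close> near \<open>c\<close>; it is nontrivial exactly because \<open>c\<close> is a
    cluster point.\<close>
  define G where "G = inf F (filtercomap p (nhds c))"
  show ?thesis
  proof
    show "G \<le> F" by (simp add: G_def)
    show "G \<noteq> bot"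
    proof
      assume "G = bot"
      then obtain Q R where Q: "eventually Q F" and R: "eventually R (filtercomap p (nhds c))"
        and QR: "\<And>n. Q n \<Longrightarrow> R n \<Longrightarrow> False"
        unfolding G_def trivial_limit_def eventually_inf by auto
      obtain S where S: "eventually S (nhds c)" "\<And>n. S (p n) \<Longrightarrow> R n"
        using R by (auto simp: eventually_filtercomap)
      have "eventually (\<lambda>x. \<exists>n. x = p n \<and> Q n) (filtermap p F)"
        using Q by (auto simp: eventually_filtermap elim: eventually_mono)
      then have "eventually (\<lambda>x. False) (inf (nhds c) (filtermap p F))"
        unfolding eventually_inf using S QR by blast
      then show False using c(2) by (simp add: trivial_limit_def)
    qed
    show "c i \<in> C i" for i using c(1) by auto
    have "filterlim p (nhds c) G"
      unfolding filterlim_def G_def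
      using filtermap_filtercomap[of p "nhds c"] filtermap_mono[of "inf F (filtercomap p (nhds c))"]
      by (meson inf_le2 order_trans)
    moreover have "((\<lambda>f. f i) \<longlongrightarrow> c i) (nhds c)" for i
    proof -
      have "continuous_on UNIV (\<lambda>f :: 'i \<Rightarrow> 'b. f i)"
        by (rule continuous_on_product_then_coordinatewise) simp
      then have "open ((\<lambda>f :: 'i \<Rightarrow> 'b. f i) -` S)" if "open S" for S
        using that continuous_on_open_vimage[of UNIV "\<lambda>f :: 'i \<Rightarrow> 'b. f i"] by simp
      then show ?thesis
        unfolding tendsto_def eventually_nhds by (metis vimageE vimageI)
    qed
    ultimately show "((\<lambda>n. p n i) \<longlongrightarrow> c i) G" for i
      using filterlim_compose by blast
  qed
qed

text \<open>Pointwise limits exist by compactness of the intervals. Dominated convergence does not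
  hold along arbitrary filters; L1 convergence follows instead from \<open>K_tau_L1_le\<close>,
  which asks for closeness at finitely many points only.\<close>

lemma K_tau_L1_compact:
  assumes X: "geometric_data_set X" and F: "F \<noteq> bot" and v: "\<And>n. v n \<in> K_tau X"
  obtains G w where "G \<le> F" "G \<noteq> bot" "w \<in> K_tau X"
    "((\<lambda>n. L1_dist (gds_measure X) (v n) w) \<longlongrightarrow> 0) G"
proof -
  \<comment> \<open>The singleton off the carrier forces the limit to be extensional.\<close>
  let ?C = "\<lambda>x. if x \<in> gds_carrier X then {-1/2..1/2} else {undefined :: real}"
  have "compact (?C x)" for x by simp
  moreover have "v n x \<in> ?C x" for n x
    using K_tau_bounds[OF v, of x n] K_tau_extensional[of X] v[of n] by (auto simp: extensional_def abs_le_iff)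
  ultimately obtain G w where G: "G \<le> F" "G \<noteq> bot" and w: "\<And>x. w x \<in> ?C x"
    and lim: "\<And>x. ((\<lambda>n. v n x) \<longlongrightarrow> w x) G"
    using filter_cluster_point_pointwise[OF F, of ?C v] by blast
  have "w x = undefined" if "x \<notin> gds_carrier X" for x using w[of x] that by simp
  then have "w \<in> extensional (gds_carrier X)" by (simp add: extensional_def)
  then have "limitin (pointwise_topology (gds_carrier X)) v w G"
    using lim v K_tau_extensional[of X] by (auto simp: limitin_componentwise PiE_def subset_iff)
  then have wK: "w \<in> K_tau X"
    by (rule limitin_closedin) (use v G(2) in \<open>auto simp: K_tau_def\<close>)
  have "((\<lambda>n. L1_dist (gds_measure X) (v n) w) \<longlongrightarrow> 0) G"
  proof (rule tendstoI)
    fix e :: real assume e: "e > 0"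
    obtain P where P: "finite P" "P \<subseteq> gds_carrier X"
      "\<And>u v. u \<in> K_tau X \<Longrightarrow> v \<in> K_tau X \<Longrightarrow> (\<forall>p\<in>P. \<bar>u p - v p\<bar> < e/4) \<Longrightarrow>
         L1_dist (gds_measure X) u v < e/4 * 4"
      using K_tau_L1_le[OF X, of "e/4"] e by auto
    have "eventually (\<lambda>n. \<forall>p\<in>P. \<bar>v n p - w p\<bar> < e/4) G"
      using P(1) by (rule eventually_ball_finite)
        (use tendstoD[OF lim, of "e/4"] e in \<open>auto simp: dist_real_def\<close>)
    then show "eventually (\<lambda>n. dist (L1_dist (gds_measure X) (v n) w) 0 < e) G"
    proof eventually_elim
      case (elim n)
      have "0 \<le> L1_dist (gds_measure X) (v n) w" by (simp add: L1_dist_def)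
      then show ?case using P(3)[OF v wK elim] by simp
    qed
  qed
  then show ?thesis using that G wK by blast
qed

subsection \<open>Compactness of couplings\<close>

lemma closedin_borel_sets: "closedin T C \<Longrightarrow> C \<in> borel_sets T"
proof -
  assume C: "closedin T C"
  have "topspace T - (topspace T - C) \<in> borel_sets T"
    unfolding borel_sets_def by (intro sigma_sets.Compl sigma_sets.Basic) (use C in auto)
  moreover have "topspace T - (topspace T - C) = C" using closedin_subset[OF C] by auto
  ultimately show ?thesis by simp
qed

section \<open>Tightness and inner regularity of a single measure\<close>

lemma (in finite_measure) measure_UNION_geometric_le:
  assumes "\<And>m::nat. A m \<in> sets M" and "\<And>m. measure M (A m) \<le> e * (1/2) ^ Suc m"
  shows "measure M (\<Union>m. A m) \<le> e"
proof -
  have s: "(\<lambda>m. e * (1/2) ^ Suc m) sums e"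
    using sums_mult[OF power_half_series, of e] by simp
  have sm: "summable (\<lambda>m. measure M (A m))"
    by (rule summable_comparison_test'[OF sums_summable[OF s]]) (use assms(2) in auto)
  have "measure M (\<Union>m. A m) \<le> (\<Sum>m. measure M (A m))"
    by (rule finite_measure_subadditive_countably) (use assms(1) sm in auto)
  also have "\<dots> \<le> (\<Sum>m. e * (1/2) ^ Suc m)"
    by (rule suminf_le[OF assms(2) sm sums_summable[OF s]])
  also have "\<dots> = e" using s by (rule sums_unique[symmetric])
  finally show ?thesis .
qed

text \<open>Ulam's argument: for every mesh 1 / (m + 1) all but finitely many cells of a partition
  are discarded, at the price of e / 2^(m+1). What survives every cut is totally bounded, and its
  closure is compact by completeness.\<close>

lemma gds_tight:
  assumes X: "geometric_data_set X" and e: "e > 0"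
  shows "\<exists>K. compactin (gds_topology X) K \<and> measure (gds_measure X) (gds_carrier X - K) \<le> e"
proof -
  interpret prob_space "gds_measure X" by (rule gdsD[OF X])
  interpret Metric_space "gds_carrier X" "gds_dist X" by (rule gdsD[OF X])
  have "\<exists>i :: 'a \<Rightarrow> nat. i \<in> measurable (gds_measure X) (count_space UNIV) \<and>
    (\<forall>x\<in>gds_carrier X. \<forall>x'\<in>gds_carrier X. i x = i x' \<longrightarrow> gds_dist X x x' < 1 / Suc m)" for m :: nat
    using gds_fine_partition[OF X, of "1 / Suc m"] by (metis of_nat_0_less_iff zero_less_Suc zero_less_divide_1_iff)
  then obtain i :: "nat \<Rightarrow> 'a \<Rightarrow> nat"
    where im[measurable]: "\<And>m. i m \<in> measurable (gds_measure X) (count_space UNIV)"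
      and i: "\<And>m x x'. x \<in> gds_carrier X \<Longrightarrow> x' \<in> gds_carrier X \<Longrightarrow> i m x = i m x' \<Longrightarrow>
                gds_dist X x x' < 1 / Suc m"
    by metis
  define A where "A m n = {x \<in> space (gds_measure X). n \<le> i m x}" for m n
  have [measurable]: "A m n \<in> sets (gds_measure X)" for m n unfolding A_def by measurable
  have "\<exists>n. prob (A m n) \<le> e * (1/2) ^ Suc m" for m
  proof -
    have "(\<lambda>n. prob (A m n)) \<longlonglongrightarrow> prob (\<Inter>n. A m n)"
      by (rule finite_Lim_measure_decseq) (auto simp: A_def decseq_def)
    moreover have "(\<Inter>n. A m n) = {}" by (auto simp: A_def) (metis not_less_eq_eq)
    ultimately have "(\<lambda>n. prob (A m n)) \<longlonglongrightarrow> 0" by simp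
    then have "eventually (\<lambda>n. prob (A m n) < e * (1/2) ^ Suc m) sequentially"
      using e by (intro order_tendstoD(2)) auto
    then show ?thesis by (auto simp: eventually_sequentially intro: less_imp_le)
  qed
  then obtain n where n: "\<And>m. prob (A m (n m)) \<le> e * (1/2) ^ Suc m" by metis
  define S where "S = {x \<in> gds_carrier X. \<forall>m. i m x < n m}"
  have "mtotally_bounded S"
    unfolding mtotally_bounded_def
  proof (intro allI impI)
    fix d :: real assume "d > 0"
    then obtain m where m: "1 / Suc m < d" using nat_approx_posE by blast
    define r where "r k = (SOME x. x \<in> S \<and> i m x = k)" for k
    have r: "r (i m x) \<in> S" "i m (r (i m x)) = i m x" if "x \<in> S" for x
      using someI[of "\<lambda>y. y \<in> S \<and> i m y = i m x" x] that unfolding r_def by auto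
    have "x \<in> mball (r (i m x)) d" if x: "x \<in> S" for x
    proof -
      have "x \<in> gds_carrier X" "r (i m x) \<in> gds_carrier X" using r(1)[OF x] x by (auto simp: S_def)
      moreover from this have "gds_dist X (r (i m x)) x < 1 / Suc m" using i r(2)[OF x] by blast
      ultimately show ?thesis using m by simp
    qed
    moreover have "i m x < n m" if "x \<in> S" for x using that by (simp add: S_def)
    ultimately have "S \<subseteq> (\<Union>x\<in>r ` {..<n m} \<inter> S. mball x d)"
      using r(1) by (intro subsetI UN_I[of "r (i m _)"]) blast+
    then show "\<exists>K. finite K \<and> K \<subseteq> S \<and> S \<subseteq> (\<Union>x\<in>K. mball x d)"
      by (intro exI[of _ "r ` {..<n m} \<inter> S"]) auto
  qed
  then have K: "compactin mtopology (mtopology closure_of S)"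
    using mtotally_bounded_eq_compact_closure_of[OF gdsD(2)[OF X]] by blast
  have "gds_carrier X - mtopology closure_of S \<subseteq> (\<Union>m. A m (n m))"
  proof
    fix x assume x: "x \<in> gds_carrier X - mtopology closure_of S"
    then have "x \<notin> S" using closure_of_subset[of S mtopology] by (auto simp: S_def)
    then show "x \<in> (\<Union>m. A m (n m))" using x gdsD(5)[OF X] by (auto simp: S_def A_def not_less)
  qed
  then have "prob (gds_carrier X - mtopology closure_of S) \<le> prob (\<Union>m. A m (n m))"
    by (intro finite_measure_mono) auto
  also have "\<dots> \<le> e" by (rule measure_UNION_geometric_le[OF _ n]) simp
  finally show ?thesis using K by blast
qed

lemma gds_compact_closed:
  assumes X: "geometric_data_set X" and K: "compactin (gds_topology X) K"
  shows "closedin (gds_topology X) K"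
  using compactin_imp_closedin[OF Metric_space.Hausdorff_space_mtopology[OF gdsD(1)[OF X]] K] .

lemma gds_compact_sets:
  assumes X: "geometric_data_set X" and K: "compactin (gds_topology X) K"
  shows "K \<in> sets (gds_measure X)"
  using closedin_borel_sets[OF gds_compact_closed[OF X K]] gdsD(6)[OF X] by simp

text \<open>The sets that are inner regular together with their complement form a sigma-algebra. It
  contains the open sets: these are countable unions of closed sets, and a closed set is inner
  regular by tightness.\<close>

lemma gds_inner_regular:
  assumes X: "geometric_data_set X" and A: "A \<in> sets (gds_measure X)" and e: "e > 0"
  shows "\<exists>K. compactin (gds_topology X) K \<and> K \<subseteq> A \<and> measure (gds_measure X) (A - K) \<le> e"
proof -
  interpret prob_space "gds_measure X" by (rule gdsD[OF X])
  let ?T = "gds_topology X" and ?C = "gds_carrier X" and ?M = "gds_measure X"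
  define inner where "inner A \<longleftrightarrow> (\<forall>e>0. \<exists>K. compactin ?T K \<and> K \<subseteq> A \<and> prob (A - K) \<le> e)" for A
  have top: "topspace ?T = ?C" by (rule gdsD[OF X])
  have sub: "B \<subseteq> ?C" if "B \<in> sets ?M" for B using sets.sets_into_space[OF that] gdsD(5)[OF X] by simp
  have closed: "inner B" if B: "closedin ?T B" for B
    unfolding inner_def
  proof (intro allI impI)
    fix e :: real assume "e > 0"
    then obtain K where K: "compactin ?T K" "prob (?C - K) \<le> e" using gds_tight[OF X] by blast
    have "prob (B - B \<inter> K) \<le> prob (?C - K)"
      using closedin_subset[OF B] gds_compact_sets[OF X K(1)] sets.top[of ?M] gdsD(5)[OF X] top
      by (intro finite_measure_mono) auto
    then show "\<exists>K. compactin ?T K \<and> K \<subseteq> B \<and> prob (B - K) \<le> e"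
      using K closed_Int_compactin[OF B K(1)] by (intro exI[of _ "B \<inter> K"]) auto
  qed
  have exhaust: "inner (\<Union>n. B n)" if B: "\<And>n::nat. inner (B n)" "\<And>n. B n \<in> sets ?M" for B
    unfolding inner_def
  proof (intro allI impI)
    fix e :: real assume e: "e > 0"
    have "(e / 2) * (1/2) ^ Suc n > 0" for n using e by simp
    then have "\<forall>n. \<exists>K. compactin ?T K \<and> K \<subseteq> B n \<and> prob (B n - K) \<le> (e / 2) * (1/2) ^ Suc n"
      using B(1) unfolding inner_def by blast
    then obtain K where K: "\<And>n. compactin ?T (K n)" "\<And>n. K n \<subseteq> B n"
       "\<And>n. prob (B n - K n) \<le> (e / 2) * (1/2) ^ Suc n" by metis
    have [measurable]: "K n \<in> sets ?M" "B n \<in> sets ?M" for n using gds_compact_sets[OF X K(1)] B by auto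
    \<comment> \<open>An infinite union of compact sets need not be compact, so it is cut off at a
      finite stage. Half of \<open>e\<close> pays for the cut and the other half for the losses
      inside the \<open>B n\<close>.\<close>
    let ?D = "\<lambda>n. (\<Union>m. K m) - (\<Union>m<n. K m)"
    have "(\<lambda>n. prob (?D n)) \<longlonglongrightarrow> prob (\<Inter>n. ?D n)"
      by (rule finite_Lim_measure_decseq) (auto simp: decseq_def)
    moreover have "(\<Inter>n. ?D n) = {}" by auto
    ultimately have "(\<lambda>n. prob (?D n)) \<longlonglongrightarrow> 0" by (simp only: measure_empty)
    then have "eventually (\<lambda>n. prob (?D n) < e / 2) sequentially"
      using e by (intro order_tendstoD(2)) auto
    then obtain n where n: "prob (?D n) < e / 2" by (auto simp: eventually_sequentially)
    have "prob ((\<Union>m. B m) - (\<Union>m<n. K m)) \<le> prob ((\<Union>m. B m - K m) \<union> ?D n)"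
      by (intro finite_measure_mono) auto
    also have "\<dots> \<le> prob (\<Union>m. B m - K m) + prob (?D n)"
      by (intro measure_Un_le) auto
    also have "prob (\<Union>m. B m - K m) \<le> e / 2" by (rule measure_UNION_geometric_le[OF _ K(3)]) simp
    finally have "prob ((\<Union>m. B m) - (\<Union>m<n. K m)) \<le> e" using n by simp
    moreover have "compactin ?T (\<Union>m<n. K m)" using K(1) by (intro compactin_Union) auto
    ultimately show "\<exists>L. compactin ?T L \<and> L \<subseteq> (\<Union>n. B n) \<and> prob ((\<Union>n. B n) - L) \<le> e"
      using K(2) by (intro exI[of _ "\<Union>m<n. K m"]) blast
  qed
  have inter: "inner (\<Inter>n. B n)" if B: "\<And>n::nat. inner (B n)" "\<And>n. B n \<in> sets ?M" for B
    unfolding inner_def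
  proof (intro allI impI)
    fix e :: real assume e: "e > 0"
    have "e * (1/2) ^ Suc n > 0" for n using e by simp
    then have "\<forall>n. \<exists>K. compactin ?T K \<and> K \<subseteq> B n \<and> prob (B n - K) \<le> e * (1/2) ^ Suc n"
      using B(1) unfolding inner_def by blast
    then obtain K where K: "\<And>n. compactin ?T (K n)" "\<And>n. K n \<subseteq> B n"
       "\<And>n. prob (B n - K n) \<le> e * (1/2) ^ Suc n" by metis
    have [measurable]: "K n \<in> sets ?M" "B n \<in> sets ?M" for n using gds_compact_sets[OF X K(1)] B by auto
    have "prob ((\<Inter>n. B n) - (\<Inter>n. K n)) \<le> prob (\<Union>m. B m - K m)"
      by (intro finite_measure_mono) auto
    also have "\<dots> \<le> e" by (rule measure_UNION_geometric_le[OF _ K(3)]) simp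
    finally have "prob ((\<Inter>n. B n) - (\<Inter>n. K n)) \<le> e" .
    moreover have "compactin ?T (\<Inter>n. K n)"
      using closed_compactin_Inter[OF K(1)[of 0], of "range K"] gds_compact_closed[OF X K(1)] by blast
    ultimately show "\<exists>L. compactin ?T L \<and> L \<subseteq> (\<Inter>n. B n) \<and> prob ((\<Inter>n. B n) - L) \<le> e"
      using K(2) by (intro exI[of _ "\<Inter>n. K n"]) blast
  qed
  have "A \<in> sigma_sets ?C {U. openin ?T U}"
    using A gdsD(6)[OF X] top by (simp add: borel_sets_def)
  \<comment> \<open>Carrying the complement through the induction makes the complement case trivial
    and turns the union case into one union and one intersection.\<close>
  then have "inner A \<and> inner (?C - A) \<and> A \<in> sets ?M"
  proof induction
    case (Basic U)
    then have U: "openin ?T U" by simp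
    have "fsigma_in ?T U"
      by (rule open_imp_fsigma_in[OF _ U]) (use Metric_space.metrizable_space_mtopology[OF gdsD(1)[OF X]] in simp)
    then obtain F :: "nat \<Rightarrow> _" where F: "\<And>n. closedin ?T (F n)" "\<Union> (range F) = U"
      unfolding fsigma_in_ascending by blast
    have "F n \<in> sets ?M" for n using closedin_borel_sets[OF F(1)] gdsD(6)[OF X] by simp
    then have "inner (\<Union>n. F n)" by (intro exhaust closed F(1))
    moreover have "inner (?C - U)"
      using closed[OF closedin_diff[OF closedin_topspace U]] top by simp
    ultimately show ?case using F openin_borel_sets[OF U] gdsD(6)[OF X] by simp
  next
    case Empty
    have "inner {}" "inner ?C" using closed[OF closedin_empty] closed[OF closedin_topspace] top by auto
    then show ?case by simp
  next
    case (Compl B)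
    then have "?C - (?C - B) = B" using sub by blast
    then show ?case using Compl sets.compl_sets[of B ?M] gdsD(5)[OF X] by simp
  next
    case (Union B)
    have "inner (\<Inter>n. ?C - B n)"
      by (rule inter) (use Union sets.compl_sets[of _ ?M] gdsD(5)[OF X] in auto)
    moreover have "(\<Inter>n. ?C - B n) = ?C - (\<Union>n. B n)" by auto
    ultimately show ?case using exhaust[of B] Union by auto
  qed
  then show ?thesis using e by (auto simp: inner_def)
qed


section \<open>Couplings, their marginals and their limits\<close>

lemma gds_couplingD:
  assumes X: "geometric_data_set X" and Y: "geometric_data_set Y" and \<pi>: "\<pi> \<in> gds_couplings X Y"
  shows "prob_space \<pi>" "space \<pi> = gds_carrier X \<times> gds_carrier Y"
    "sets \<pi> = sets (gds_measure X \<Otimes>\<^sub>M gds_measure Y)"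
    "fst \<in> measurable \<pi> (gds_measure X)" "snd \<in> measurable \<pi> (gds_measure Y)"
    "distr \<pi> (gds_measure X) fst = gds_measure X" "distr \<pi> (gds_measure Y) snd = gds_measure Y"
proof -
  show sets: "sets \<pi> = sets (gds_measure X \<Otimes>\<^sub>M gds_measure Y)"
    using \<pi> by (simp add: gds_couplings_def sets_pair_gds[OF X Y])
  then show "fst \<in> measurable \<pi> (gds_measure X)" "snd \<in> measurable \<pi> (gds_measure Y)"
    by (simp_all add: measurable_cong_sets[OF sets refl])
qed (use \<pi> in \<open>auto simp: gds_couplings_def\<close>)

lemma gds_couplingI:
  assumes X: "geometric_data_set X" and Y: "geometric_data_set Y" and "prob_space \<pi>"
    and sets: "sets \<pi> = sets (gds_measure X \<Otimes>\<^sub>M gds_measure Y)"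
    and "distr \<pi> (gds_measure X) fst = gds_measure X" "distr \<pi> (gds_measure Y) snd = gds_measure Y"
  shows "\<pi> \<in> gds_couplings X Y"
  using assms sets_eq_imp_space_eq[OF sets]
  by (simp add: gds_couplings_def sets_pair_gds[OF X Y] space_pair_measure gdsD(5)[OF X] gdsD(5)[OF Y])

lemma gds_coupling_marginals:
  assumes X: "geometric_data_set X" and Y: "geometric_data_set Y" and \<pi>: "\<pi> \<in> gds_couplings X Y"
  shows "A \<in> sets (gds_measure X) \<Longrightarrow> measure \<pi> (A \<times> gds_carrier Y) = measure (gds_measure X) A"
    and "B \<in> sets (gds_measure Y) \<Longrightarrow> measure \<pi> (gds_carrier X \<times> B) = measure (gds_measure Y) B"
proof -
  note c = gds_couplingD[OF X Y \<pi>]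
  show "measure \<pi> (A \<times> gds_carrier Y) = measure (gds_measure X) A" if A: "A \<in> sets (gds_measure X)"
  proof -
    have "fst -` A \<inter> space \<pi> = A \<times> gds_carrier Y"
      using sets.sets_into_space[OF A] gdsD(5)[OF X] c(2) by auto
    then show ?thesis using measure_distr[OF c(4) A] c(6) by simp
  qed
  show "measure \<pi> (gds_carrier X \<times> B) = measure (gds_measure Y) B" if B: "B \<in> sets (gds_measure Y)"
  proof -
    have "snd -` B \<inter> space \<pi> = gds_carrier X \<times> B"
      using sets.sets_into_space[OF B] gdsD(5)[OF Y] c(2) by auto
    then show ?thesis using measure_distr[OF c(5) B] c(7) by simp
  qed
qed

text \<open>
  The limit is taken along a filter for which all the numbers \<open>measure (\<pi> n) E\<close> converge at once.
  It is only finitely additive, but the marginals are inner regular with respect to compact sets,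
  which makes it countably additive on an algebra containing all measurable rectangles.
\<close>

lemma gds_coupling_limit:
  assumes X: "geometric_data_set X" and Y: "geometric_data_set Y"
    and \<pi>: "\<And>n. \<pi> n \<in> gds_couplings X Y" and F: "F \<noteq> bot"
  obtains G \<rho> where "G \<le> F" "G \<noteq> bot" "\<rho> \<in> gds_couplings X Y"
    "\<And>A B. A \<in> sets (gds_measure X) \<Longrightarrow> B \<in> sets (gds_measure Y) \<Longrightarrow>
       ((\<lambda>n. measure (\<pi> n) (A \<times> B)) \<longlongrightarrow> measure \<rho> (A \<times> B)) G"
proof -
  let ?P = "gds_measure X \<Otimes>\<^sub>M gds_measure Y"
  let ?CX = "gds_carrier X" and ?CY = "gds_carrier Y"
  let ?\<Omega> = "?CX \<times> ?CY"
  let ?T = "prod_topology (gds_topology X) (gds_topology Y)"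
  note c = gds_couplingD[OF X Y \<pi>]
  have spP: "space ?P = ?\<Omega>" by (simp add: space_pair_measure gdsD(5)[OF X] gdsD(5)[OF Y])
  have CX: "?CX \<in> sets (gds_measure X)" and CY: "?CY \<in> sets (gds_measure Y)"
    using sets.top[of "gds_measure X"] sets.top[of "gds_measure Y"] gdsD(5)[OF X] gdsD(5)[OF Y] by auto
  have "measure (\<pi> n) E \<in> {0..1}" for n E
    using prob_space.prob_le_1[OF c(1)] by simp
  then obtain G \<gamma> where G: "G \<le> F" "G \<noteq> bot" and \<gamma>01: "\<And>E. \<gamma> E \<in> {0..1::real}"
    and lim: "\<And>E. ((\<lambda>n. measure (\<pi> n) E) \<longlongrightarrow> \<gamma> E) G"
    using filter_cluster_point_pointwise[OF F, of "\<lambda>_. {0..1}" "\<lambda>n E. measure (\<pi> n) E"] by blast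
  have fin: "finite_measure (\<pi> n)" for n using c(1) by (rule prob_space.finite_measure)
  have mono: "\<gamma> E \<le> \<gamma> E'" if "E \<subseteq> E'" "E' \<in> sets ?P" for E E'
    by (rule tendsto_le[OF G(2) lim lim], rule always_eventually, rule allI,
        rule finite_measure.finite_measure_mono[OF fin]) (use that c(3) in auto)
  have subadd: "\<gamma> (E \<union> E') \<le> \<gamma> E + \<gamma> E'" if "E \<in> sets ?P" "E' \<in> sets ?P" for E E'
    by (rule tendsto_le[OF G(2) tendsto_add[OF lim lim] lim], rule always_eventually, rule allI,
        rule measure_Un_le) (use that c(3) in auto)
  have add: "\<gamma> (E \<union> E') = \<gamma> E + \<gamma> E'" if "E \<in> sets ?P" "E' \<in> sets ?P" "E \<inter> E' = {}" for E E'
  proof (rule tendsto_unique[OF G(2) lim])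
    have "measure (\<pi> n) (E \<union> E') = measure (\<pi> n) E + measure (\<pi> n) E'" for n
      using that c(3) by (intro finite_measure.finite_measure_Union[OF fin]) auto
    then show "((\<lambda>n. measure (\<pi> n) (E \<union> E')) \<longlongrightarrow> \<gamma> E + \<gamma> E') G"
      using tendsto_add[OF lim[of E] lim[of E']] by simp
  qed
  have marg: "\<gamma> (A \<times> ?CY) = measure (gds_measure X) A" if "A \<in> sets (gds_measure X)" for A
    using lim[of "A \<times> ?CY"] G(2) by (simp add: gds_coupling_marginals[OF X Y \<pi>] that tendsto_const_iff)
  have marg': "\<gamma> (?CX \<times> B) = measure (gds_measure Y) B" if "B \<in> sets (gds_measure Y)" for B
    using lim[of "?CX \<times> B"] G(2) by (simp add: gds_coupling_marginals[OF X Y \<pi>] that tendsto_const_iff)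
  have Haus: "Hausdorff_space ?T"
    using Metric_space.Hausdorff_space_mtopology[OF gdsD(1)[OF X]]
      Metric_space.Hausdorff_space_mtopology[OF gdsD(1)[OF Y]] by (simp add: Hausdorff_space_prod_topology)
  have Kclosed: "closedin ?T K" and Ksets: "K \<in> sets ?P" if "compactin ?T K" for K
    using compactin_imp_closedin[OF Haus that] closedin_borel_sets by (auto simp: sets_pair_gds[OF X Y])
  \<comment> \<open>Inner regularity of the finitely additive set function \<open>\<gamma>\<close>,
    with compact subsets of the product as approximants.\<close>
  define inner where "inner E \<longleftrightarrow> (\<forall>e>0. \<exists>K. compactin ?T K \<and> K \<subseteq> E \<and> \<gamma> (E - K) \<le> e)" for E
  have inner_Un: "inner (E \<union> E')" and inner_Int: "inner (E \<inter> E')"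
    if E: "inner E" "inner E'" "E \<in> sets ?P" "E' \<in> sets ?P" for E E'
  proof -
    have "\<exists>K K'. compactin ?T K \<and> compactin ?T K' \<and> K \<subseteq> E \<and> K' \<subseteq> E' \<and> \<gamma> ((E - K) \<union> (E' - K')) \<le> e"
      if e: "e > 0" for e
    proof -
      obtain K K' where K: "compactin ?T K" "K \<subseteq> E" "\<gamma> (E - K) \<le> e/2"
        "compactin ?T K'" "K' \<subseteq> E'" "\<gamma> (E' - K') \<le> e/2"
        using E(1,2) half_gt_zero[OF e] unfolding inner_def by blast
      have "\<gamma> ((E - K) \<union> (E' - K')) \<le> \<gamma> (E - K) + \<gamma> (E' - K')"
        using E K Ksets by (intro subadd) auto
      then show ?thesis using K by force
    qed
    note * = this
    show "inner (E \<union> E')"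
      unfolding inner_def
    proof (intro allI impI)
      fix e :: real assume "e > 0"
      with * obtain K K' where K: "compactin ?T K" "compactin ?T K'" "K \<subseteq> E" "K' \<subseteq> E'"
        "\<gamma> ((E - K) \<union> (E' - K')) \<le> e" by blast
      have "\<gamma> (E \<union> E' - (K \<union> K')) \<le> \<gamma> ((E - K) \<union> (E' - K'))"
        using E K Ksets by (intro mono) auto
      then show "\<exists>K. compactin ?T K \<and> K \<subseteq> E \<union> E' \<and> \<gamma> (E \<union> E' - K) \<le> e"
        using K compactin_Un[OF K(1,2)] by (intro exI[of _ "K \<union> K'"]) auto
    qed
    show "inner (E \<inter> E')"
      unfolding inner_def
    proof (intro allI impI)
      fix e :: real assume "e > 0"
      with * obtain K K' where K: "compactin ?T K" "compactin ?T K'" "K \<subseteq> E" "K' \<subseteq> E'"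
        "\<gamma> ((E - K) \<union> (E' - K')) \<le> e" by blast
      have "\<gamma> (E \<inter> E' - (K \<inter> K')) \<le> \<gamma> ((E - K) \<union> (E' - K'))"
        using E K Ksets by (intro mono) auto
      then show "\<exists>K. compactin ?T K \<and> K \<subseteq> E \<inter> E' \<and> \<gamma> (E \<inter> E' - K) \<le> e"
        using K closed_Int_compactin[OF Kclosed[OF K(1)] K(2)] by (intro exI[of _ "K \<inter> K'"]) auto
    qed
  qed
  have inner_rect: "inner (A \<times> B)" if A: "A \<in> sets (gds_measure X)" and B: "B \<in> sets (gds_measure Y)" for A B
    unfolding inner_def
  proof (intro allI impI)
    fix e :: real assume "e > 0"
    then have "e / 2 > 0" by simp
    obtain K where K: "compactin (gds_topology X) K" "K \<subseteq> A" "measure (gds_measure X) (A - K) \<le> e/2"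
      using gds_inner_regular[OF X A \<open>e / 2 > 0\<close>] by blast
    obtain L where L: "compactin (gds_topology Y) L" "L \<subseteq> B" "measure (gds_measure Y) (B - L) \<le> e/2"
      using gds_inner_regular[OF Y B \<open>e / 2 > 0\<close>] by blast
    have m: "A - K \<in> sets (gds_measure X)" "B - L \<in> sets (gds_measure Y)"
      using A B gds_compact_sets[OF X K(1)] gds_compact_sets[OF Y L(1)] by auto
    \<comment> \<open>What is lost lies in two strips over the whole of the other factor. On strips
      \<open>\<gamma>\<close> equals a fixed marginal, which is already known to be inner
      regular.\<close>
    have "\<gamma> (A \<times> B - K \<times> L) \<le> \<gamma> ((A - K) \<times> ?CY \<union> ?CX \<times> (B - L))"
      using sets.sets_into_space[OF A] sets.sets_into_space[OF B] gdsD(5)[OF X] gdsD(5)[OF Y] m CX CY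
      by (intro mono) auto
    also have "\<dots> \<le> \<gamma> ((A - K) \<times> ?CY) + \<gamma> (?CX \<times> (B - L))"
      using m CX CY by (intro subadd) auto
    also have "\<dots> \<le> e" using marg[OF m(1)] marg'[OF m(2)] K(3) L(3) by simp
    finally show "\<exists>K. compactin ?T K \<and> K \<subseteq> A \<times> B \<and> \<gamma> (A \<times> B - K) \<le> e"
      using K L by (intro exI[of _ "K \<times> L"]) (auto simp: compactin_Times)
  qed
  \<comment> \<open>Inner regularity alone is not visibly stable under complements; asking for it on
    both sides yields an algebra.\<close>
  define R where "R = {E \<in> sets ?P. inner E \<and> inner (?\<Omega> - E)}"
  have rect: "A \<times> B \<in> R" if A: "A \<in> sets (gds_measure X)" and B: "B \<in> sets (gds_measure Y)" for A B
  proof -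
    have m: "?CX - A \<in> sets (gds_measure X)" "?CY - B \<in> sets (gds_measure Y)" using A B CX CY by auto
    have "inner ((?CX - A) \<times> ?CY \<union> ?CX \<times> (?CY - B))"
      using m CX CY by (intro inner_Un inner_rect) auto
    moreover have "(?CX - A) \<times> ?CY \<union> ?CX \<times> (?CY - B) = ?\<Omega> - A \<times> B"
      using sets.sets_into_space[OF A] sets.sets_into_space[OF B] gdsD(5)[OF X] gdsD(5)[OF Y] by auto
    ultimately show ?thesis using A B inner_rect[OF A B] by (simp add: R_def)
  qed
  have sub\<Omega>: "E \<subseteq> ?\<Omega>" if "E \<in> sets ?P" for E using sets.sets_into_space[OF that] spP by simp
  interpret alg: algebra ?\<Omega> R
    unfolding algebra_iff_Un
  proof (intro conjI ballI)
    show "R \<subseteq> Pow ?\<Omega>" using sub\<Omega> by (auto simp: R_def)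
    show "{} \<in> R" using rect[of "{}" "{}"] by simp
    show "?\<Omega> - E \<in> R" if "E \<in> R" for E
    proof -
      have "?\<Omega> - (?\<Omega> - E) = E" using that sub\<Omega> by (auto simp: R_def)
      then show ?thesis using that sets.compl_sets[of E ?P] spP by (simp add: R_def)
    qed
    show "E \<union> E' \<in> R" if "E \<in> R" "E' \<in> R" for E E'
    proof -
      have m: "?\<Omega> - E \<in> sets ?P" "?\<Omega> - E' \<in> sets ?P"
        using that sets.compl_sets[of _ ?P] spP by (auto simp: R_def)
      have "inner ((?\<Omega> - E) \<inter> (?\<Omega> - E'))" using that m by (intro inner_Int) (auto simp: R_def)
      moreover have "(?\<Omega> - E) \<inter> (?\<Omega> - E') = ?\<Omega> - (E \<union> E')" by auto
      ultimately show ?thesis using that inner_Un[of E E'] by (auto simp: R_def)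
    qed
  qed
  \<comment> \<open>Continuity at the empty set by compactness: the \<open>E n\<close> are replaced
    by compact \<open>K n\<close> inside them. The finite intersections of the \<open>K n\<close>
    shrink to the empty set, so one of them is already empty, and up to that stage the losses sum to
    less than \<open>e\<close>.\<close>
  have empty_cont: "(\<lambda>n. \<gamma> (E n)) \<longlonglongrightarrow> 0"
    if E: "range E \<subseteq> R" "decseq E" "(\<Inter>n. E n) = {}" for E :: "nat \<Rightarrow> _"
  proof (rule LIMSEQ_I)
    fix r :: real assume r: "r > 0"
    define e where "e = r / 2"
    have e: "e > 0" using r by (simp add: e_def)
    then have "e * (1/2) ^ Suc n > 0" for n by simp
    moreover have "inner (E n)" for n using E(1) by (auto simp: R_def)
    ultimately have "\<forall>n. \<exists>K. compactin ?T K \<and> K \<subseteq> E n \<and> \<gamma> (E n - K) \<le> e * (1/2) ^ Suc n"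
      unfolding inner_def by blast
    then obtain K where K: "\<And>n. compactin ?T (K n)" "\<And>n. K n \<subseteq> E n"
        "\<And>n. \<gamma> (E n - K n) \<le> e * (1/2) ^ Suc n" by metis
    have Em: "E n \<in> sets ?P" for n using E(1) by (auto simp: R_def)
    define L where "L n = (\<Inter>m\<le>n. K m)" for n
    have Lc: "closedin ?T (L n)" for n unfolding L_def by (intro closedin_INT Kclosed K(1)) auto
    have Lm: "L n \<in> sets ?P" for n using closedin_borel_sets[OF Lc] by (simp add: sets_pair_gds[OF X Y])
    \<comment> \<open>The right-hand side is the partial sum of the geometric losses e / 2^(m+1) for
      m up to n.\<close>
    have le: "\<gamma> (E n - L n) \<le> e * (1 - (1/2) ^ Suc n)" for n
    proof (induction n)
      case 0
      then show ?case using K(3)[of 0] by (simp add: L_def)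
    next
      case (Suc n)
      have "\<gamma> (E (Suc n) - L (Suc n)) \<le> \<gamma> ((E n - L n) \<union> (E (Suc n) - K (Suc n)))"
      proof (rule mono)
        show "E (Suc n) - L (Suc n) \<subseteq> (E n - L n) \<union> (E (Suc n) - K (Suc n))"
          using decseq_SucD[OF E(2), of n] by (auto simp: L_def atMost_Suc)
      qed (use Em Lm Ksets[OF K(1)] in auto)
      also have "\<dots> \<le> \<gamma> (E n - L n) + \<gamma> (E (Suc n) - K (Suc n))"
        using Em Lm Ksets[OF K(1)] by (intro subadd) auto
      also have "\<dots> \<le> e * (1 - (1/2) ^ Suc n) + e * (1/2) ^ Suc (Suc n)" using Suc K(3)[of "Suc n"] by simp
      also have "\<dots> = e * (1 - (1/2) ^ Suc (Suc n))" by (simp add: algebra_simps)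
      finally show ?case .
    qed
    have "\<exists>N. L N = {}"
    proof (rule ccontr)
      assume "\<nexists>N. L N = {}"
      moreover have "compact_space (subtopology ?T (K 0))" using K(1)[of 0] by (simp add: compactin_subspace)
      moreover have "closedin (subtopology ?T (K 0)) (L n)" for n
        using Lc by (intro closedin_subset_topspace) (auto simp: L_def)
      moreover have "decseq L" by (force simp: decseq_def L_def)
      ultimately have "(\<Inter>n. L n) \<noteq> {}" by (intro compact_space_imp_nest) auto
      moreover have "(\<Inter>n. L n) \<subseteq> (\<Inter>n. E n)" using K(2) by (force simp: L_def)
      ultimately show False using E(3) by simp
    qed
    then obtain N where N: "L N = {}" by blast
    have "norm (\<gamma> (E n) - 0) < r" if "n \<ge> N" for n
    proof -
      have "\<gamma> (E n) \<le> \<gamma> (E N)" using decseqD[OF E(2) that] Em by (rule mono)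
      also have "\<dots> \<le> e * (1 - (1/2) ^ Suc N)" using le[of N] N by simp
      also have "\<dots> \<le> e * 1" using e by (intro mult_left_mono) auto
      also have "\<dots> < r" using r by (simp add: e_def)
      finally show ?thesis using \<gamma>01[of "E n"] by simp
    qed
    then show "\<exists>N. \<forall>n\<ge>N. norm (\<gamma> (E n) - 0) < r" by blast
  qed
  have \<gamma>0: "\<gamma> {} = 0" using add[of "{}" "{}"] by simp
  \<comment> \<open>For a finite additive set function on an algebra, continuity at the empty set is
    what the Caratheodory extension asks for.\<close>
  have "\<exists>\<mu>. (\<forall>s\<in>R. \<mu> s = ennreal (\<gamma> s)) \<and> measure_space ?\<Omega> (sigma_sets ?\<Omega> R) \<mu>"
  proof (rule alg.caratheodory_empty_continuous)
    show "positive R (\<lambda>E. ennreal (\<gamma> E))" by (simp add: positive_def \<gamma>0)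
    show "Measure_Space.additive R (\<lambda>E. ennreal (\<gamma> E))"
    proof (unfold additive_def, intro ballI impI)
      fix E E' assume "E \<in> R" "E' \<in> R" "E \<inter> E' = {}"
      then have "\<gamma> (E \<union> E') = \<gamma> E + \<gamma> E'" by (intro add) (auto simp: R_def)
      then show "ennreal (\<gamma> (E \<union> E')) = ennreal (\<gamma> E) + ennreal (\<gamma> E')"
        using \<gamma>01[of E] \<gamma>01[of E'] by (simp add: ennreal_plus)
    qed
    show "(\<lambda>n. ennreal (\<gamma> (E n))) \<longlonglongrightarrow> 0"
      if "range E \<subseteq> R" "decseq E" "(\<Inter>n. E n) = {}" for E :: "nat \<Rightarrow> _"
      using tendsto_ennrealI[OF empty_cont[OF that]] by simp
  qed simp
  then obtain \<mu> where \<mu>: "\<And>s. s \<in> R \<Longrightarrow> \<mu> s = ennreal (\<gamma> s)"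
    and ms: "measure_space ?\<Omega> (sigma_sets ?\<Omega> R) \<mu>" by blast
  have gen: "sigma_sets ?\<Omega> R = sets ?P"
  proof
    show "sigma_sets ?\<Omega> R \<subseteq> sets ?P"
      unfolding spP[symmetric] by (rule sets.sigma_sets_subset) (auto simp: R_def)
    show "sets ?P \<subseteq> sigma_sets ?\<Omega> R"
      unfolding sets_pair_measure spP[unfolded space_pair_measure]
      by (rule sigma_sets_mono) (use rect in \<open>auto intro: sigma_sets.Basic\<close>)
  qed
  define \<rho> where "\<rho> = measure_of ?\<Omega> (sets ?P) \<mu>"
  have ms': "sigma_algebra ?\<Omega> (sets ?P)" "positive (sets ?P) \<mu>" "countably_additive (sets ?P) \<mu>"
    using ms by (simp_all add: gen measure_space_def)
  have sets\<rho>: "sets \<rho> = sets ?P"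
    unfolding \<rho>_def using ms'(1) by (rule sigma_algebra.sets_measure_of_eq)
  have space\<rho>: "space \<rho> = ?\<Omega>" using sets_eq_imp_space_eq[OF sets\<rho>] spP by simp
  have em: "emeasure \<rho> (A \<times> B) = ennreal (\<gamma> (A \<times> B))"
    if "A \<in> sets (gds_measure X)" "B \<in> sets (gds_measure Y)" for A B
    unfolding \<rho>_def using emeasure_measure_of_sigma[OF ms', of "A \<times> B"] that \<mu>[OF rect[OF that]] by simp
  have me: "measure \<rho> (A \<times> B) = \<gamma> (A \<times> B)"
    if "A \<in> sets (gds_measure X)" "B \<in> sets (gds_measure Y)" for A B
    using em[OF that] \<gamma>01[of "A \<times> B"] by (simp add: measure_def)
  interpret PX: prob_space "gds_measure X" by (rule gdsD[OF X])
  interpret PY: prob_space "gds_measure Y" by (rule gdsD[OF Y])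
  have "prob_space \<rho>"
    by (rule prob_spaceI) (use em[OF CX CY] marg[OF CX] PX.prob_space gdsD(5)[OF X] space\<rho> in simp)
  moreover have mf: "fst \<in> measurable \<rho> (gds_measure X)" "snd \<in> measurable \<rho> (gds_measure Y)"
    by (simp_all add: measurable_cong_sets[OF sets\<rho> refl])
  have "distr \<rho> (gds_measure X) fst = gds_measure X"
  proof (rule measure_eqI)
    fix A assume "A \<in> sets (distr \<rho> (gds_measure X) fst)"
    then have A: "A \<in> sets (gds_measure X)" by simp
    have "fst -` A \<inter> space \<rho> = A \<times> ?CY"
      using sets.sets_into_space[OF A] gdsD(5)[OF X] space\<rho> by auto
    then show "emeasure (distr \<rho> (gds_measure X) fst) A = emeasure (gds_measure X) A"
      using emeasure_distr[OF mf(1) A] em[OF A CY] marg[OF A] by (simp add: PX.emeasure_eq_measure)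
  qed simp
  moreover have "distr \<rho> (gds_measure Y) snd = gds_measure Y"
  proof (rule measure_eqI)
    fix B assume "B \<in> sets (distr \<rho> (gds_measure Y) snd)"
    then have B: "B \<in> sets (gds_measure Y)" by simp
    have "snd -` B \<inter> space \<rho> = ?CX \<times> B"
      using sets.sets_into_space[OF B] gdsD(5)[OF Y] space\<rho> by auto
    then show "emeasure (distr \<rho> (gds_measure Y) snd) B = emeasure (gds_measure Y) B"
      using emeasure_distr[OF mf(2) B] em[OF CX B] marg'[OF B] by (simp add: PY.emeasure_eq_measure)
  qed simp
  ultimately have "\<rho> \<in> gds_couplings X Y" using sets\<rho> by (intro gds_couplingI[OF X Y])
  then show ?thesis using that[OF G, of \<rho>] lim me by simp
qed

subsection \<open>Optimal couplings\<close>

lemma L1_dist_nonneg: "0 \<le> L1_dist M f g"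
  by (simp add: L1_dist_def)

lemma L1_dist_commute: "L1_dist M f g = L1_dist M g f"
  by (simp add: L1_dist_def abs_minus_commute)

lemma L1_dist_triangle:
  assumes "integrable M f" "integrable M g" "integrable M h"
  shows "L1_dist M f h \<le> L1_dist M f g + L1_dist M g h"
proof -
  have "L1_dist M f h \<le> (\<integral>p. \<bar>f p - g p\<bar> + \<bar>g p - h p\<bar> \<partial>M)"
    unfolding L1_dist_def using assms by (intro integral_mono) auto
  also have "\<dots> = L1_dist M f g + L1_dist M g h"
    unfolding L1_dist_def using assms by (intro Bochner_Integration.integral_add) auto
  finally show ?thesis .
qed

lemma K_tau_comp_measurable:
  assumes X: "geometric_data_set X" and u: "u \<in> K_tau X" and "\<phi> \<in> measurable M (gds_measure X)"
  shows "u \<circ> \<phi> \<in> borel_measurable M"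
  using measurable_comp[OF assms(3) K_tau_measurable[OF X u]] .

lemma K_tau_comp_bounds:
  assumes X: "geometric_data_set X" and u: "u \<in> K_tau X" and "\<phi> \<in> measurable M (gds_measure X)"
    and "p \<in> space M"
  shows "\<bar>(u \<circ> \<phi>) p\<bar> \<le> 1/2"
  using K_tau_bounds[OF u, of "\<phi> p"] measurable_space[OF assms(3,4)] gdsD(5)[OF X] by simp

lemma K_tau_comp_integrable:
  assumes X: "geometric_data_set X" and u: "u \<in> K_tau X" and M: "prob_space M"
    and \<phi>: "\<phi> \<in> measurable M (gds_measure X)"
  shows "integrable M (u \<circ> \<phi>)"
proof -
  interpret prob_space M by fact
  show ?thesis
    by (rule integrable_const_bound[where B = "1/2"])
      (use K_tau_comp_bounds[OF X u \<phi>] K_tau_comp_measurable[OF X u \<phi>] in \<open>auto intro!: AE_I2\<close>)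
qed

lemma L1_dist_comp:
  assumes X: "geometric_data_set X" and u: "u \<in> K_tau X" and v: "v \<in> K_tau X"
    and \<phi>: "\<phi> \<in> measurable M (gds_measure X)" "distr M (gds_measure X) \<phi> = gds_measure X"
  shows "L1_dist M (u \<circ> \<phi>) (v \<circ> \<phi>) = L1_dist (gds_measure X) u v"
proof -
  have [measurable]: "u \<in> borel_measurable (gds_measure X)" "v \<in> borel_measurable (gds_measure X)"
    using K_tau_measurable[OF X] u v by auto
  have "L1_dist (distr M (gds_measure X) \<phi>) u v = L1_dist M (u \<circ> \<phi>) (v \<circ> \<phi>)"
    unfolding L1_dist_def using \<phi>(1) by (subst integral_distr) auto
  then show ?thesis using \<phi>(2) by simp
qed

lemma L1_dist_coupling_le_1:
  assumes X: "geometric_data_set X" and Y: "geometric_data_set Y" and \<pi>: "\<pi> \<in> gds_couplings X Y"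
    and u: "u \<in> K_tau X" and v: "v \<in> K_tau Y"
  shows "L1_dist \<pi> (u \<circ> fst) (v \<circ> snd) \<le> 1"
proof -
  note c = gds_couplingD[OF X Y \<pi>]
  interpret prob_space \<pi> by (rule c)
  have "L1_dist \<pi> (u \<circ> fst) (v \<circ> snd) \<le> (\<integral>p. 1 \<partial>\<pi>)"
    unfolding L1_dist_def
  proof (rule integral_mono)
    show "integrable \<pi> (\<lambda>p. \<bar>(u \<circ> fst) p - (v \<circ> snd) p\<bar>)"
      using K_tau_comp_integrable[OF X u c(1,4)] K_tau_comp_integrable[OF Y v c(1,5)]
      by (intro integrable_abs Bochner_Integration.integrable_diff)
    fix p assume p: "p \<in> space \<pi>"
    show "\<bar>(u \<circ> fst) p - (v \<circ> snd) p\<bar> \<le> 1"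
      using K_tau_comp_bounds[OF X u c(4) p] K_tau_comp_bounds[OF Y v c(5) p] by linarith
  qed simp
  then show ?thesis by (simp add: prob_space)
qed

lemma K_tau_level_sets:
  assumes X: "geometric_data_set X" and u: "u \<in> K_tau X"
  shows "{x \<in> gds_carrier X. \<lfloor>c * u x\<rfloor> = i} \<in> sets (gds_measure X)"
proof -
  have [measurable]: "u \<in> borel_measurable (gds_measure X)" by (rule K_tau_measurable[OF X u])
  have "{x \<in> space (gds_measure X). \<lfloor>c * u x\<rfloor> = i} \<in> sets (gds_measure X)" by measurable
  then show ?thesis by (simp add: gdsD(5)[OF X])
qed

text \<open>Limits of couplings are only known on rectangles, so the L1 distance is expressed
  through finitely many of them. Rounding \<open>u\<close> and \<open>v\<close> down to multiples of
  1 / N costs 1 / N each, and the resulting error does not depend on the coupling.\<close>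

lemma L1_dist_step_approx:
  assumes X: "geometric_data_set X" and Y: "geometric_data_set Y" and \<pi>: "\<pi> \<in> gds_couplings X Y"
    and u: "u \<in> K_tau X" and v: "v \<in> K_tau Y" and N: "N > 0"
  shows "\<bar>L1_dist \<pi> (u \<circ> fst) (v \<circ> snd) -
    (\<Sum>i\<in>{-int N..int N}. \<Sum>j\<in>{-int N..int N}. \<bar>of_int i - of_int j\<bar> / N *
       measure \<pi> ({x \<in> gds_carrier X. \<lfloor>N * u x\<rfloor> = i} \<times> {y \<in> gds_carrier Y. \<lfloor>N * v y\<rfloor> = j}))\<bar> \<le> 2 / N"
proof -
  note c = gds_couplingD[OF X Y \<pi>]
  interpret prob_space \<pi> by (rule c)
  let ?I = "{-int N..int N}"
  let ?A = "\<lambda>i. {x \<in> gds_carrier X. \<lfloor>N * u x\<rfloor> = i}" and ?B = "\<lambda>j. {y \<in> gds_carrier Y. \<lfloor>N * v y\<rfloor> = j}"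
  let ?g = "\<lambda>p. \<Sum>i\<in>?I. \<Sum>j\<in>?I. \<bar>of_int i - of_int j\<bar> / N * indicat_real (?A i \<times> ?B j) p"
  let ?f = "\<lambda>p. \<bar>(u \<circ> fst) p - (v \<circ> snd) p\<bar>"
  have AB: "?A i \<times> ?B j \<in> sets \<pi>" for i j
    unfolding c(3) using K_tau_level_sets[OF X u] K_tau_level_sets[OF Y v] by (intro pair_measureI)
  have int: "integrable \<pi> (\<lambda>p. \<bar>of_int i - of_int j\<bar> / N * indicat_real (?A i \<times> ?B j) p)" for i j
    using AB by (intro integrable_mult_right integrable_real_indicator) (auto simp: less_top[symmetric])
  have g: "integrable \<pi> ?g" by (intro Bochner_Integration.integrable_sum int)
  have f: "integrable \<pi> ?f"
    using K_tau_comp_integrable[OF X u c(1,4)] K_tau_comp_integrable[OF Y v c(1,5)]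
    by (intro integrable_abs Bochner_Integration.integrable_diff)
  have "integral\<^sup>L \<pi> ?g = (\<Sum>i\<in>?I. \<integral>p. (\<Sum>j\<in>?I. \<bar>of_int i - of_int j\<bar> / N * indicat_real (?A i \<times> ?B j) p) \<partial>\<pi>)"
    by (rule Bochner_Integration.integral_sum) (intro Bochner_Integration.integrable_sum int)
  also have "\<dots> = (\<Sum>i\<in>?I. \<Sum>j\<in>?I. \<integral>p. \<bar>of_int i - of_int j\<bar> / N * indicat_real (?A i \<times> ?B j) p \<partial>\<pi>)"
    by (intro sum.cong refl Bochner_Integration.integral_sum int)
  also have "\<dots> = (\<Sum>i\<in>?I. \<Sum>j\<in>?I. \<bar>of_int i - of_int j\<bar> / N * measure \<pi> (?A i \<times> ?B j))"
    by (intro sum.cong refl, subst integral_mult_right_zero)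
      (simp add: sets.Int_space_eq1[OF AB] sets.Int_space_eq2[OF AB])
  finally have "integral\<^sup>L \<pi> ?g =
    (\<Sum>i\<in>?I. \<Sum>j\<in>?I. \<bar>of_int i - of_int j\<bar> / N * measure \<pi> (?A i \<times> ?B j))" .
  moreover have "\<bar>integral\<^sup>L \<pi> ?f - integral\<^sup>L \<pi> ?g\<bar> \<le> 2 / N"
  proof -
    have le: "\<bar>?f p - ?g p\<bar> \<le> 2 / N" if p: "p \<in> space \<pi>" for p
    proof -
      obtain x y where xy: "p = (x, y)" "x \<in> gds_carrier X" "y \<in> gds_carrier Y" using p c(2) by auto
      let ?a = "\<lfloor>N * u x\<rfloor>" and ?b = "\<lfloor>N * v y\<rfloor>"
      have u': "- real N \<le> N * u x" "N * u x \<le> N" and v': "- real N \<le> N * v y" "N * v y \<le> N"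
      proof -
        have "\<bar>real N * w\<bar> \<le> N" if "\<bar>w\<bar> \<le> 1/2" for w
          unfolding abs_mult using mult_left_mono[of "\<bar>w\<bar>" 1 "real N"] that by simp
        then show "- real N \<le> N * u x" "N * u x \<le> N" "- real N \<le> N * v y" "N * v y \<le> N"
          using K_tau_bounds[OF u xy(2)] K_tau_bounds[OF v xy(3)] by (simp_all add: abs_le_iff minus_le_iff)
      qed
      \<comment> \<open>The range of summation contains the cells of all points, so exactly one term
        of the double sum survives at \<open>p\<close>.\<close>
      have a: "?a \<in> ?I" "?b \<in> ?I" using u' v' by (auto simp: le_floor_iff floor_le_iff)
      have "?g p = (\<Sum>i\<in>?I. \<Sum>j\<in>?I. if i = ?a then (if j = ?b then \<bar>of_int i - of_int j\<bar> / N else 0) else 0)"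
        using xy by (intro sum.cong refl) (auto simp: indicator_def)
      also have "\<dots> = (\<Sum>i\<in>?I. if i = ?a then \<bar>of_int i - of_int ?b\<bar> / N else 0)"
        using a by (intro sum.cong refl) auto
      also have "\<dots> = \<bar>of_int ?a - of_int ?b\<bar> / N" using a by simp
      finally have g: "?g p = \<bar>of_int ?a / N - of_int ?b / N\<bar>"
        using N by (simp add: diff_divide_distrib[symmetric])
      have fl: "\<bar>w - of_int \<lfloor>N * w\<rfloor> / N\<bar> \<le> 1 / N" for w :: real
      proof -
        have "N * \<bar>w - of_int \<lfloor>N * w\<rfloor> / N\<bar> = \<bar>N * w - of_int \<lfloor>N * w\<rfloor>\<bar>"
          using N by (simp add: abs_mult_pos' right_diff_distrib)
        also have "\<dots> \<le> 1" by linarith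
        finally show ?thesis using N by (simp add: field_simps)
      qed
      have "?f p = \<bar>u x - v y\<bar>" using xy by simp
      moreover have "\<bar>\<bar>s - t\<bar> - \<bar>s' - t'\<bar>\<bar> \<le> 2 / N" if "\<bar>s - s'\<bar> \<le> 1 / N" "\<bar>t - t'\<bar> \<le> 1 / N" for s t s' t' :: real
      proof -
        have "\<bar>\<bar>s - t\<bar> - \<bar>s' - t'\<bar>\<bar> \<le> 1 / N + 1 / N" using that by linarith
        then show ?thesis by simp
      qed
      ultimately show ?thesis unfolding g using fl by simp
    qed
    have "\<bar>integral\<^sup>L \<pi> ?f - integral\<^sup>L \<pi> ?g\<bar> = \<bar>\<integral>p. ?f p - ?g p \<partial>\<pi>\<bar>"
      by (subst Bochner_Integration.integral_diff[OF f g]) (rule refl)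
    also have "\<dots> \<le> (\<integral>p. \<bar>?f p - ?g p\<bar> \<partial>\<pi>)" by (rule integral_abs_bound)
    also have "\<dots> \<le> (\<integral>p. 2 / N \<partial>\<pi>)"
    proof (rule integral_mono)
      show "integrable \<pi> (\<lambda>p. \<bar>?f p - ?g p\<bar>)"
        by (rule integrable_abs[OF Bochner_Integration.integrable_diff[OF f g]])
      show "\<bar>?f p - ?g p\<bar> \<le> 2 / N" if "p \<in> space \<pi>" for p by (rule le[OF that])
    qed (rule integrable_const)
    also have "\<dots> = 2 / N" by (simp add: prob_space)
    finally show ?thesis .
  qed
  ultimately show ?thesis unfolding L1_dist_def by simp
qed

text \<open>The step sums converge as finite combinations of rectangle measures, and the rounding
  error is uniform over all couplings. The choice of \<open>N\<close> makes each of the three errors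
  smaller than e / 3.\<close>

lemma L1_dist_tendsto:
  assumes X: "geometric_data_set X" and Y: "geometric_data_set Y"
    and \<pi>: "\<And>n. \<pi> n \<in> gds_couplings X Y" and \<rho>: "\<rho> \<in> gds_couplings X Y"
    and lim: "\<And>A B. A \<in> sets (gds_measure X) \<Longrightarrow> B \<in> sets (gds_measure Y) \<Longrightarrow>
       ((\<lambda>n. measure (\<pi> n) (A \<times> B)) \<longlongrightarrow> measure \<rho> (A \<times> B)) G"
    and u: "u \<in> K_tau X" and v: "v \<in> K_tau Y"
  shows "((\<lambda>n. L1_dist (\<pi> n) (u \<circ> fst) (v \<circ> snd)) \<longlongrightarrow> L1_dist \<rho> (u \<circ> fst) (v \<circ> snd)) G"
proof (rule tendstoI)
  fix e :: real assume "e > 0"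
  then obtain N where "1 / Suc N < e / 6" using nat_approx_posE[of "e / 6"] by auto
  then obtain N :: nat where N: "N > 0" "2 / N < e / 3" using that[of "Suc N"] by auto
  let ?L = "\<lambda>\<pi>. L1_dist \<pi> (u \<circ> fst) (v \<circ> snd)"
  let ?S = "\<lambda>\<pi>. \<Sum>i\<in>{-int N..int N}. \<Sum>j\<in>{-int N..int N}. \<bar>of_int i - of_int j\<bar> / N *
     measure \<pi> ({x \<in> gds_carrier X. \<lfloor>N * u x\<rfloor> = i} \<times> {y \<in> gds_carrier Y. \<lfloor>N * v y\<rfloor> = j})"
  have "((\<lambda>n. ?S (\<pi> n)) \<longlongrightarrow> ?S \<rho>) G"
    by (intro tendsto_sum tendsto_mult tendsto_const lim K_tau_level_sets[OF X u] K_tau_level_sets[OF Y v])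
  then have "eventually (\<lambda>n. dist (?S (\<pi> n)) (?S \<rho>) < e / 3) G"
    by (rule tendstoD) (use \<open>e > 0\<close> in simp)
  then show "eventually (\<lambda>n. dist (?L (\<pi> n)) (?L \<rho>) < e) G"
  proof eventually_elim
    case (elim n)
    have "\<bar>?L (\<pi> n) - ?S (\<pi> n)\<bar> \<le> 2 / N" "\<bar>?L \<rho> - ?S \<rho>\<bar> \<le> 2 / N"
      using L1_dist_step_approx[OF X Y \<pi> u v N(1)] L1_dist_step_approx[OF X Y \<rho> u v N(1)] .
    moreover have "dist a a' < e" if "\<bar>a - b\<bar> \<le> 2 / N" "\<bar>a' - b'\<bar> \<le> 2 / N" "dist b b' < e / 3"
      for a a' b b' :: real
      using that N(2) unfolding dist_real_def by linarith
    ultimately show ?case using elim by blast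
  qed
qed

section \<open>Hausdorff distances and near-optimal partners\<close>

lemma hausdorff_distance_leI:
  assumes ne: "A \<noteq> {}" "B \<noteq> {}" and nn: "\<And>a b. a \<in> A \<Longrightarrow> b \<in> B \<Longrightarrow> 0 \<le> d a b"
    and A: "\<And>a e. a \<in> A \<Longrightarrow> e > 0 \<Longrightarrow> \<exists>b\<in>B. d a b \<le> c + e"
    and B: "\<And>b e. b \<in> B \<Longrightarrow> e > 0 \<Longrightarrow> \<exists>a\<in>A. d a b \<le> c + e"
  shows "hausdorff_distance d A B \<le> c"
  unfolding hausdorff_distance_def
proof (rule max.boundedI; (rule cSUP_least[OF ne(1)] | rule cSUP_least[OF ne(2)]); rule field_le_epsilon)
  fix a and e :: real assume a: "a \<in> A" and "e > 0"
  then obtain b where b: "b \<in> B" "d a b \<le> c + e" using A by blast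
  have "bdd_below (d a ` B)" using nn[OF a] by (auto simp: bdd_below_def)
  then have "(INF b\<in>B. d a b) \<le> d a b" using b(1) by (rule cINF_lower)
  then show "(INF b\<in>B. d a b) \<le> c + e" using b(2) by linarith
next
  fix b and e :: real assume b: "b \<in> B" and "e > 0"
  then obtain a where a: "a \<in> A" "d a b \<le> c + e" using B by blast
  have "bdd_below ((\<lambda>a. d a b) ` A)" using nn[OF _ b] by (auto simp: bdd_below_def)
  then have "(INF a\<in>A. d a b) \<le> d a b" using a(1) by (rule cINF_lower)
  then show "(INF a\<in>A. d a b) \<le> c + e" using a(2) by linarith
qed

text \<open>Suprema and infima of reals are informative only on bounded sets: nonnegativity serves
  the infima and the bound \<open>C\<close> serves the suprema.\<close>

lemma hausdorff_distance_bounds: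
  assumes ne: "A \<noteq> {}" "B \<noteq> {}"
    and nn: "\<And>a b. a \<in> A \<Longrightarrow> b \<in> B \<Longrightarrow> 0 \<le> d a b" and le: "\<And>a b. a \<in> A \<Longrightarrow> b \<in> B \<Longrightarrow> d a b \<le> (C::real)"
  shows "a \<in> A \<Longrightarrow> (INF b\<in>B. d a b) \<le> hausdorff_distance d A B"
    and "b \<in> B \<Longrightarrow> (INF a\<in>A. d a b) \<le> hausdorff_distance d A B"
    and "0 \<le> hausdorff_distance d A B"
proof -
  have 1: "(INF b\<in>B. d a b) \<le> C" if a: "a \<in> A" for a
  proof -
    obtain b where b: "b \<in> B" using ne by blast
    have "(INF b\<in>B. d a b) \<le> d a b" using nn[OF a] b by (intro cINF_lower) (auto simp: bdd_below_def)
    then show ?thesis using le[OF a b] by linarith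
  qed
  have 2: "(INF a\<in>A. d a b) \<le> C" if b: "b \<in> B" for b
  proof -
    obtain a where a: "a \<in> A" using ne by blast
    have "(INF a\<in>A. d a b) \<le> d a b" using nn[OF _ b] a by (intro cINF_lower) (auto simp: bdd_below_def)
    then show ?thesis using le[OF a b] by linarith
  qed
  show A: "(INF b\<in>B. d a b) \<le> hausdorff_distance d A B" if "a \<in> A" for a
    unfolding hausdorff_distance_def
    by (rule max.coboundedI1, rule cSUP_upper[OF that]) (use 1 in \<open>auto simp: bdd_above_def\<close>)
  show "(INF a\<in>A. d a b) \<le> hausdorff_distance d A B" if "b \<in> B" for b
    unfolding hausdorff_distance_def
    by (rule max.coboundedI2, rule cSUP_upper[OF that]) (use 2 in \<open>auto simp: bdd_above_def\<close>)
  obtain a where a: "a \<in> A" using ne by blast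
  have "0 \<le> (INF b\<in>B. d a b)" using nn[OF a] ne by (intro cINF_greatest)
  then show "0 \<le> hausdorff_distance d A B" using A[OF a] by linarith
qed

lemma K_tau_nonempty: "geometric_data_set X \<Longrightarrow> K_tau X \<noteq> {}"
  using tau_feature_K_tau gdsD(9) by blast

context
  fixes X :: "'a gds" and Y :: "'b gds" and \<pi> :: "('a \<times> 'b) measure"
  assumes X: "geometric_data_set X" and Y: "geometric_data_set Y" and \<pi>: "\<pi> \<in> gds_couplings X Y"
begin

lemma D_tau_leI:
  assumes "\<And>u e. u \<in> K_tau X \<Longrightarrow> e > 0 \<Longrightarrow> \<exists>v\<in>K_tau Y. L1_dist \<pi> (u \<circ> fst) (v \<circ> snd) \<le> c + e"
    and "\<And>v e. v \<in> K_tau Y \<Longrightarrow> e > 0 \<Longrightarrow> \<exists>u\<in>K_tau X. L1_dist \<pi> (u \<circ> fst) (v \<circ> snd) \<le> c + e"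
  shows "D_tau \<pi> X Y \<le> c"
  unfolding D_tau_def
  by (rule hausdorff_distance_leI[OF _ _ L1_dist_nonneg])
    (use assms K_tau_nonempty[OF X] K_tau_nonempty[OF Y] in auto)

lemma D_tau_bounds:
  shows "u \<in> K_tau X \<Longrightarrow> D_tau \<pi> X Y < c \<Longrightarrow> \<exists>v\<in>K_tau Y. L1_dist \<pi> (u \<circ> fst) (v \<circ> snd) < c"
    and "v \<in> K_tau Y \<Longrightarrow> D_tau \<pi> X Y < c \<Longrightarrow> \<exists>u\<in>K_tau X. L1_dist \<pi> (u \<circ> fst) (v \<circ> snd) < c"
    and "0 \<le> D_tau \<pi> X Y"
proof -
  let ?A = "(\<lambda>u. u \<circ> (fst :: 'a \<times> 'b \<Rightarrow> 'a)) ` K_tau X"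
  let ?B = "(\<lambda>v. v \<circ> (snd :: 'a \<times> 'b \<Rightarrow> 'b)) ` K_tau Y"
  have ne: "?A \<noteq> {}" "?B \<noteq> {}" using K_tau_nonempty[OF X] K_tau_nonempty[OF Y] by auto
  have le: "L1_dist \<pi> a b \<le> 1" if "a \<in> ?A" "b \<in> ?B" for a b
    using that L1_dist_coupling_le_1[OF X Y \<pi>] by auto
  note h = hausdorff_distance_bounds[of ?A ?B "L1_dist \<pi>", OF ne L1_dist_nonneg le, folded D_tau_def]
  show "0 \<le> D_tau \<pi> X Y" by (rule h)
  show "\<exists>v\<in>K_tau Y. L1_dist \<pi> (u \<circ> fst) (v \<circ> snd) < c" if u: "u \<in> K_tau X" and c: "D_tau \<pi> X Y < c"
  proof -
    have "Inf (L1_dist \<pi> (u \<circ> fst) ` ?B) < c" using h(1)[of "u \<circ> fst"] u c by simp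
    from cInf_lessD[OF _ this] show ?thesis using ne by auto
  qed
  show "\<exists>u\<in>K_tau X. L1_dist \<pi> (u \<circ> fst) (v \<circ> snd) < c" if v: "v \<in> K_tau Y" and c: "D_tau \<pi> X Y < c"
  proof -
    have "Inf ((\<lambda>a. L1_dist \<pi> a (v \<circ> snd)) ` ?A) < c" using h(2)[of "v \<circ> snd"] v c by simp
    from cInf_lessD[OF _ this] show ?thesis using ne by auto
  qed
qed

end

lemma d_tau_le_D_tau:
  assumes X: "geometric_data_set X" and Y: "geometric_data_set Y" and \<pi>: "\<pi> \<in> gds_couplings X Y"
  shows "d_tau X Y \<le> D_tau \<pi> X Y"
  unfolding d_tau_def
  by (rule cINF_lower[OF _ \<pi>]) (use D_tau_bounds(3)[OF X Y] in \<open>auto simp: bdd_below_def\<close>)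

text \<open>Ensures that the infimum in \<open>d_tau\<close> is taken over a nonempty set.\<close>

lemma gds_product_coupling:
  assumes X: "geometric_data_set X" and Y: "geometric_data_set Y"
  shows "gds_measure X \<Otimes>\<^sub>M gds_measure Y \<in> gds_couplings X Y"
proof -
  interpret PX: prob_space "gds_measure X" by (rule gdsD[OF X])
  interpret PY: prob_space "gds_measure Y" by (rule gdsD[OF Y])
  interpret pair_prob_space "gds_measure X" "gds_measure Y" ..
  have snd: "distr (gds_measure X \<Otimes>\<^sub>M gds_measure Y) (gds_measure Y) snd = gds_measure Y"
  proof (rule measure_eqI)
    fix B assume "B \<in> sets (distr (gds_measure X \<Otimes>\<^sub>M gds_measure Y) (gds_measure Y) snd)"
    then have B: "B \<in> sets (gds_measure Y)" by simp
    have "snd -` B \<inter> space (gds_measure X \<Otimes>\<^sub>M gds_measure Y) = space (gds_measure X) \<times> B"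
      using sets.sets_into_space[OF B] by (auto simp: space_pair_measure)
    then show "emeasure (distr (gds_measure X \<Otimes>\<^sub>M gds_measure Y) (gds_measure Y) snd) B = emeasure (gds_measure Y) B"
      using B by (simp add: emeasure_distr PY.emeasure_pair_measure_Times PX.emeasure_space_1)
  qed simp
  show ?thesis
    by (rule gds_couplingI[OF X Y _ refl PY.distr_pair_fst snd]) unfold_locales
qed

lemma d_tau_less:
  assumes X: "geometric_data_set X" and Y: "geometric_data_set Y" and c: "d_tau X Y < c"
  obtains \<pi> where "\<pi> \<in> gds_couplings X Y" "D_tau \<pi> X Y < c"
  using c cInf_lessD[of "(\<lambda>\<pi>. D_tau \<pi> X Y) ` gds_couplings X Y" c] gds_product_coupling[OF X Y]
  unfolding d_tau_def by auto

text \<open>For a fixed \<open>u\<close> the partners along the minimising sequence have an L1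
  cluster point \<open>w\<close>, along a finer filter that may depend on \<open>u\<close>. All
  couplings share the marginal on the other side, so replacing the partner by \<open>w\<close> costs
  the same under the coupling as under that marginal; only then does the coupling pass to its limit,
  with \<open>u\<close> and \<open>w\<close> fixed.\<close>

lemma d_tau_attained:
  assumes X: "geometric_data_set X" and Y: "geometric_data_set Y"
  obtains \<rho> where "\<rho> \<in> gds_couplings X Y"
    "\<And>u. u \<in> K_tau X \<Longrightarrow> \<exists>v\<in>K_tau Y. L1_dist \<rho> (u \<circ> fst) (v \<circ> snd) \<le> d_tau X Y"
    "\<And>v. v \<in> K_tau Y \<Longrightarrow> \<exists>u\<in>K_tau X. L1_dist \<rho> (u \<circ> fst) (v \<circ> snd) \<le> d_tau X Y"
proof -
  let ?d = "d_tau X Y"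
  have "\<exists>\<pi>. \<pi> \<in> gds_couplings X Y \<and> D_tau \<pi> X Y < ?d + 1 / real (Suc n)" for n
    by (rule d_tau_less[OF X Y, of "?d + 1 / real (Suc n)"]) auto
  then obtain \<pi> where \<pi>: "\<And>n. \<pi> n \<in> gds_couplings X Y" and D: "\<And>n. D_tau (\<pi> n) X Y < ?d + 1 / real (Suc n)"
    by metis
  note c = gds_couplingD[OF X Y \<pi>]
  obtain G \<rho> where G: "G \<le> sequentially" "G \<noteq> bot" and \<rho>: "\<rho> \<in> gds_couplings X Y"
    and lim: "\<And>A B. A \<in> sets (gds_measure X) \<Longrightarrow> B \<in> sets (gds_measure Y) \<Longrightarrow>
       ((\<lambda>n. measure (\<pi> n) (A \<times> B)) \<longlongrightarrow> measure \<rho> (A \<times> B)) G"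
    using gds_coupling_limit[where \<pi> = \<pi>, OF X Y \<pi> trivial_limit_sequentially] by blast
  have L: "((\<lambda>n. L1_dist (\<pi> n) (u \<circ> fst) (v \<circ> snd)) \<longlongrightarrow> L1_dist \<rho> (u \<circ> fst) (v \<circ> snd)) G'"
    if "u \<in> K_tau X" "v \<in> K_tau Y" "G' \<le> G" for u v G'
    using tendsto_mono[OF that(3) L1_dist_tendsto[where \<pi> = \<pi>, OF X Y \<pi> \<rho> lim that(1,2)]] .
  have R: "((\<lambda>n. ?d + 1 / real (Suc n) + l n) \<longlongrightarrow> ?d) G'" if "G' \<le> G" "(l \<longlongrightarrow> 0) G'" for G' l
  proof -
    have "((\<lambda>n. 1 / real (Suc n)) \<longlongrightarrow> 0) G'"
      by (rule tendsto_mono[OF order_trans[OF that(1) G(1)] LIMSEQ_Suc[OF lim_1_over_n]])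
    from tendsto_add[OF tendsto_add[OF tendsto_const this] that(2), of ?d] show ?thesis by simp
  qed
  show ?thesis
  proof (rule that[OF \<rho>])
    fix u assume u: "u \<in> K_tau X"
    have "\<forall>n. \<exists>v\<in>K_tau Y. L1_dist (\<pi> n) (u \<circ> fst) (v \<circ> snd) < ?d + 1 / real (Suc n)"
      using D_tau_bounds(1)[OF X Y \<pi> u D] by blast
    then obtain v where v: "\<And>n. v n \<in> K_tau Y"
        "\<And>n. L1_dist (\<pi> n) (u \<circ> fst) (v n \<circ> snd) < ?d + 1 / real (Suc n)"
      by metis
    obtain G' w where G': "G' \<le> G" "G' \<noteq> bot" and w: "w \<in> K_tau Y"
      and lw: "((\<lambda>n. L1_dist (gds_measure Y) (v n) w) \<longlongrightarrow> 0) G'"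
      using K_tau_L1_compact[where v = v, OF Y G(2) v(1)] by blast
    have "L1_dist (\<pi> n) (u \<circ> fst) (w \<circ> snd) \<le> ?d + 1 / real (Suc n) + L1_dist (gds_measure Y) (v n) w" for n
    proof -
      have "L1_dist (\<pi> n) (u \<circ> fst) (w \<circ> snd) \<le>
          L1_dist (\<pi> n) (u \<circ> fst) (v n \<circ> snd) + L1_dist (\<pi> n) (v n \<circ> snd) (w \<circ> snd)"
        using u v(1)[of n] w by (intro L1_dist_triangle K_tau_comp_integrable[OF X _ c(1,4)] K_tau_comp_integrable[OF Y _ c(1,5)])
      also have "L1_dist (\<pi> n) (v n \<circ> snd) (w \<circ> snd) = L1_dist (gds_measure Y) (v n) w"
        by (rule L1_dist_comp[OF Y v(1) w c(5,7)])
      finally show ?thesis using v(2)[of n] by linarith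
    qed
    then have "L1_dist \<rho> (u \<circ> fst) (w \<circ> snd) \<le> ?d"
      by (intro tendsto_le[OF G'(2) R[OF G'(1) lw] L[OF u w G'(1)]] always_eventually) blast
    then show "\<exists>v\<in>K_tau Y. L1_dist \<rho> (u \<circ> fst) (v \<circ> snd) \<le> ?d" using w by blast
  next
    fix v assume v: "v \<in> K_tau Y"
    have "\<forall>n. \<exists>u\<in>K_tau X. L1_dist (\<pi> n) (u \<circ> fst) (v \<circ> snd) < ?d + 1 / real (Suc n)"
      using D_tau_bounds(2)[OF X Y \<pi> v D] by blast
    then obtain u where u: "\<And>n. u n \<in> K_tau X"
        "\<And>n. L1_dist (\<pi> n) (u n \<circ> fst) (v \<circ> snd) < ?d + 1 / real (Suc n)"
      by metis
    obtain G' w where G': "G' \<le> G" "G' \<noteq> bot" and w: "w \<in> K_tau X"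
      and lw: "((\<lambda>n. L1_dist (gds_measure X) (u n) w) \<longlongrightarrow> 0) G'"
      using K_tau_L1_compact[where v = u, OF X G(2) u(1)] by blast
    have "L1_dist (\<pi> n) (w \<circ> fst) (v \<circ> snd) \<le> ?d + 1 / real (Suc n) + L1_dist (gds_measure X) (u n) w" for n
    proof -
      have "L1_dist (\<pi> n) (w \<circ> fst) (v \<circ> snd) \<le>
          L1_dist (\<pi> n) (w \<circ> fst) (u n \<circ> fst) + L1_dist (\<pi> n) (u n \<circ> fst) (v \<circ> snd)"
        using v u(1)[of n] w by (intro L1_dist_triangle K_tau_comp_integrable[OF X _ c(1,4)] K_tau_comp_integrable[OF Y _ c(1,5)])
      also have "L1_dist (\<pi> n) (w \<circ> fst) (u n \<circ> fst) = L1_dist (gds_measure X) (u n) w"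
        using L1_dist_comp[OF X w u(1) c(4,6)] by (simp add: L1_dist_commute)
      finally show ?thesis using u(2)[of n] by linarith
    qed
    then have "L1_dist \<rho> (w \<circ> fst) (v \<circ> snd) \<le> ?d"
      by (intro tendsto_le[OF G'(2) R[OF G'(1) lw] L[OF w v G'(1)]] always_eventually) blast
    then show "\<exists>u\<in>K_tau X. L1_dist \<rho> (u \<circ> fst) (v \<circ> snd) \<le> ?d" using w by blast
  qed
qed

subsection \<open>The triangle inequality\<close>

text \<open>
  Gluing along a discrete index needs no disintegration: the glued measure has the density
  \<open>[i x = j y] / P (i = i x)\<close> with respect to the product.
\<close>

lemma discrete_gluing:
  fixes i :: "'a \<Rightarrow> nat" and j :: "'b \<Rightarrow> nat"
  assumes "prob_space M" "prob_space N"
    and i: "i \<in> measurable M (count_space UNIV)" and j: "j \<in> measurable N (count_space UNIV)"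
    and eq: "distr M (count_space UNIV) i = distr N (count_space UNIV) j"
  obtains \<kappa> where "sets \<kappa> = sets (M \<Otimes>\<^sub>M N)" "distr \<kappa> M fst = M" "distr \<kappa> N snd = N"
    "AE p in \<kappa>. i (fst p) = j (snd p)"
proof -
  interpret M: prob_space M by fact
  interpret N: prob_space N by fact
  interpret pair_prob_space M N ..
  note [measurable] = i j
  define m where "m k = emeasure M {x \<in> space M. i x = k}" for k
  have mN: "m k = emeasure N {y \<in> space N. j y = k}" for k
  proof -
    have "i -` {k} \<inter> space M = {x \<in> space M. i x = k}" "j -` {k} \<inter> space N = {y \<in> space N. j y = k}" by auto
    then show ?thesis
      using arg_cong[OF eq, of "\<lambda>D. emeasure D {k}"] by (simp add: emeasure_distr i j m_def)
  qed
  \<comment> \<open>Dividing by the mass of the class makes the conditional mass one in both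
    directions. On classes of mass zero the quotient is infinite, but those are null for both
    measures.\<close>
  define f where "f p = (if i (fst p) = j (snd p) then 1 / m (i (fst p)) else 0)" for p
  have mi: "(\<lambda>p. m (i (fst p))) \<in> borel_measurable (M \<Otimes>\<^sub>M N)"
    by (rule measurable_compose[OF measurable_compose[OF measurable_fst i]]) simp
  have [measurable]: "f \<in> borel_measurable (M \<Otimes>\<^sub>M N)" unfolding f_def
  proof (rule measurable_If)
    show "(\<lambda>p. 1 / m (i (fst p))) \<in> borel_measurable (M \<Otimes>\<^sub>M N)"
      using mi by (intro borel_measurable_divide_ennreal borel_measurable_const)
    have "{p \<in> space (M \<Otimes>\<^sub>M N). \<exists>k. j (snd p) = k \<and> i (fst p) = k} \<in> sets (M \<Otimes>\<^sub>M N)" by measurable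
    then show "{p \<in> space (M \<Otimes>\<^sub>M N). i (fst p) = j (snd p)} \<in> sets (M \<Otimes>\<^sub>M N)" by simp
  qed simp
  define \<kappa> where "\<kappa> = density (M \<Otimes>\<^sub>M N) f"
  have one: "1 / m k * m k = 1" if "m k \<noteq> 0" for k
    using that M.emeasure_finite[of "{x \<in> space M. i x = k}"]
    by (simp add: m_def ennreal_divide_times ennreal_divide_self less_top[symmetric])
  have fM: "(\<integral>\<^sup>+ y. f (x, y) \<partial>N) = 1" if "m (i x) \<noteq> 0" for x
  proof -
    have "(\<integral>\<^sup>+ y. f (x, y) \<partial>N) = (\<integral>\<^sup>+ y. 1 / m (i x) * indicator {y \<in> space N. j y = i x} y \<partial>N)"
      by (intro nn_integral_cong) (auto simp: f_def indicator_def)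
    also have "\<dots> = 1 / m (i x) * m (i x)" by (simp add: nn_integral_cmult mN)
    finally show ?thesis using one[OF that] by simp
  qed
  have fN: "(\<integral>\<^sup>+ x. f (x, y) \<partial>M) = 1" if "m (j y) \<noteq> 0" for y
  proof -
    have "(\<integral>\<^sup>+ x. f (x, y) \<partial>M) = (\<integral>\<^sup>+ x. 1 / m (j y) * indicator {x \<in> space M. i x = j y} x \<partial>M)"
      by (intro nn_integral_cong) (auto simp: f_def indicator_def)
    also have "\<dots> = 1 / m (j y) * m (j y)" by (simp add: nn_integral_cmult m_def)
    finally show ?thesis using one[OF that] by simp
  qed
  have "AE x in M. m k = 0 \<longrightarrow> i x \<noteq> k" for k
  proof (cases "m k = 0")
    case True
    then have "AE x in M. \<not> i x = k" unfolding m_def by (subst AE_iff_measurable[OF _ refl]) auto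
    then show ?thesis by simp
  qed simp
  then have "AE x in M. \<forall>k. m k = 0 \<longrightarrow> i x \<noteq> k" by (simp add: AE_all_countable)
  \<comment> \<open>The countably many possible indices allow the null classes to be removed
    simultaneously.\<close>
  then have aeM: "AE x in M. m (i x) \<noteq> 0" by eventually_elim blast
  have "AE y in N. m k = 0 \<longrightarrow> j y \<noteq> k" for k
  proof (cases "m k = 0")
    case True
    then have "AE y in N. \<not> j y = k" unfolding mN by (subst AE_iff_measurable[OF _ refl]) auto
    then show ?thesis by simp
  qed simp
  then have "AE y in N. \<forall>k. m k = 0 \<longrightarrow> j y \<noteq> k" by (simp add: AE_all_countable)
  then have aeN: "AE y in N. m (j y) \<noteq> 0" by eventually_elim blast
  have sets: "sets \<kappa> = sets (M \<Otimes>\<^sub>M N)" by (simp add: \<kappa>_def)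
  have "distr \<kappa> M fst = M"
  proof (rule measure_eqI)
    fix A assume "A \<in> sets (distr \<kappa> M fst)"
    then have A[measurable]: "A \<in> sets M" by simp
    have "emeasure (distr \<kappa> M fst) A = (\<integral>\<^sup>+ p. f p * indicator A (fst p) \<partial>(M \<Otimes>\<^sub>M N))"
      unfolding \<kappa>_def
      by (subst emeasure_distr, simp, simp, subst emeasure_density)
        (auto intro!: nn_integral_cong simp: indicator_def)
    also have "\<dots> = (\<integral>\<^sup>+ x. \<integral>\<^sup>+ y. f (x, y) * indicator A x \<partial>N \<partial>M)"
      by (subst N.nn_integral_fst[symmetric]) auto
    also have "\<dots> = (\<integral>\<^sup>+ x. (\<integral>\<^sup>+ y. f (x, y) \<partial>N) * indicator A x \<partial>M)"
      by (intro nn_integral_cong nn_integral_multc) measurable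
    also have "\<dots> = (\<integral>\<^sup>+ x. indicator A x \<partial>M)"
      by (rule nn_integral_cong_AE) (use aeM in \<open>eventually_elim, simp add: fM\<close>)
    finally show "emeasure (distr \<kappa> M fst) A = emeasure M A" by simp
  qed simp
  moreover have "distr \<kappa> N snd = N"
  proof (rule measure_eqI)
    fix B assume "B \<in> sets (distr \<kappa> N snd)"
    then have B[measurable]: "B \<in> sets N" by simp
    have "emeasure (distr \<kappa> N snd) B = (\<integral>\<^sup>+ p. f p * indicator B (snd p) \<partial>(M \<Otimes>\<^sub>M N))"
      unfolding \<kappa>_def
      by (subst emeasure_distr, simp, simp, subst emeasure_density)
        (auto intro!: nn_integral_cong simp: indicator_def)
    also have "\<dots> = (\<integral>\<^sup>+ y. \<integral>\<^sup>+ x. f (x, y) * indicator B y \<partial>M \<partial>N)"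
      by (subst nn_integral_snd[symmetric]) auto
    also have "\<dots> = (\<integral>\<^sup>+ y. (\<integral>\<^sup>+ x. f (x, y) \<partial>M) * indicator B y \<partial>N)"
      by (intro nn_integral_cong nn_integral_multc) measurable
    also have "\<dots> = (\<integral>\<^sup>+ y. indicator B y \<partial>N)"
      by (rule nn_integral_cong_AE) (use aeN in \<open>eventually_elim, simp add: fN\<close>)
    finally show "emeasure (distr \<kappa> N snd) B = emeasure N B" by simp
  qed simp
  moreover have "AE p in \<kappa>. i (fst p) = j (snd p)"
    unfolding \<kappa>_def by (subst AE_density) (auto simp: f_def)
  ultimately show ?thesis using that sets by blast
qed

text \<open>The glued measure carries two copies of the middle coordinate that agree only up to
  distance \<open>r\<close>. A third of \<open>e\<close> goes to each of the two nearly optimal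
  couplings and the last third to moving \<open>v\<close> from one copy to the other.\<close>

lemma d_tau_triangle:
  assumes X: "geometric_data_set X" and Y: "geometric_data_set Y" and Z: "geometric_data_set Z"
  shows "d_tau X Z \<le> d_tau X Y + d_tau Y Z"
proof (rule field_le_epsilon)
  fix e :: real assume "e > 0"
  define r where "r = e / 3"
  have r: "r > 0" using \<open>e > 0\<close> by (simp add: r_def)
  obtain \<pi> where \<pi>: "\<pi> \<in> gds_couplings X Y" and D\<pi>: "D_tau \<pi> X Y < d_tau X Y + r"
    by (rule d_tau_less[OF X Y, of "d_tau X Y + r"]) (use r in auto)
  obtain \<rho> where \<rho>: "\<rho> \<in> gds_couplings Y Z" and D\<rho>: "D_tau \<rho> Y Z < d_tau Y Z + r"
    by (rule d_tau_less[OF Y Z, of "d_tau Y Z + r"]) (use r in auto)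
  note c = gds_couplingD[OF X Y \<pi>] and c' = gds_couplingD[OF Y Z \<rho>]
  obtain i :: "'b \<Rightarrow> nat" where im: "i \<in> measurable (gds_measure Y) (count_space UNIV)"
    and i: "\<And>y y'. y \<in> gds_carrier Y \<Longrightarrow> y' \<in> gds_carrier Y \<Longrightarrow> i y = i y' \<Longrightarrow> gds_dist Y y y' < r"
    using gds_fine_partition[OF Y r] by blast
  \<comment> \<open>Both sides are the image of the measure on \<open>Y\<close> under
    \<open>i\<close>, since \<open>\<pi>\<close> and \<open>\<rho>\<close> have it as a common
    marginal.\<close>
  have eq: "distr \<pi> (count_space UNIV) (i \<circ> snd) = distr \<rho> (count_space UNIV) (i \<circ> fst)"
    using distr_distr[OF im c(5)] distr_distr[OF im c'(4)] c(7) c'(6) by simp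
  obtain \<kappa> where sets\<kappa>: "sets \<kappa> = sets (\<pi> \<Otimes>\<^sub>M \<rho>)"
    and m1: "distr \<kappa> \<pi> fst = \<pi>" and m2: "distr \<kappa> \<rho> snd = \<rho>"
    and ae: "AE p in \<kappa>. (i \<circ> snd) (fst p) = (i \<circ> fst) (snd p)"
    using discrete_gluing[OF c(1) c'(1) measurable_comp[OF c(5) im] measurable_comp[OF c'(4) im] eq] by blast
  have f1: "fst \<in> measurable \<kappa> \<pi>" and f2: "snd \<in> measurable \<kappa> \<rho>"
    by (simp_all add: measurable_cong_sets[OF sets\<kappa> refl])
  have P\<kappa>: "prob_space \<kappa>"
  proof (rule prob_spaceI)
    have "emeasure (distr \<kappa> \<pi> fst) (space \<pi>) = emeasure \<kappa> (space \<kappa>)"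
      using emeasure_distr[OF f1 sets.top] measurable_space[OF f1] by (simp add: Int_absorb1 subset_eq)
    then show "emeasure \<kappa> (space \<kappa>) = 1" using m1 prob_space.emeasure_space_1[OF c(1)] by simp
  qed
  interpret prob_space \<kappa> by (rule P\<kappa>)
  let ?a = "fst \<circ> fst :: _ \<Rightarrow> 'a" and ?b = "snd \<circ> fst :: _ \<Rightarrow> 'b"
  let ?b' = "fst \<circ> snd :: _ \<Rightarrow> 'b" and ?c = "snd \<circ> snd :: _ \<Rightarrow> 'c"
  have ma: "?a \<in> measurable \<kappa> (gds_measure X)" and mb: "?b \<in> measurable \<kappa> (gds_measure Y)"
    and mb': "?b' \<in> measurable \<kappa> (gds_measure Y)" and mc: "?c \<in> measurable \<kappa> (gds_measure Z)"
    using measurable_comp[OF f1 c(4)] measurable_comp[OF f1 c(5)]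
      measurable_comp[OF f2 c'(4)] measurable_comp[OF f2 c'(5)] by auto
  \<comment> \<open>The coupling for \<open>X\<close> and \<open>Z\<close> is the joint law of the
    two outer coordinates.\<close>
  define \<sigma> where "\<sigma> = distr \<kappa> (gds_measure X \<Otimes>\<^sub>M gds_measure Z) (\<lambda>p. (?a p, ?c p))"
  have mac: "(\<lambda>p. (?a p, ?c p)) \<in> measurable \<kappa> (gds_measure X \<Otimes>\<^sub>M gds_measure Z)"
    using ma mc by (rule measurable_Pair)
  have \<sigma>: "\<sigma> \<in> gds_couplings X Z"
  proof (rule gds_couplingI[OF X Z])
    show "prob_space \<sigma>" unfolding \<sigma>_def by (rule prob_space_distr[OF mac])
    show "sets \<sigma> = sets (gds_measure X \<Otimes>\<^sub>M gds_measure Z)" by (simp add: \<sigma>_def)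
    have "distr \<sigma> (gds_measure X) fst = distr (distr \<kappa> \<pi> fst) (gds_measure X) fst"
      unfolding \<sigma>_def
      by (subst distr_distr[OF measurable_fst mac], subst distr_distr[OF c(4) f1]) (simp add: o_def)
    then show "distr \<sigma> (gds_measure X) fst = gds_measure X" using m1 c(6) by simp
    have "distr \<sigma> (gds_measure Z) snd = distr (distr \<kappa> \<rho> snd) (gds_measure Z) snd"
      unfolding \<sigma>_def
      by (subst distr_distr[OF measurable_snd mac], subst distr_distr[OF c'(5) f2]) (simp add: o_def)
    then show "distr \<sigma> (gds_measure Z) snd = gds_measure Z" using m2 c'(7) by simp
  qed
  have key: "L1_dist \<sigma> (u \<circ> fst) (w \<circ> snd)
      \<le> L1_dist \<pi> (u \<circ> fst) (v \<circ> snd) + L1_dist \<rho> (v \<circ> fst) (w \<circ> snd) + r"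
    if u: "u \<in> K_tau X" and v: "v \<in> K_tau Y" and w: "w \<in> K_tau Z" for u v w
  proof -
    have [measurable]: "u \<in> borel_measurable (gds_measure X)" "v \<in> borel_measurable (gds_measure Y)"
      "w \<in> borel_measurable (gds_measure Z)" using K_tau_measurable X Y Z u v w by auto
    have iu: "integrable \<kappa> (u \<circ> ?a)" and iv: "integrable \<kappa> (v \<circ> ?b)"
      and iv': "integrable \<kappa> (v \<circ> ?b')" and iw: "integrable \<kappa> (w \<circ> ?c)"
      using K_tau_comp_integrable[OF X u P\<kappa> ma] K_tau_comp_integrable[OF Y v P\<kappa> mb]
        K_tau_comp_integrable[OF Y v P\<kappa> mb'] K_tau_comp_integrable[OF Z w P\<kappa> mc] by auto
    have 1: "L1_dist \<sigma> (u \<circ> fst) (w \<circ> snd) = L1_dist \<kappa> (u \<circ> ?a) (w \<circ> ?c)"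
      unfolding L1_dist_def \<sigma>_def by (subst integral_distr[OF mac]) auto
    have "(\<lambda>p. \<bar>(u \<circ> fst) p - (v \<circ> snd) p\<bar>) \<in> borel_measurable \<pi>"
      using K_tau_comp_measurable[OF X u c(4)] K_tau_comp_measurable[OF Y v c(5)] by measurable
    from integral_distr[OF f1 this] have 2: "L1_dist \<pi> (u \<circ> fst) (v \<circ> snd) = L1_dist \<kappa> (u \<circ> ?a) (v \<circ> ?b)"
      unfolding L1_dist_def m1 by simp
    have "(\<lambda>p. \<bar>(v \<circ> fst) p - (w \<circ> snd) p\<bar>) \<in> borel_measurable \<rho>"
      using K_tau_comp_measurable[OF Y v c'(4)] K_tau_comp_measurable[OF Z w c'(5)] by measurable
    from integral_distr[OF f2 this] have 3: "L1_dist \<rho> (v \<circ> fst) (w \<circ> snd) = L1_dist \<kappa> (v \<circ> ?b') (w \<circ> ?c)"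
      unfolding L1_dist_def m2 by simp
    have "L1_dist \<kappa> (v \<circ> ?b) (v \<circ> ?b') \<le> (\<integral>p. r \<partial>\<kappa>)"
      unfolding L1_dist_def
    proof (rule integral_mono_AE)
      show "integrable \<kappa> (\<lambda>p. \<bar>(v \<circ> ?b) p - (v \<circ> ?b') p\<bar>)"
        by (rule integrable_abs[OF Bochner_Integration.integrable_diff[OF iv iv']])
      show "AE p in \<kappa>. \<bar>(v \<circ> ?b) p - (v \<circ> ?b') p\<bar> \<le> r"
        using ae AE_space
      proof eventually_elim
        case (elim p)
        have y: "?b p \<in> gds_carrier Y" "?b' p \<in> gds_carrier Y"
          using measurable_space[OF mb elim(2)] measurable_space[OF mb' elim(2)] gdsD(5)[OF Y] by auto
        have "gds_dist Y (?b p) (?b' p) < r" using elim(1) by (intro i[OF y]) simp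
        then show ?case using K_tau_le_dist[OF Y v y] by simp
      qed
    qed simp
    then have 4: "L1_dist \<kappa> (v \<circ> ?b) (v \<circ> ?b') \<le> r" by (simp add: prob_space)
    have "L1_dist \<kappa> (u \<circ> ?a) (w \<circ> ?c) \<le> L1_dist \<kappa> (u \<circ> ?a) (v \<circ> ?b) + L1_dist \<kappa> (v \<circ> ?b) (w \<circ> ?c)"
      by (rule L1_dist_triangle[OF iu iv iw])
    moreover have "L1_dist \<kappa> (v \<circ> ?b) (w \<circ> ?c) \<le> L1_dist \<kappa> (v \<circ> ?b) (v \<circ> ?b') + L1_dist \<kappa> (v \<circ> ?b') (w \<circ> ?c)"
      by (rule L1_dist_triangle[OF iv iv' iw])
    ultimately show ?thesis unfolding 1 2 3 using 4 by linarith
  qed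
  have "D_tau \<sigma> X Z \<le> d_tau X Y + d_tau Y Z + e"
  proof (rule D_tau_leI[OF X Z \<sigma>])
    fix u and e' :: real assume u: "u \<in> K_tau X" and "e' > 0"
    obtain v where v: "v \<in> K_tau Y" "L1_dist \<pi> (u \<circ> fst) (v \<circ> snd) < d_tau X Y + r"
      using D_tau_bounds(1)[OF X Y \<pi> u D\<pi>] by blast
    obtain w where w: "w \<in> K_tau Z" "L1_dist \<rho> (v \<circ> fst) (w \<circ> snd) < d_tau Y Z + r"
      using D_tau_bounds(1)[OF Y Z \<rho> v(1) D\<rho>] by blast
    have "L1_dist \<sigma> (u \<circ> fst) (w \<circ> snd) \<le> d_tau X Y + d_tau Y Z + e + e'"
      using key[OF u v(1) w(1)] v(2) w(2) \<open>e' > 0\<close> by (simp add: r_def)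
    then show "\<exists>w\<in>K_tau Z. L1_dist \<sigma> (u \<circ> fst) (w \<circ> snd) \<le> d_tau X Y + d_tau Y Z + e + e'" using w(1) by blast
  next
    fix w and e' :: real assume w: "w \<in> K_tau Z" and "e' > 0"
    obtain v where v: "v \<in> K_tau Y" "L1_dist \<rho> (v \<circ> fst) (w \<circ> snd) < d_tau Y Z + r"
      using D_tau_bounds(2)[OF Y Z \<rho> w D\<rho>] by blast
    obtain u where u: "u \<in> K_tau X" "L1_dist \<pi> (u \<circ> fst) (v \<circ> snd) < d_tau X Y + r"
      using D_tau_bounds(2)[OF X Y \<pi> v(1) D\<pi>] by blast
    have "L1_dist \<sigma> (u \<circ> fst) (w \<circ> snd) \<le> d_tau X Y + d_tau Y Z + e + e'"
      using key[OF u(1) v(1) w] u(2) v(2) \<open>e' > 0\<close> by (simp add: r_def)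
    then show "\<exists>u\<in>K_tau X. L1_dist \<sigma> (u \<circ> fst) (w \<circ> snd) \<le> d_tau X Y + d_tau Y Z + e + e'" using u(1) by blast
  qed
  then show "d_tau X Z \<le> d_tau X Y + d_tau Y Z + e" using d_tau_le_D_tau[OF X Z \<sigma>] by linarith
qed

subsection \<open>Data sets generated by features on a probability space\<close>

text \<open>
  The carrier is the support of the image of \<open>M\<close> in the sup-metric completion: its points are
  the functions \<open>c\<close> on \<open>F\<close> that are uniformly approximated by the evaluations
  \<open>f \<mapsto> f \<omega>\<close> with positive probability.
\<close>

lemma gds_of_features:
  fixes M :: "'w measure" and F :: "('w \<Rightarrow> real) set"
  assumes "prob_space M" and F: "F \<noteq> {}"
    and bdd: "\<And>\<omega> \<omega>'. \<omega> \<in> space M \<Longrightarrow> \<omega>' \<in> space M \<Longrightarrow> bdd_above ((\<lambda>f. \<bar>f \<omega> - f \<omega>'\<bar>) ` F)"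
    and meas: "\<And>c e. {\<omega> \<in> space M. \<forall>f\<in>F. \<bar>c f - f \<omega>\<bar> \<le> e} \<in> sets M"
    and Q: "countable Q" "Q \<subseteq> space M" "\<And>\<omega> e. \<omega> \<in> space M \<Longrightarrow> e > 0 \<Longrightarrow> \<exists>q\<in>Q. \<forall>f\<in>F. \<bar>f \<omega> - f q\<bar> \<le> e"
  obtains Z :: "(('w \<Rightarrow> real) \<Rightarrow> real) gds" and \<phi> and ev
  where "geometric_data_set Z" "\<phi> \<in> measurable M (gds_measure Z)"
    "distr M (gds_measure Z) \<phi> = gds_measure Z" "gds_features Z = ev ` F"
    "AE \<omega> in M. \<forall>f\<in>F. ev f (\<phi> \<omega>) = f \<omega>"
proof -
  interpret prob_space M by fact
  define N where "N c e = {\<omega> \<in> space M. \<forall>f\<in>F. \<bar>c f - f \<omega>\<bar> \<le> e}" for c :: "('w \<Rightarrow> real) \<Rightarrow> real" and e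
  have N[measurable]: "N c e \<in> sets M" for c e unfolding N_def by (rule meas)
  define C where "C = {c \<in> extensional F. \<forall>e>0. emeasure M (N c e) > 0}"
  have Cext: "c \<in> extensional F" and CN: "e > 0 \<Longrightarrow> emeasure M (N c e) > 0" if "c \<in> C" for c e
    using that by (auto simp: C_def)
  have Cnear: "\<exists>\<omega>\<in>space M. \<forall>f\<in>F. \<bar>c f - f \<omega>\<bar> \<le> e" if "c \<in> C" "e > 0" for c e
  proof -
    have "N c e \<noteq> {}" using CN[OF that] by auto
    then show ?thesis by (auto simp: N_def)
  qed
  define ev where "ev f = (\<lambda>c\<in>C. c f)" for f :: "'w \<Rightarrow> real"
  \<comment> \<open>The topology depends on carrier and features alone, so a placeholder measure
    lets it be fixed before the measure, which is defined on its Borel sets.\<close>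
  define T where "T = gds_topology (\<lparr>gds_carrier = C, gds_features = ev ` F, gds_measure = undefined\<rparr>)"
  define \<Phi> where "\<Phi> \<omega> = (\<lambda>f\<in>F. f \<omega>)" for \<omega>
  \<comment> \<open>Countably many null neighbourhoods, centred at points of \<open>Q\<close>,
    suffice: a null neighbourhood of any \<omega> contains one of them that itself contains
    \<omega>. Their union \<open>B\<close> is therefore null and contains every point whose
    evaluation misses the support.\<close>
  define I where "I = {p \<in> Q \<times> (UNIV :: nat set). emeasure M (N (\<Phi> (fst p)) (1 / Suc (snd p))) = 0}"
  define B where "B = (\<Union>p\<in>I. N (\<Phi> (fst p)) (1 / Suc (snd p)))"
  have "countable I" unfolding I_def using Q(1) by (intro countable_Collect) auto
  then have B: "B \<in> null_sets M" unfolding B_def by (rule null_sets_UN') (auto simp: I_def null_sets_def)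
  have Bm[measurable]: "B \<in> sets M" using B by auto
  have \<Phi>C: "\<Phi> \<omega> \<in> C" if \<omega>: "\<omega> \<in> space M" "\<omega> \<notin> B" for \<omega>
  proof (rule ccontr)
    assume "\<Phi> \<omega> \<notin> C"
    then obtain e where e: "e > 0" "emeasure M (N (\<Phi> \<omega>) e) = 0" by (auto simp: C_def \<Phi>_def)
    obtain n where n: "1 / Suc n < e / 2" using nat_approx_posE[of "e/2"] e(1) by auto
    have "1 / real (Suc n) > 0" by simp
    from Q(3)[OF \<omega>(1) this] obtain q where q: "q \<in> Q" "\<forall>f\<in>F. \<bar>f \<omega> - f q\<bar> \<le> 1 / Suc n" by blast
    have "N (\<Phi> q) (1 / Suc n) \<subseteq> N (\<Phi> \<omega>) e"
    proof
      fix \<eta> assume \<eta>: "\<eta> \<in> N (\<Phi> q) (1 / Suc n)"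
      have "\<bar>f \<omega> - f \<eta>\<bar> \<le> e" if "f \<in> F" for f
      proof -
        have "\<bar>f q - f \<eta>\<bar> \<le> 1 / Suc n" using \<eta> that by (simp add: N_def \<Phi>_def)
        moreover have "\<bar>f \<omega> - f q\<bar> \<le> 1 / Suc n" using q(2) that by blast
        ultimately show ?thesis using n by linarith
      qed
      then show "\<eta> \<in> N (\<Phi> \<omega>) e" using \<eta> by (simp add: N_def \<Phi>_def)
    qed
    then have "emeasure M (N (\<Phi> q) (1 / Suc n)) \<le> emeasure M (N (\<Phi> \<omega>) e)" by (rule emeasure_mono) simp
    then have "(q, n) \<in> I" using e(2) q(1) by (simp add: I_def)
    moreover have "\<omega> \<in> N (\<Phi> q) (1 / Suc n)"
      using \<omega>(1) q(2) by (auto simp: N_def \<Phi>_def abs_minus_commute)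
    ultimately show False using \<omega>(2) unfolding B_def by force
  qed
  have notB: "emeasure M (A - B) = emeasure M A" if "A \<in> sets M" for A
    using that B by (rule emeasure_Diff_null_set[rotated])
  have "emeasure M (space M - B) = 1" using notB[of "space M"] emeasure_space_1 by simp
  then have "space M - B \<noteq> {}" by (metis emeasure_empty zero_neq_one)
  then obtain c0 where c0: "c0 \<in> C" using \<Phi>C by blast
  \<comment> \<open>On the null set the map takes an arbitrary point of the support, so that it has
    values in the carrier everywhere.\<close>
  define \<phi> where "\<phi> \<omega> = (if \<omega> \<in> B then c0 else \<Phi> \<omega>)" for \<omega>
  have \<phi>C: "\<phi> \<omega> \<in> C" if "\<omega> \<in> space M" for \<omega> using that \<Phi>C c0 by (simp add: \<phi>_def)
  define Z where "Z = \<lparr>gds_carrier = C, gds_features = ev ` F,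
     gds_measure = distr M (sigma C (borel_sets T)) \<phi>\<rparr>"
  have [simp]: "gds_carrier Z = C" "gds_features Z = ev ` F" by (simp_all add: Z_def)
  have "gds_dist Z = gds_dist \<lparr>gds_carrier = C, gds_features = ev ` F, gds_measure = undefined\<rparr>"
    by (auto simp: fun_eq_iff gds_dist_def)
  then have T: "gds_topology Z = T" by (simp add: T_def)
  have bddC: "bdd_above ((\<lambda>f. \<bar>c f - c' f\<bar>) ` F)" if c: "c \<in> C" "c' \<in> C" for c c'
  proof -
    obtain \<omega> \<omega>' where \<omega>: "\<omega> \<in> space M" "\<forall>f\<in>F. \<bar>c f - f \<omega>\<bar> \<le> 1" "\<omega>' \<in> space M" "\<forall>f\<in>F. \<bar>c' f - f \<omega>'\<bar> \<le> 1"
      using Cnear[OF c(1), of 1] Cnear[OF c(2), of 1] by auto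
    obtain b where b: "\<And>f. f \<in> F \<Longrightarrow> \<bar>f \<omega> - f \<omega>'\<bar> \<le> b"
      using bdd[OF \<omega>(1,3)] by (auto simp: bdd_above_def)
    have "\<bar>c f - c' f\<bar> \<le> b + 2" if "f \<in> F" for f
    proof -
      have "\<bar>c f - f \<omega>\<bar> \<le> 1" "\<bar>c' f - f \<omega>'\<bar> \<le> 1" using \<omega> that by auto
      then show ?thesis using b[OF that] by linarith
    qed
    then show ?thesis by (auto simp: bdd_above_def)
  qed
  have dist: "gds_dist Z c c' = (SUP f\<in>F. \<bar>c f - c' f\<bar>)" if "c \<in> C" "c' \<in> C" for c c'
    using that by (simp add: gds_dist_def ev_def image_image)
  have dist_le: "gds_dist Z c c' \<le> e \<longleftrightarrow> (\<forall>f\<in>F. \<bar>c f - c' f\<bar> \<le> e)" if "c \<in> C" "c' \<in> C" for c c' e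
    unfolding dist[OF that] by (rule cSUP_le_iff[OF F bddC[OF that]])
  have dist_out: "gds_dist Z c c' = 0" if "\<not> (c \<in> C \<and> c' \<in> C)" for c c'
    using that by (auto simp: gds_dist_def)
  have le_dist: "\<bar>c f - c' f\<bar> \<le> gds_dist Z c c'" if "c \<in> C" "c' \<in> C" "f \<in> F" for c c' f
    using dist_le[OF that(1,2), of "gds_dist Z c c'"] that(3) by simp
  have dist_nonneg: "0 \<le> gds_dist Z c c'" for c c'
  proof (cases "c \<in> C \<and> c' \<in> C")
    case True
    obtain f where "f \<in> F" using F by blast
    then show ?thesis using le_dist[of c c' f] True by linarith
  qed (simp add: dist_out)
  interpret MZ: Metric_space C "gds_dist Z"
  proof
    show "0 \<le> gds_dist Z c c'" for c c' by (rule dist_nonneg)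
    show "gds_dist Z c c' = gds_dist Z c' c" for c c'
      by (cases "c \<in> C \<and> c' \<in> C") (auto simp: dist dist_out abs_minus_commute)
    show "gds_dist Z c c' = 0 \<longleftrightarrow> c = c'" if c: "c \<in> C" "c' \<in> C" for c c'
    proof
      assume "gds_dist Z c c' = 0"
      then have "c f = c' f" if "f \<in> F" for f using le_dist[OF c that] by simp
      then show "c = c'" using Cext[OF c(1)] Cext[OF c(2)] by (intro extensionalityI) auto
    next
      assume "c = c'"
      then have "gds_dist Z c c' \<le> 0" using dist_le[OF c] by simp
      then show "gds_dist Z c c' = 0" using dist_nonneg[of c c'] by linarith
    qed
    show "gds_dist Z a c \<le> gds_dist Z a b + gds_dist Z b c" if abc: "a \<in> C" "b \<in> C" "c \<in> C" for a b c
      unfolding dist_le[OF abc(1,3)]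
    proof
      fix f assume "f \<in> F"
      then show "\<bar>a f - c f\<bar> \<le> gds_dist Z a b + gds_dist Z b c"
        using le_dist[OF abc(1,2)] le_dist[OF abc(2,3)] by (smt (verit))
    qed
  qed
  have Tm: "MZ.mtopology = T" using T by simp
  have spT: "topspace T = C" using MZ.topspace_mtopology Tm by simp
  have sg: "space (sigma C (borel_sets T)) = C" "sets (sigma C (borel_sets T)) = borel_sets T"
    using borel_sets_subset[of T] spT
    by (auto simp: space_measure_of_conv borel_sets_def intro!: sigma_sets_sigma_sets_eq dest: openin_subset)
  have spZ: "space (gds_measure Z) = C" "sets (gds_measure Z) = borel_sets T"
    using sg by (simp_all add: Z_def)
  have ball: "\<exists>r>0. \<forall>c'\<in>C. (\<forall>f\<in>F. \<bar>c f - c' f\<bar> \<le> r) \<longrightarrow> c' \<in> U" if U: "openin T U" "c \<in> U" for U c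
  proof -
    have cC: "c \<in> C" using openin_subset[OF U(1)] U(2) spT by blast
    obtain r where r: "r > 0" "MZ.mball c r \<subseteq> U"
      using U unfolding Tm[symmetric] MZ.openin_mtopology by blast
    have "c' \<in> U" if "c' \<in> C" "\<forall>f\<in>F. \<bar>c f - c' f\<bar> \<le> r/2" for c'
    proof -
      have "gds_dist Z c c' \<le> r / 2" using dist_le[OF cC that(1)] that(2) by blast
      then have "c' \<in> MZ.mball c r" using r(1) that(1) cC by simp
      then show ?thesis using r(2) by blast
    qed
    then show ?thesis using r(1) by (intro exI[of _ "r/2"]) auto
  qed
  \<comment> \<open>Evaluations at points of \<open>Q\<close> may lie outside the support, so they
    cannot serve as a dense set. For each \<open>q\<close> and each accuracy a nearby point of
    \<open>C\<close> is chosen where there is one.\<close>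
  define J where "J = {p \<in> Q \<times> (UNIV :: nat set). \<exists>c\<in>C. \<forall>f\<in>F. \<bar>c f - f (fst p)\<bar> \<le> 1 / Suc (snd p)}"
  define pick where "pick p = (SOME c. c \<in> C \<and> (\<forall>f\<in>F. \<bar>c f - f (fst p)\<bar> \<le> 1 / Suc (snd p)))"
    for p :: "'w \<times> nat"
  define D where "D = pick ` J"
  have pick: "pick p \<in> C" "\<forall>f\<in>F. \<bar>pick p f - f (fst p)\<bar> \<le> 1 / Suc (snd p)" if "p \<in> J" for p
    using someI_ex[of "\<lambda>c. c \<in> C \<and> (\<forall>f\<in>F. \<bar>c f - f (fst p)\<bar> \<le> 1 / Suc (snd p))"] that
    unfolding pick_def J_def by auto
  have "countable J" unfolding J_def using Q(1) by (intro countable_Collect) auto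
  then have Dcount: "countable D" by (simp add: D_def)
  have DC: "D \<subseteq> C" using pick(1) by (auto simp: D_def)
  have dense: "\<exists>c'\<in>D. \<forall>f\<in>F. \<bar>c f - c' f\<bar> \<le> e" if c: "c \<in> C" and e: "e > 0" for c e
  proof -
    obtain n where n: "1 / Suc n < e / 2" using nat_approx_posE[of "e/2"] e by auto
    \<comment> \<open>Two steps of length \<open>r\<close>, from \<open>c\<close> to \<omega> and
      from \<omega> to \<open>q\<close>, reach exactly the radius that \<open>J\<close> asks
      for.\<close>
    obtain r :: real where r: "r > 0" and rr: "r + r = 1 / Suc n"
      using that[OF _ field_sum_of_halves] by simp
    obtain \<omega> where \<omega>: "\<omega> \<in> space M" "\<forall>f\<in>F. \<bar>c f - f \<omega>\<bar> \<le> r" using Cnear[OF c r] by blast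
    obtain q where q: "q \<in> Q" "\<forall>f\<in>F. \<bar>f \<omega> - f q\<bar> \<le> r" using Q(3)[OF \<omega>(1) r] by blast
    have cq: "\<bar>c f - f q\<bar> \<le> 1 / Suc n" if "f \<in> F" for f
    proof -
      have "\<bar>c f - f \<omega>\<bar> \<le> r" "\<bar>f \<omega> - f q\<bar> \<le> r" using \<omega>(2) q(2) that by auto
      then have "\<bar>c f - f q\<bar> \<le> r + r" by linarith
      then show ?thesis by (simp only: rr)
    qed
    then have J: "(q, n) \<in> J" using q(1) c by (auto simp: J_def)
    have "\<bar>c f - pick (q, n) f\<bar> \<le> e" if "f \<in> F" for f
    proof -
      have "\<bar>pick (q, n) f - f q\<bar> \<le> 1 / Suc n" using pick(2)[OF J] that by simp
      then show ?thesis using cq[OF that] n by linarith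
    qed
    then show ?thesis using J unfolding D_def by blast
  qed
  have mh: "\<phi> \<in> measurable M (sigma C (borel_sets T))"
  proof (rule measurable_sigma_sets[where \<Omega> = C and A = "{U. openin T U}"])
    show "sets (sigma C (borel_sets T)) = sigma_sets C {U. openin T U}"
      using sg spT by (simp add: borel_sets_def)
    show "{U. openin T U} \<subseteq> Pow C" using spT by (auto dest: openin_subset)
    show "\<phi> \<in> space M \<rightarrow> C" using \<phi>C by auto
    fix U assume "U \<in> {U. openin T U}"
    then have U: "openin T U" by simp
    \<comment> \<open>Preimages are known to be measurable only for closed supremum balls. An open
      set is a countable union of such balls centred in \<open>D\<close>; on \<open>B\<close> the
      map is constant and is treated separately.\<close>
    define P where "P = {p \<in> D \<times> (UNIV :: nat set). \<forall>c\<in>C. (\<forall>f\<in>F. \<bar>fst p f - c f\<bar> \<le> 1 / Suc (snd p)) \<longrightarrow> c \<in> U}"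
    have "countable P" unfolding P_def using Dcount by (intro countable_Collect) auto
    then have "(\<Union>p\<in>P. N (fst p) (1 / Suc (snd p)) - B) \<in> sets M"
      by (rule sets.countable_UN'') auto
    moreover have "(if c0 \<in> U then B else {}) \<in> sets M" by simp
    moreover have "\<phi> -` U \<inter> space M = (\<Union>p\<in>P. N (fst p) (1 / Suc (snd p)) - B) \<union> (if c0 \<in> U then B else {})"
    proof (intro equalityI subsetI)
      fix \<omega> assume \<omega>: "\<omega> \<in> \<phi> -` U \<inter> space M"
      show "\<omega> \<in> (\<Union>p\<in>P. N (fst p) (1 / Suc (snd p)) - B) \<union> (if c0 \<in> U then B else {})"
      proof (cases "\<omega> \<in> B")
        case True
        then show ?thesis using \<omega> by (simp add: \<phi>_def)
      next
        case False
        then have \<Phi>U: "\<Phi> \<omega> \<in> U" "\<Phi> \<omega> \<in> C" using \<omega> \<Phi>C by (auto simp: \<phi>_def)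
        obtain r where r: "r > 0" "\<And>c. c \<in> C \<Longrightarrow> (\<forall>f\<in>F. \<bar>\<Phi> \<omega> f - c f\<bar> \<le> r) \<Longrightarrow> c \<in> U"
          using ball[OF U \<Phi>U(1)] by blast
        obtain n where n: "1 / Suc n < r / 2" using nat_approx_posE[of "r/2"] r(1) by auto
        have "1 / real (Suc n) > 0" by simp
        from dense[OF \<Phi>U(2) this] obtain c where c: "c \<in> D" "\<forall>f\<in>F. \<bar>\<Phi> \<omega> f - c f\<bar> \<le> 1 / Suc n" by blast
        have "(c, n) \<in> P"
          unfolding P_def
        proof (clarsimp simp: c(1))
          fix c' assume c': "c' \<in> C" "\<forall>f\<in>F. \<bar>c f - c' f\<bar> \<le> 1 / (1 + real n)"
          show "c' \<in> U"
          proof (rule r(2)[OF c'(1)], rule ballI)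
            fix f assume "f \<in> F"
            then have "\<bar>\<Phi> \<omega> f - c f\<bar> \<le> 1 / Suc n" "\<bar>c f - c' f\<bar> \<le> 1 / Suc n" using c c' by auto
            then show "\<bar>\<Phi> \<omega> f - c' f\<bar> \<le> r" using n by linarith
          qed
        qed
        moreover have "\<omega> \<in> N c (1 / Suc n)" using c(2) \<omega> by (auto simp: N_def \<Phi>_def abs_minus_commute)
        ultimately show ?thesis using False by force
      qed
    next
      fix \<omega> assume \<omega>: "\<omega> \<in> (\<Union>p\<in>P. N (fst p) (1 / Suc (snd p)) - B) \<union> (if c0 \<in> U then B else {})"
      have sp: "\<omega> \<in> space M" using \<omega> sets.sets_into_space[OF Bm] by (auto simp: N_def split: if_splits)
      show "\<omega> \<in> \<phi> -` U \<inter> space M"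
      proof (cases "\<omega> \<in> B")
        case True
        then show ?thesis using \<omega> sp by (auto simp: \<phi>_def split: if_splits)
      next
        case False
        then obtain p where p: "p \<in> P" "\<omega> \<in> N (fst p) (1 / Suc (snd p))" using \<omega> by (auto split: if_splits)
        have "\<forall>f\<in>F. \<bar>fst p f - \<Phi> \<omega> f\<bar> \<le> 1 / Suc (snd p)" using p(2) by (simp add: N_def \<Phi>_def)
        then have "\<Phi> \<omega> \<in> U" using p(1) \<Phi>C[OF sp False] unfolding P_def by blast
        then show ?thesis using sp False by (simp add: \<phi>_def)
      qed
    qed
    ultimately show "\<phi> -` U \<inter> space M \<in> sets M" by simp
  qed
  have "MZ.mcomplete"
    unfolding MZ.mcomplete_def
  proof (intro allI impI)
    fix \<sigma> assume s: "MZ.MCauchy \<sigma>"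
    then have sC: "\<sigma> n \<in> C" for n by (auto simp: MZ.MCauchy_def)
    have s': "\<exists>k. \<forall>n\<ge>k. \<forall>m\<ge>k. \<forall>f\<in>F. \<bar>\<sigma> n f - \<sigma> m f\<bar> \<le> e" if "e > 0" for e
    proof -
      obtain k where k: "\<And>n m. k \<le> n \<Longrightarrow> k \<le> m \<Longrightarrow> gds_dist Z (\<sigma> n) (\<sigma> m) < e"
        using s \<open>e > 0\<close> unfolding MZ.MCauchy_def by blast
      have "\<bar>\<sigma> n f - \<sigma> m f\<bar> \<le> e" if "n \<ge> k" "m \<ge> k" "f \<in> F" for n m f
        using le_dist[OF sC sC that(3), of n m] k[OF that(1,2)] by linarith
      then show ?thesis by blast
    qed
    have "convergent (\<lambda>n. \<sigma> n f)" if f: "f \<in> F" for f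
    proof (rule Cauchy_convergent, rule CauchyI)
      fix e :: real assume "e > 0"
      then obtain k where "\<forall>n\<ge>k. \<forall>m\<ge>k. \<forall>f\<in>F. \<bar>\<sigma> n f - \<sigma> m f\<bar> \<le> e / 2" using s'[of "e/2"] by auto
      then have "\<forall>m\<ge>k. \<forall>n\<ge>k. norm (\<sigma> m f - \<sigma> n f) < e" using f \<open>e > 0\<close> by fastforce
      then show "\<exists>k. \<forall>m\<ge>k. \<forall>n\<ge>k. norm (\<sigma> m f - \<sigma> n f) < e" by blast
    qed
    then have lim: "(\<lambda>n. \<sigma> n f) \<longlonglongrightarrow> lim (\<lambda>n. \<sigma> n f)" if "f \<in> F" for f
      using that by (simp add: convergent_LIMSEQ_iff)
    define c where "c = (\<lambda>f\<in>F. lim (\<lambda>n. \<sigma> n f))"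
    have unif: "\<exists>k. \<forall>n\<ge>k. \<forall>f\<in>F. \<bar>\<sigma> n f - c f\<bar> \<le> e" if "e > 0" for e
    proof -
      obtain k where k: "\<forall>n\<ge>k. \<forall>m\<ge>k. \<forall>f\<in>F. \<bar>\<sigma> n f - \<sigma> m f\<bar> \<le> e" using s'[OF \<open>e > 0\<close>] by blast
      have "\<bar>\<sigma> n f - c f\<bar> \<le> e" if n: "n \<ge> k" and f: "f \<in> F" for n f
      proof (rule LIMSEQ_le_const2)
        show "(\<lambda>m. \<bar>\<sigma> n f - \<sigma> m f\<bar>) \<longlonglongrightarrow> \<bar>\<sigma> n f - c f\<bar>"
          using lim[OF f] f by (auto simp: c_def intro!: tendsto_intros)
        show "\<exists>N. \<forall>m\<ge>N. \<bar>\<sigma> n f - \<sigma> m f\<bar> \<le> e" using k n f by blast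
      qed
      then show ?thesis by blast
    qed
    have "c \<in> C"
      unfolding C_def
    proof (intro CollectI conjI allI impI)
      show "c \<in> extensional F" by (simp add: c_def)
      fix e :: real assume e: "e > 0"
      obtain k where k: "\<forall>n\<ge>k. \<forall>f\<in>F. \<bar>\<sigma> n f - c f\<bar> \<le> e / 2" using unif[of "e/2"] e by auto
      \<comment> \<open>Being in the support is preserved by uniform limits: a neighbourhood of a
        late member of the sequence lies inside that of the limit.\<close>
      have "N (\<sigma> k) (e / 2) \<subseteq> N c e"
      proof
        fix \<omega> assume \<omega>: "\<omega> \<in> N (\<sigma> k) (e / 2)"
        have "\<bar>c f - f \<omega>\<bar> \<le> e" if "f \<in> F" for f
        proof -
          have "\<bar>\<sigma> k f - f \<omega>\<bar> \<le> e / 2" "\<bar>\<sigma> k f - c f\<bar> \<le> e / 2" using \<omega> k that by (auto simp: N_def)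
          then show ?thesis by linarith
        qed
        then show "\<omega> \<in> N c e" using \<omega> by (simp add: N_def)
      qed
      then have "emeasure M (N (\<sigma> k) (e / 2)) \<le> emeasure M (N c e)" by (rule emeasure_mono) simp
      moreover have "emeasure M (N (\<sigma> k) (e / 2)) > 0" using CN[OF sC] e by simp
      ultimately show "emeasure M (N c e) > 0" by (rule less_le_trans[rotated])
    qed
    moreover have "\<exists>k. \<forall>n\<ge>k. gds_dist Z (\<sigma> n) c < e" if "e > 0" for e
    proof -
      obtain k where k: "\<forall>n\<ge>k. \<forall>f\<in>F. \<bar>\<sigma> n f - c f\<bar> \<le> e / 2" using unif[of "e/2"] \<open>e > 0\<close> by auto
      have "gds_dist Z (\<sigma> n) c < e" if "n \<ge> k" for n
      proof -
        have "gds_dist Z (\<sigma> n) c \<le> e / 2" using dist_le[OF sC \<open>c \<in> C\<close>] k that by blast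
        then show ?thesis using \<open>e > 0\<close> by linarith
      qed
      then show ?thesis by blast
    qed
    ultimately have "limitin MZ.mtopology \<sigma> c sequentially"
      unfolding MZ.limit_metric_sequentially using sC by blast
    then show "\<exists>x. limitin MZ.mtopology \<sigma> x sequentially" by blast
  qed
  moreover have "separable_space MZ.mtopology"
    unfolding separable_space_def
  proof (intro exI[of _ D] conjI Dcount)
    show "D \<subseteq> topspace MZ.mtopology" using DC by simp
    have "\<exists>c'\<in>D. c' \<in> MZ.mball c r" if c: "c \<in> C" and r: "r > 0" for c r
    proof -
      obtain c' where c': "c' \<in> D" "\<forall>f\<in>F. \<bar>c f - c' f\<bar> \<le> r / 2" using dense[OF c, of "r/2"] r by auto
      then have "gds_dist Z c c' \<le> r / 2" using dist_le[OF c] DC by blast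
      then show ?thesis using c' c r DC by (intro bexI[of _ c']) auto
    qed
    then show "MZ.mtopology closure_of D = topspace MZ.mtopology"
      unfolding MZ.metric_closure_of by auto
  qed
  moreover have "prob_space (gds_measure Z)"
    using prob_space_distr[OF mh] by (simp add: Z_def)
  moreover have "emeasure (gds_measure Z) U > 0" if U: "openin T U" "U \<noteq> {}" for U
  proof -
    obtain c where c: "c \<in> U" using U(2) by blast
    then have cC: "c \<in> C" using openin_subset[OF U(1)] spT by blast
    obtain r where r: "r > 0" "\<And>c'. c' \<in> C \<Longrightarrow> (\<forall>f\<in>F. \<bar>c f - c' f\<bar> \<le> r) \<Longrightarrow> c' \<in> U"
      using ball[OF U(1) c] by blast
    \<comment> \<open>Removing \<open>B\<close> costs no mass and avoids the points where the map is
      not evaluation.\<close>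
    have "N c r - B \<subseteq> \<phi> -` U \<inter> space M"
    proof
      fix \<omega> assume \<omega>: "\<omega> \<in> N c r - B"
      then have "\<Phi> \<omega> \<in> C" using \<Phi>C by (simp add: N_def)
      then have "\<Phi> \<omega> \<in> U" using \<omega> by (intro r(2)) (auto simp: N_def \<Phi>_def)
      then show "\<omega> \<in> \<phi> -` U \<inter> space M" using \<omega> by (simp add: \<phi>_def N_def)
    qed
    moreover have Us: "U \<in> sets (sigma C (borel_sets T))" using openin_borel_sets[OF U(1)] sg by simp
    ultimately have "emeasure M (N c r - B) \<le> emeasure M (\<phi> -` U \<inter> space M)"
      by (intro emeasure_mono measurable_sets[OF mh])
    then have "emeasure M (N c r) \<le> emeasure (gds_measure Z) U"
      using emeasure_distr[OF mh Us] notB[OF N] by (simp add: Z_def)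
    then show ?thesis using CN[OF cC r(1)] by (rule less_le_trans[rotated])
  qed
  moreover have "bdd_above ((\<lambda>g. \<bar>g c - g c'\<bar>) ` ev ` F)" if "c \<in> C" "c' \<in> C" for c c'
    using bddC[OF that] that by (simp add: image_image ev_def)
  moreover have "ev ` F \<noteq> {}" "ev ` F \<subseteq> extensional C" using F by (auto simp: ev_def)
  ultimately have Z: "geometric_data_set Z"
    unfolding geometric_data_set_def using MZ.Metric_space_axioms spZ Tm by simp
  have mh': "\<phi> \<in> measurable M (gds_measure Z)" using mh by (simp add: Z_def)
  have "distr M (gds_measure Z) \<phi> = distr M (sigma C (borel_sets T)) \<phi>"
    by (rule distr_cong) (simp_all add: spZ sg)
  then have dZ: "distr M (gds_measure Z) \<phi> = gds_measure Z" by (simp add: Z_def)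
  have "AE \<omega> in M. \<omega> \<notin> B" using B by (rule AE_not_in)
  then have "AE \<omega> in M. \<forall>f\<in>F. ev f (\<phi> \<omega>) = f \<omega>"
    using AE_space
  proof eventually_elim
    case (elim \<omega>)
    then show ?case using \<Phi>C[OF elim(2,1)] by (simp add: \<phi>_def ev_def) (simp add: \<Phi>_def)
  qed
  then show ?thesis using that[OF Z mh' dZ] by simp
qed

subsection \<open>Interpolation\<close>

text \<open>A presentation of the data set by random variables: \<open>H\<close> has the same L1
  closure over \<open>M\<close> as the pulled-back \<open>K_tau\<close>. Approximation in both
  directions replaces equality because the interpolated families are not themselves closed under
  limits. Data sets realized over the same \<open>M\<close> can be compared through their families
  alone.\<close>

definition gds_realized :: "'w measure \<Rightarrow> 'a gds \<Rightarrow> ('w \<Rightarrow> 'a) \<Rightarrow> ('w \<Rightarrow> real) set \<Rightarrow> bool" where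
  "gds_realized M X \<phi> H \<longleftrightarrow>
     \<phi> \<in> measurable M (gds_measure X) \<and> distr M (gds_measure X) \<phi> = gds_measure X \<and>
     (\<forall>u\<in>K_tau X. \<forall>e>0. \<exists>h\<in>H. L1_dist M (u \<circ> \<phi>) h < e) \<and>
     (\<forall>h\<in>H. \<forall>e>0. \<exists>u\<in>K_tau X. L1_dist M (u \<circ> \<phi>) h < e)"

text \<open>The joint law of the two maps is a coupling, under which L1 distances are those over
  \<open>M\<close>. Integrability of the families is what permits the triangle inequality for the
  Bochner integral.\<close>

lemma d_tau_le_realized:
  assumes X: "geometric_data_set X" and Y: "geometric_data_set Y" and M: "prob_space M"
    and \<phi>: "gds_realized M X \<phi> H" and \<psi>: "gds_realized M Y \<psi> H'"
    and int: "\<And>h. h \<in> H \<Longrightarrow> integrable M h" "\<And>h. h \<in> H' \<Longrightarrow> integrable M h"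
    and H: "\<And>h. h \<in> H \<Longrightarrow> \<exists>h'\<in>H'. L1_dist M h h' \<le> c"
    and H': "\<And>h'. h' \<in> H' \<Longrightarrow> \<exists>h\<in>H. L1_dist M h h' \<le> c"
  shows "d_tau X Y \<le> c"
proof -
  interpret prob_space M by (rule M)
  have m: "\<phi> \<in> measurable M (gds_measure X)" "\<psi> \<in> measurable M (gds_measure Y)"
    and d: "distr M (gds_measure X) \<phi> = gds_measure X" "distr M (gds_measure Y) \<psi> = gds_measure Y"
    using \<phi> \<psi> by (auto simp: gds_realized_def)
  define \<pi> where "\<pi> = distr M (gds_measure X \<Otimes>\<^sub>M gds_measure Y) (\<lambda>\<omega>. (\<phi> \<omega>, \<psi> \<omega>))"
  have mp: "(\<lambda>\<omega>. (\<phi> \<omega>, \<psi> \<omega>)) \<in> measurable M (gds_measure X \<Otimes>\<^sub>M gds_measure Y)"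
    using m by (rule measurable_Pair)
  have \<pi>: "\<pi> \<in> gds_couplings X Y"
  proof (rule gds_couplingI[OF X Y])
    show "prob_space \<pi>" unfolding \<pi>_def by (rule prob_space_distr[OF mp])
    show "sets \<pi> = sets (gds_measure X \<Otimes>\<^sub>M gds_measure Y)" by (simp add: \<pi>_def)
    show "distr \<pi> (gds_measure X) fst = gds_measure X"
      unfolding \<pi>_def by (subst distr_distr[OF measurable_fst mp]) (simp add: o_def d)
    show "distr \<pi> (gds_measure Y) snd = gds_measure Y"
      unfolding \<pi>_def by (subst distr_distr[OF measurable_snd mp]) (simp add: o_def d)
  qed
  have L: "L1_dist \<pi> (u \<circ> fst) (v \<circ> snd) = L1_dist M (u \<circ> \<phi>) (v \<circ> \<psi>)"
    if "u \<in> K_tau X" "v \<in> K_tau Y" for u v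
  proof -
    have [measurable]: "u \<in> borel_measurable (gds_measure X)" "v \<in> borel_measurable (gds_measure Y)"
      using K_tau_measurable X Y that by auto
    show ?thesis unfolding L1_dist_def \<pi>_def by (subst integral_distr[OF mp]) auto
  qed
  have T: "L1_dist M (u \<circ> \<phi>) (v \<circ> \<psi>) \<le> L1_dist M (u \<circ> \<phi>) h + L1_dist M h h' + L1_dist M (v \<circ> \<psi>) h'"
    if "u \<in> K_tau X" "v \<in> K_tau Y" "h \<in> H" "h' \<in> H'" for u v h h'
  proof -
    have iu: "integrable M (u \<circ> \<phi>)" and iv: "integrable M (v \<circ> \<psi>)"
      using K_tau_comp_integrable[OF X that(1) M m(1)] K_tau_comp_integrable[OF Y that(2) M m(2)] by auto
    show ?thesis
      using L1_dist_triangle[OF iu int(1)[OF that(3)] iv] L1_dist_triangle[OF int(1)[OF that(3)] int(2)[OF that(4)] iv]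
      by (simp add: L1_dist_commute[of M "v \<circ> \<psi>" h'])
  qed
  have "D_tau \<pi> X Y \<le> c"
  proof (rule D_tau_leI[OF X Y \<pi>])
    fix u and e :: real assume u: "u \<in> K_tau X" and e: "e > 0"
    obtain h where h: "h \<in> H" "L1_dist M (u \<circ> \<phi>) h < e / 2"
      using \<phi> u half_gt_zero[OF e] unfolding gds_realized_def by blast
    obtain h' where h': "h' \<in> H'" "L1_dist M h h' \<le> c" using H[OF h(1)] by blast
    obtain v where v: "v \<in> K_tau Y" "L1_dist M (v \<circ> \<psi>) h' < e / 2"
      using \<psi> h'(1) half_gt_zero[OF e] unfolding gds_realized_def by blast
    have "L1_dist \<pi> (u \<circ> fst) (v \<circ> snd) \<le> c + e"
      unfolding L[OF u v(1)] using T[OF u v(1) h(1) h'(1)] h(2) h'(2) v(2) by linarith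
    then show "\<exists>v\<in>K_tau Y. L1_dist \<pi> (u \<circ> fst) (v \<circ> snd) \<le> c + e" using v(1) by blast
  next
    fix v and e :: real assume v: "v \<in> K_tau Y" and e: "e > 0"
    obtain h' where h': "h' \<in> H'" "L1_dist M (v \<circ> \<psi>) h' < e / 2"
      using \<psi> v half_gt_zero[OF e] unfolding gds_realized_def by blast
    obtain h where h: "h \<in> H" "L1_dist M h h' \<le> c" using H'[OF h'(1)] by blast
    obtain u where u: "u \<in> K_tau X" "L1_dist M (u \<circ> \<phi>) h < e / 2"
      using \<phi> h(1) half_gt_zero[OF e] unfolding gds_realized_def by blast
    have "L1_dist \<pi> (u \<circ> fst) (v \<circ> snd) \<le> c + e"
      unfolding L[OF u(1) v] using T[OF u(1) v h(1) h'(1)] h(2) h'(2) u(2) by linarith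
    then show "\<exists>u\<in>K_tau X. L1_dist \<pi> (u \<circ> fst) (v \<circ> snd) \<le> c + e" using u(1) by blast
  qed
  then show ?thesis using d_tau_le_D_tau[OF X Y \<pi>] by linarith
qed

text \<open>Allows an abstractly constructed data set to be replaced by an isomorphic copy with
  carrier in the reals.\<close>

lemma gds_realized_iso:
  assumes X: "geometric_data_set X" and W: "geometric_data_set W" and \<theta>: "gds_isomorphism X W \<theta>"
    and \<phi>: "gds_realized M X \<phi> H"
  shows "gds_realized M W (\<theta> \<circ> \<phi>) H"
proof -
  have m: "\<phi> \<in> measurable M (gds_measure X)" "distr M (gds_measure X) \<phi> = gds_measure X"
    and \<theta>m: "\<theta> \<in> measurable (gds_measure X) (gds_measure W)" "distr (gds_measure X) (gds_measure W) \<theta> = gds_measure W"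
    using \<phi> \<theta> by (auto simp: gds_realized_def gds_isomorphism_def)
  have K: "K_tau X = (\<lambda>u. compose (gds_carrier X) u \<theta>) ` K_tau W"
    using K_tau_iso_eq[OF X W \<theta>] by simp
  have L: "L1_dist M (compose (gds_carrier X) u \<theta> \<circ> \<phi>) h = L1_dist M (u \<circ> (\<theta> \<circ> \<phi>)) h" for u h
    unfolding L1_dist_def
    by (rule Bochner_Integration.integral_cong)
      (use measurable_space[OF m(1)] gdsD(5)[OF X] in \<open>auto simp: compose_def\<close>)
  have "distr M (gds_measure W) (\<theta> \<circ> \<phi>) = gds_measure W"
    using distr_distr[OF \<theta>m(1) m(1)] m(2) \<theta>m(2) by simp
  then show ?thesis
    using \<phi> measurable_comp[OF m(1) \<theta>m(1)] unfolding gds_realized_def K by (simp add: L)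
qed

text \<open>An optimal coupling realizes both data sets through its two projections, and the
  comparison of realizations does not care in which order they are named.\<close>

lemma d_tau_swap_le:
  assumes X: "geometric_data_set X" and Y: "geometric_data_set Y"
  shows "d_tau Y X \<le> d_tau X Y"
proof -
  obtain \<rho> where \<rho>: "\<rho> \<in> gds_couplings X Y"
    "\<And>u. u \<in> K_tau X \<Longrightarrow> \<exists>v\<in>K_tau Y. L1_dist \<rho> (u \<circ> fst) (v \<circ> snd) \<le> d_tau X Y"
    "\<And>v. v \<in> K_tau Y \<Longrightarrow> \<exists>u\<in>K_tau X. L1_dist \<rho> (u \<circ> fst) (v \<circ> snd) \<le> d_tau X Y"
    using d_tau_attained[OF X Y] by blast
  note c = gds_couplingD[OF X Y \<rho>(1)]
  have z: "L1_dist \<rho> f f < e" if "e > 0" for f e using that by (simp add: L1_dist_def)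
  show ?thesis
  proof (rule d_tau_le_realized[OF Y X c(1)])
    show "gds_realized \<rho> Y snd ((\<lambda>v. v \<circ> snd) ` K_tau Y)" "gds_realized \<rho> X fst ((\<lambda>u. u \<circ> fst) ` K_tau X)"
      unfolding gds_realized_def using c z by blast+
    show "integrable \<rho> h" if "h \<in> (\<lambda>v. v \<circ> snd) ` K_tau Y" for h
      using that K_tau_comp_integrable[OF Y _ c(1,5)] by blast
    show "integrable \<rho> h" if "h \<in> (\<lambda>u. u \<circ> fst) ` K_tau X" for h
      using that K_tau_comp_integrable[OF X _ c(1,4)] by blast
    show "\<exists>h'\<in>(\<lambda>u. u \<circ> fst) ` K_tau X. L1_dist \<rho> h h' \<le> d_tau X Y" if "h \<in> (\<lambda>v. v \<circ> snd) ` K_tau Y" for h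
      using that \<rho>(3) by (auto simp: L1_dist_commute[of \<rho> "_ \<circ> snd"])
    show "\<exists>h\<in>(\<lambda>v. v \<circ> snd) ` K_tau Y. L1_dist \<rho> h h' \<le> d_tau X Y" if "h' \<in> (\<lambda>u. u \<circ> fst) ` K_tau X" for h'
      using that \<rho>(2) by (auto simp: L1_dist_commute[of \<rho> "_ \<circ> snd"])
  qed
qed

lemma d_tau_commute:
  assumes "geometric_data_set X" and "geometric_data_set Y"
  shows "d_tau X Y = d_tau Y X"
  using d_tau_swap_le assms by (metis antisym)

section \<open>The inverse of \<open>tau\<close> on the open interval: artanh of 2 w\<close>

definition atau :: "real \<Rightarrow> real" where
  "atau w = ln ((1/2 + w) / (1/2 - w)) / 2"

lemma tau_atau:
  assumes "\<bar>w\<bar> < 1/2"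
  shows "tau (atau w) = w"
proof -
  have w: "1/2 + w > 0" "1/2 - w > 0" using assms by (auto simp: abs_less_iff)
  have "exp (-2 * atau w) = (1/2 - w) / (1/2 + w)"
    using w by (simp add: atau_def exp_minus)
  then have "1/2 + tau (atau w) = 1 / (1 + (1/2 - w) / (1/2 + w))" unfolding half_plus_tau by simp
  also have "1 + (1/2 - w) / (1/2 + w) = 1 / (1/2 + w)" using w by (simp add: field_simps)
  finally show ?thesis by simp
qed

lemma tau_le_iff: "tau a \<le> tau b \<longleftrightarrow> a \<le> b"
  by (simp add: tau_def)

text \<open>Multiplying the two bounds shows that the odds (1/2 + w) / (1/2 - w) exceed those of
  \<open>w'\<close> by a factor of at most exp (4 D); half the logarithm of this is 2 D. Both gaps
  are needed, because either may be close to zero.\<close>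

lemma atau_le:
  assumes w: "\<bar>w\<bar> < 1/2" "\<bar>w'\<bar> < 1/2"
    and le: "1/2 + w \<le> exp (2 * D) * (1/2 + w')" "1/2 - w' \<le> exp (2 * D) * (1/2 - w)"
  shows "atau w \<le> atau w' + 2 * D"
proof -
  have pos: "1/2 + w > 0" "1/2 - w > 0" "1/2 + w' > 0" "1/2 - w' > 0" using w by (auto simp: abs_less_iff)
  have "(1/2 + w) * (1/2 - w') \<le> (exp (2 * D) * (1/2 + w')) * (exp (2 * D) * (1/2 - w))"
    using le pos by (intro mult_mono) auto
  also have "\<dots> = exp (4 * D) * (1/2 + w') * (1/2 - w)"
    using exp_add[of "2 * D" "2 * D"] by simp
  finally have "(1/2 + w) / (1/2 - w) \<le> exp (4 * D) * ((1/2 + w') / (1/2 - w'))"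
    using pos by (simp add: field_simps)
  then have "ln ((1/2 + w) / (1/2 - w)) \<le> ln (exp (4 * D) * ((1/2 + w') / (1/2 - w')))"
    using pos by (intro iffD2[OF ln_le_cancel_iff]) auto
  also have "\<dots> = 4 * D + ln ((1/2 + w') / (1/2 - w'))"
    using pos by (subst ln_mult) auto
  finally show ?thesis by (simp add: atau_def)
qed

text \<open>The pairs do not depend on the interpolation parameter: following one pair from s to t
  is what gives the cost proportional to the difference of s and t. The last condition keeps proper
  convex combinations inside the domain of \<open>atau\<close>.\<close>

definition optimal_pairs :: "('a \<times> 'b) measure \<Rightarrow> 'a gds \<Rightarrow> 'b gds \<Rightarrow> (('a \<Rightarrow> real) \<times> ('b \<Rightarrow> real)) set" where
  "optimal_pairs \<pi> X Y = {(u, v). u \<in> K_tau X \<and> v \<in> K_tau Y \<and>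
     L1_dist \<pi> (u \<circ> fst) (v \<circ> snd) \<le> d_tau X Y \<and>
     (u \<in> (\<lambda>f. compose (gds_carrier X) tau f) ` gds_features X \<or>
      v \<in> (\<lambda>f. compose (gds_carrier Y) tau f) ` gds_features Y)}"

definition interpolation :: "real \<Rightarrow> ('a \<Rightarrow> real) \<times> ('b \<Rightarrow> real) \<Rightarrow> 'a \<times> 'b \<Rightarrow> real" where
  "interpolation t w p = (1 - t) * fst w (fst p) + t * snd w (snd p)"

section \<open>Interpolation along an optimal coupling\<close>

context
  fixes X :: "'a gds" and Y :: "'b gds" and \<pi> :: "('a \<times> 'b) measure"
  assumes X: "geometric_data_set X" and Y: "geometric_data_set Y" and \<pi>: "\<pi> \<in> gds_couplings X Y"
    and opt: "\<And>u. u \<in> K_tau X \<Longrightarrow> \<exists>v\<in>K_tau Y. L1_dist \<pi> (u \<circ> fst) (v \<circ> snd) \<le> d_tau X Y"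
      "\<And>v. v \<in> K_tau Y \<Longrightarrow> \<exists>u\<in>K_tau X. L1_dist \<pi> (u \<circ> fst) (v \<circ> snd) \<le> d_tau X Y"
begin

lemma optimal_pairsD:
  assumes "w \<in> optimal_pairs \<pi> X Y"
  shows "fst w \<in> K_tau X" "snd w \<in> K_tau Y"
    "L1_dist \<pi> (fst w \<circ> fst) (snd w \<circ> snd) \<le> d_tau X Y"
  using assms by (auto simp: optimal_pairs_def)

lemma optimal_pairs_left:
  assumes f: "f \<in> gds_features X"
  shows "\<exists>v. (compose (gds_carrier X) tau f, v) \<in> optimal_pairs \<pi> X Y"
  using opt(1)[OF tau_feature_K_tau[OF X f]] tau_feature_K_tau[OF X f] f by (auto simp: optimal_pairs_def)

lemma optimal_pairs_right:
  assumes f: "f \<in> gds_features Y"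
  shows "\<exists>u. (u, compose (gds_carrier Y) tau f) \<in> optimal_pairs \<pi> X Y"
  using opt(2)[OF tau_feature_K_tau[OF Y f]] tau_feature_K_tau[OF Y f] f by (auto simp: optimal_pairs_def)

lemma interpolation_integrable:
  assumes w: "w \<in> optimal_pairs \<pi> X Y"
  shows "integrable \<pi> (interpolation t w)"
proof -
  note c = gds_couplingD[OF X Y \<pi>]
  have "integrable \<pi> (\<lambda>p. (1 - t) * (fst w \<circ> fst) p + t * (snd w \<circ> snd) p)"
    using K_tau_comp_integrable[OF X optimal_pairsD(1)[OF w] c(1,4)]
      K_tau_comp_integrable[OF Y optimal_pairsD(2)[OF w] c(1,5)]
    by (intro Bochner_Integration.integrable_add integrable_mult_right)
  then show ?thesis by (simp add: interpolation_def[abs_def])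
qed

lemma L1_dist_interpolation:
  assumes w: "w \<in> optimal_pairs \<pi> X Y"
  shows "L1_dist \<pi> (interpolation s w) (interpolation t w) \<le> \<bar>s - t\<bar> * d_tau X Y"
proof -
  have "L1_dist \<pi> (interpolation s w) (interpolation t w) = \<bar>s - t\<bar> * L1_dist \<pi> (fst w \<circ> fst) (snd w \<circ> snd)"
    unfolding L1_dist_def
  proof (subst integral_mult_right_zero[symmetric], rule Bochner_Integration.integral_cong[OF refl])
    fix p
    have "interpolation s w p - interpolation t w p = (t - s) * ((fst w \<circ> fst) p - (snd w \<circ> snd) p)"
      by (simp add: interpolation_def algebra_simps)
    then show "\<bar>interpolation s w p - interpolation t w p\<bar> = \<bar>s - t\<bar> * \<bar>(fst w \<circ> fst) p - (snd w \<circ> snd) p\<bar>"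
      by (simp add: abs_mult abs_minus_commute)
  qed
  also have "\<dots> \<le> \<bar>s - t\<bar> * d_tau X Y" using optimal_pairsD(3)[OF w] by (intro mult_left_mono) auto
  finally show ?thesis .
qed

text \<open>Only first members of pairs are seen at parameter 0, and not every element of
  \<open>K_tau X\<close> need be one. Every feature of \<open>X\<close> occurs, however, and
  features are L1-dense.\<close>

lemma realized_left: "gds_realized \<pi> X fst (interpolation 0 ` optimal_pairs \<pi> X Y)"
proof -
  note c = gds_couplingD[OF X Y \<pi>]
  have h: "interpolation 0 w = fst w \<circ> fst" for w :: "('a \<Rightarrow> real) \<times> ('b \<Rightarrow> real)"
    by (simp add: interpolation_def fun_eq_iff)
  show ?thesis
    unfolding gds_realized_def
  proof (intro conjI ballI allI impI)
    fix u and e :: real assume u: "u \<in> K_tau X" and e: "e > 0"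
    obtain f where f: "f \<in> gds_features X" "L1_dist (gds_measure X) u (compose (gds_carrier X) tau f) < e"
      using K_tau_L1_approx[OF X u e] by blast
    obtain v where v: "(compose (gds_carrier X) tau f, v) \<in> optimal_pairs \<pi> X Y"
      using optimal_pairs_left[OF f(1)] by blast
    have "L1_dist \<pi> (u \<circ> fst) (interpolation 0 (compose (gds_carrier X) tau f, v)) < e"
      unfolding h using f(2) L1_dist_comp[OF X u tau_feature_K_tau[OF X f(1)] c(4,6)] by simp
    then show "\<exists>h\<in>interpolation 0 ` optimal_pairs \<pi> X Y. L1_dist \<pi> (u \<circ> fst) h < e" using v by blast
  next
    fix h and e :: real assume "h \<in> interpolation 0 ` optimal_pairs \<pi> X Y" and e: "e > 0"
    then obtain w where w: "w \<in> optimal_pairs \<pi> X Y" "h = fst w \<circ> fst" by (auto simp: h)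
    then show "\<exists>u\<in>K_tau X. L1_dist \<pi> (u \<circ> fst) h < e"
      using e optimal_pairsD(1)[OF w(1)] by (intro bexI[of _ "fst w"]) (auto simp: L1_dist_def)
  qed (use c in auto)
qed

lemma realized_right: "gds_realized \<pi> Y snd (interpolation 1 ` optimal_pairs \<pi> X Y)"
proof -
  note c = gds_couplingD[OF X Y \<pi>]
  have h: "interpolation 1 w = snd w \<circ> snd" for w :: "('a \<Rightarrow> real) \<times> ('b \<Rightarrow> real)"
    by (simp add: interpolation_def fun_eq_iff)
  show ?thesis
    unfolding gds_realized_def
  proof (intro conjI ballI allI impI)
    fix v and e :: real assume v: "v \<in> K_tau Y" and e: "e > 0"
    obtain f where f: "f \<in> gds_features Y" "L1_dist (gds_measure Y) v (compose (gds_carrier Y) tau f) < e"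
      using K_tau_L1_approx[OF Y v e] by blast
    obtain u where u: "(u, compose (gds_carrier Y) tau f) \<in> optimal_pairs \<pi> X Y"
      using optimal_pairs_right[OF f(1)] by blast
    have "L1_dist \<pi> (v \<circ> snd) (interpolation 1 (u, compose (gds_carrier Y) tau f)) < e"
      unfolding h using f(2) L1_dist_comp[OF Y v tau_feature_K_tau[OF Y f(1)] c(5,7)] by simp
    then show "\<exists>h\<in>interpolation 1 ` optimal_pairs \<pi> X Y. L1_dist \<pi> (v \<circ> snd) h < e" using u by blast
  next
    fix h and e :: real assume "h \<in> interpolation 1 ` optimal_pairs \<pi> X Y" and e: "e > 0"
    then obtain w where w: "w \<in> optimal_pairs \<pi> X Y" "h = snd w \<circ> snd" by (auto simp: h)
    then show "\<exists>v\<in>K_tau Y. L1_dist \<pi> (v \<circ> snd) h < e"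
      using e optimal_pairsD(2)[OF w(1)] by (intro bexI[of _ "snd w"]) (auto simp: L1_dist_def)
  qed (use c in auto)
qed

text \<open>Both weights are positive and one member is \<open>tau\<close> of a real number, so its
  strict bound survives in the convex combination.\<close>

lemma interpolation_bounds:
  assumes w: "w \<in> optimal_pairs \<pi> X Y" and t: "0 < t" "t < 1"
    and p: "p \<in> gds_carrier X \<times> gds_carrier Y"
  shows "\<bar>interpolation t w p\<bar> < 1/2"
proof -
  let ?a = "fst w (fst p)" and ?b = "snd w (snd p)"
  have p': "fst p \<in> gds_carrier X" "snd p \<in> gds_carrier Y" using p by auto
  have le: "\<bar>?a\<bar> \<le> 1/2" "\<bar>?b\<bar> \<le> 1/2"
    using K_tau_bounds[OF optimal_pairsD(1)[OF w] p'(1)] K_tau_bounds[OF optimal_pairsD(2)[OF w] p'(2)] by auto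
  have "\<bar>?a\<bar> < 1/2 \<or> \<bar>?b\<bar> < 1/2"
    using w p' tau_bounds by (auto simp: optimal_pairs_def compose_def)
  then have "(1 - t) * \<bar>?a\<bar> + t * \<bar>?b\<bar> < (1 - t) * (1/2) + t * (1/2)"
  proof
    assume "\<bar>?a\<bar> < 1/2"
    then show ?thesis using t le by (intro add_less_le_mono mult_strict_left_mono mult_left_mono) auto
  next
    assume "\<bar>?b\<bar> < 1/2"
    then show ?thesis using t le by (intro add_le_less_mono mult_strict_left_mono mult_left_mono) auto
  qed
  also have "\<dots> = 1/2" by (simp add: field_simps)
  finally have "(1 - t) * \<bar>?a\<bar> + t * \<bar>?b\<bar> < 1/2" .
  moreover have "\<bar>interpolation t w p\<bar> \<le> \<bar>(1 - t) * ?a\<bar> + \<bar>t * ?b\<bar>"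
    unfolding interpolation_def by (rule abs_triangle_ineq)
  ultimately show ?thesis using t by (simp add: abs_mult)
qed

text \<open>With a common bound \<open>D\<close> on both distances, the two Harnack estimates have
  the same factor in either variable and so pass to the convex combination, where
  \<open>atau_le\<close> applies. The constant is the same for all pairs, which makes the supremum
  metric finite and separable.\<close>

lemma atau_interpolation_lipschitz:
  assumes w: "w \<in> optimal_pairs \<pi> X Y" and t: "0 < t" "t < 1"
    and p: "p \<in> gds_carrier X \<times> gds_carrier Y" "p' \<in> gds_carrier X \<times> gds_carrier Y"
  shows "\<bar>atau (interpolation t w p) - atau (interpolation t w p')\<bar>
    \<le> 2 * (gds_dist X (fst p) (fst p') + gds_dist Y (snd p) (snd p'))"
proof -
  have *: "atau (interpolation t w p) \<le> atau (interpolation t w p') + 2 * D"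
    if p: "p \<in> gds_carrier X \<times> gds_carrier Y" "p' \<in> gds_carrier X \<times> gds_carrier Y"
      and D: "gds_dist X (fst p) (fst p') \<le> D" "gds_dist X (fst p') (fst p) \<le> D"
        "gds_dist Y (snd p) (snd p') \<le> D" "gds_dist Y (snd p') (snd p) \<le> D" for p p' D
  proof (rule atau_le)
    show "\<bar>interpolation t w p\<bar> < 1/2" "\<bar>interpolation t w p'\<bar> < 1/2"
      using interpolation_bounds[OF w t] p by auto
    note K = optimal_pairsD(1,2)[OF w]
    have pc: "fst p \<in> gds_carrier X" "snd p \<in> gds_carrier Y" "fst p' \<in> gds_carrier X" "snd p' \<in> gds_carrier Y"
      using p by auto
    have "(1 - t) * (1/2 + fst w (fst p)) + t * (1/2 + snd w (snd p))
      \<le> (1 - t) * (exp (2 * D) * (1/2 + fst w (fst p'))) + t * (exp (2 * D) * (1/2 + snd w (snd p')))"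
      using t K_tau_half_le(1)[OF X K(1) pc(1,3) D(1)] K_tau_half_le(1)[OF Y K(2) pc(2,4) D(3)]
      by (intro add_mono mult_left_mono) auto
    then show "1/2 + interpolation t w p \<le> exp (2 * D) * (1/2 + interpolation t w p')"
      by (simp add: interpolation_def field_simps)
    have "(1 - t) * (1/2 - fst w (fst p')) + t * (1/2 - snd w (snd p'))
      \<le> (1 - t) * (exp (2 * D) * (1/2 - fst w (fst p))) + t * (exp (2 * D) * (1/2 - snd w (snd p)))"
      using t K_tau_half_le(2)[OF X K(1) pc(3,1) D(2)] K_tau_half_le(2)[OF Y K(2) pc(4,2) D(4)]
      by (intro add_mono mult_left_mono) auto
    then show "1/2 - interpolation t w p' \<le> exp (2 * D) * (1/2 - interpolation t w p)"
      by (simp add: interpolation_def field_simps)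
  qed
  interpret MX: Metric_space "gds_carrier X" "gds_dist X" by (rule gdsD[OF X])
  interpret MY: Metric_space "gds_carrier Y" "gds_dist Y" by (rule gdsD[OF Y])
  let ?D = "gds_dist X (fst p) (fst p') + gds_dist Y (snd p) (snd p')"
  have D: "gds_dist X (fst p) (fst p') \<le> ?D" "gds_dist X (fst p') (fst p) \<le> ?D"
     "gds_dist Y (snd p) (snd p') \<le> ?D" "gds_dist Y (snd p') (snd p) \<le> ?D"
    using MX.nonneg MY.nonneg by (simp_all add: MX.commute[of "fst p'"] MY.commute[of "snd p'"])
  show ?thesis using *[OF p D] *[OF p(2,1) D(2,1,4,3)] by linarith
qed

lemma interpolation_continuous:
  assumes w: "w \<in> optimal_pairs \<pi> X Y"
  shows "continuous_map (prod_topology (gds_topology X) (gds_topology Y)) euclideanreal (interpolation t w)"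
proof -
  let ?T = "prod_topology (gds_topology X) (gds_topology Y)"
  have "continuous_map ?T euclideanreal (fst w \<circ> fst)" "continuous_map ?T euclideanreal (snd w \<circ> snd)"
    using K_tau_continuous[OF X optimal_pairsD(1)[OF w]] K_tau_continuous[OF Y optimal_pairsD(2)[OF w]]
    by (auto intro: continuous_map_compose continuous_map_fst continuous_map_snd)
  then have "continuous_map ?T euclideanreal (\<lambda>p. (1 - t) * (fst w \<circ> fst) p + t * (snd w \<circ> snd) p)"
    by (intro continuous_map_add continuous_map_real_mult continuous_map_canonical_const)
  then show ?thesis by (simp add: interpolation_def[abs_def])
qed

text \<open>
  Only pairs one of whose members takes no value \<open>\<plusminus> 1/2\<close> are interpolated, so that applying
  \<^const>\<open>atau\<close> yields real-valued features; these pairs are still dense, which is all that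
  \<^const>\<open>K_tau\<close> sees.
\<close>

lemma realized_between:
  assumes t: "0 < t" "t < 1"
  obtains Z :: "(('a \<times> 'b \<Rightarrow> real) \<Rightarrow> real) gds" and \<phi>
  where "geometric_data_set Z" "gds_realized \<pi> Z \<phi> (interpolation t ` optimal_pairs \<pi> X Y)"
proof -
  note c = gds_couplingD[OF X Y \<pi>]
  let ?R = "optimal_pairs \<pi> X Y"
  let ?T = "prod_topology (gds_topology X) (gds_topology Y)"
  define F where "F = (\<lambda>w p. atau (interpolation t w p)) ` ?R"
  have Lip: "\<bar>f p - f p'\<bar> \<le> 2 * (gds_dist X (fst p) (fst p') + gds_dist Y (snd p) (snd p'))"
    if "f \<in> F" "p \<in> space \<pi>" "p' \<in> space \<pi>" for f p p'
    using that atau_interpolation_lipschitz[OF _ t] by (auto simp: F_def c(2))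
  obtain f0 where "f0 \<in> gds_features X" using gdsD(9)[OF X] by blast
  then have "?R \<noteq> {}" using optimal_pairs_left by blast
  then have F: "F \<noteq> {}" by (simp add: F_def)
  have bdd: "bdd_above ((\<lambda>f. \<bar>f p - f p'\<bar>) ` F)" if "p \<in> space \<pi>" "p' \<in> space \<pi>" for p p'
    using Lip[OF _ that] by (auto simp: bdd_above_def)
  \<comment> \<open>The family \<open>F\<close> may be uncountable, so measurability cannot come
    from countable operations. Each single condition is closed, hence so is their
    intersection.\<close>
  have meas: "{p \<in> space \<pi>. \<forall>f\<in>F. \<bar>k f - f p\<bar> \<le> e} \<in> sets \<pi>" for k e
  proof -
    let ?k = "\<lambda>w. k (\<lambda>p. atau (interpolation t w p))"
    \<comment> \<open>By monotonicity of \<open>tau\<close>, closeness of \<open>atau\<close> of the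
      interpolant to \<open>?k w\<close> says that the interpolant itself, a continuous function,
      lies in a closed interval.\<close>
    let ?S = "\<lambda>w. {p \<in> topspace ?T. interpolation t w p \<in> {tau (?k w - e)..tau (?k w + e)}}"
    have top: "topspace ?T = space \<pi>" by (simp add: c(2) gdsD(7)[OF X] gdsD(7)[OF Y])
    have "\<bar>?k w - atau (interpolation t w p)\<bar> \<le> e \<longleftrightarrow> p \<in> ?S w" if w: "w \<in> ?R" and p: "p \<in> space \<pi>" for w p
    proof -
      have *: "tau (atau (interpolation t w p)) = interpolation t w p"
        using interpolation_bounds[OF w t] p c(2) by (intro tau_atau) auto
      have "\<bar>?k w - atau (interpolation t w p)\<bar> \<le> e \<longleftrightarrow>
          ?k w - e \<le> atau (interpolation t w p) \<and> atau (interpolation t w p) \<le> ?k w + e"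
        by (auto simp: abs_le_iff)
      also have "\<dots> \<longleftrightarrow> interpolation t w p \<in> {tau (?k w - e)..tau (?k w + e)}"
        using tau_le_iff[of "?k w - e" "atau (interpolation t w p)"]
          tau_le_iff[of "atau (interpolation t w p)" "?k w + e"] * by simp
      finally show ?thesis using p top by simp
    qed
    then have "{p \<in> space \<pi>. \<forall>f\<in>F. \<bar>k f - f p\<bar> \<le> e} = (\<Inter>w\<in>?R. ?S w)"
      using \<open>?R \<noteq> {}\<close> top by (auto simp: F_def)
    moreover have "closedin ?T (?S w)" if "w \<in> ?R" for w
      by (rule closedin_continuous_map_preimage[OF interpolation_continuous[OF that]]) simp
    then have "closedin ?T (\<Inter>w\<in>?R. ?S w)" using \<open>?R \<noteq> {}\<close> by (intro closedin_INT) auto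
    then have "(\<Inter>w\<in>?R. ?S w) \<in> borel_sets ?T" by (rule closedin_borel_sets)
    moreover have "sets \<pi> = borel_sets ?T" using \<pi> by (simp add: gds_couplings_def)
    ultimately show ?thesis by simp
  qed
  obtain qX :: "nat \<Rightarrow> 'a" where qX: "\<And>n. qX n \<in> gds_carrier X"
    "\<And>x e. x \<in> gds_carrier X \<Longrightarrow> e > 0 \<Longrightarrow> \<exists>n. gds_dist X (qX n) x < e"
    using gds_dense_sequence[OF X] by blast
  obtain qY :: "nat \<Rightarrow> 'b" where qY: "\<And>n. qY n \<in> gds_carrier Y"
    "\<And>y e. y \<in> gds_carrier Y \<Longrightarrow> e > 0 \<Longrightarrow> \<exists>n. gds_dist Y (qY n) y < e"
    using gds_dense_sequence[OF Y] by blast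
  interpret MX: Metric_space "gds_carrier X" "gds_dist X" by (rule gdsD[OF X])
  interpret MY: Metric_space "gds_carrier Y" "gds_dist Y" by (rule gdsD[OF Y])
  have Q: "\<exists>q\<in>range qX \<times> range qY. \<forall>f\<in>F. \<bar>f p - f q\<bar> \<le> e" if p: "p \<in> space \<pi>" and e: "e > 0" for p e
  proof -
    have pc: "fst p \<in> gds_carrier X" "snd p \<in> gds_carrier Y"
      using p unfolding c(2) mem_Times_iff by blast+
    \<comment> \<open>With Lipschitz constant 2 and two coordinates, accuracy e / 4 in each gives
      \<open>e\<close>.\<close>
    have e4: "e / 4 > 0" using e by simp
    obtain n m where nm: "gds_dist X (qX n) (fst p) < e / 4" "gds_dist Y (qY m) (snd p) < e / 4"
      using qX(2)[OF pc(1) e4] qY(2)[OF pc(2) e4] by blast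
    have q: "(qX n, qY m) \<in> space \<pi>" using qX qY c(2) by simp
    have "\<bar>f p - f (qX n, qY m)\<bar> \<le> e" if "f \<in> F" for f
      using Lip[OF that p q] nm by (simp add: MX.commute[of "fst p"] MY.commute[of "snd p"])
    then show ?thesis by blast
  qed
  have Qc: "countable (range qX \<times> range qY)" "range qX \<times> range qY \<subseteq> space \<pi>" using qX(1) qY(1) c(2) by auto
  obtain Z :: "(('a \<times> 'b \<Rightarrow> real) \<Rightarrow> real) gds" and \<phi> ev
    where Z: "geometric_data_set Z" and m: "\<phi> \<in> measurable \<pi> (gds_measure Z)"
      "distr \<pi> (gds_measure Z) \<phi> = gds_measure Z" and ev: "gds_features Z = ev ` F"
      and ae: "AE p in \<pi>. \<forall>f\<in>F. ev f (\<phi> p) = f p"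
    using gds_of_features[OF c(1) F bdd meas Qc Q] by blast
  \<comment> \<open>Applying \<open>tau\<close> to the feature made from \<open>w\<close> undoes
    \<open>atau\<close>; pulled back along \<open>\<phi>\<close> it is the interpolant almost
    everywhere, which is enough for L1.\<close>
  let ?h = "\<lambda>w. compose (gds_carrier Z) tau (ev (\<lambda>p. atau (interpolation t w p)))"
  have h: "?h w \<in> K_tau Z" if "w \<in> ?R" for w
    by (rule tau_feature_K_tau[OF Z]) (use that in \<open>auto simp: ev F_def\<close>)
  have L: "L1_dist \<pi> (u \<circ> \<phi>) (interpolation t w) = L1_dist (gds_measure Z) u (?h w)"
    if u: "u \<in> K_tau Z" and w: "w \<in> ?R" for u w
  proof -
    note um = K_tau_comp_measurable[OF Z u m(1)] and hm = K_tau_comp_measurable[OF Z h[OF w] m(1)]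
    have im: "interpolation t w \<in> borel_measurable \<pi>" using interpolation_integrable[OF w] by auto
    have "L1_dist \<pi> (u \<circ> \<phi>) (interpolation t w) = L1_dist \<pi> (u \<circ> \<phi>) (?h w \<circ> \<phi>)"
      unfolding L1_dist_def
    proof (rule integral_cong_AE)
      show "(\<lambda>p. \<bar>(u \<circ> \<phi>) p - interpolation t w p\<bar>) \<in> borel_measurable \<pi>"
        by (rule borel_measurable_abs[OF borel_measurable_diff[OF um im]])
      show "(\<lambda>p. \<bar>(u \<circ> \<phi>) p - (?h w \<circ> \<phi>) p\<bar>) \<in> borel_measurable \<pi>"
        by (rule borel_measurable_abs[OF borel_measurable_diff[OF um hm]])
      show "AE p in \<pi>. \<bar>(u \<circ> \<phi>) p - interpolation t w p\<bar> = \<bar>(u \<circ> \<phi>) p - (?h w \<circ> \<phi>) p\<bar>"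
        using ae AE_space
      proof eventually_elim
        case (elim p)
        have "ev (\<lambda>p. atau (interpolation t w p)) (\<phi> p) = atau (interpolation t w p)"
          using elim(1) w by (auto simp: F_def)
        moreover have "\<phi> p \<in> gds_carrier Z" using measurable_space[OF m(1) elim(2)] gdsD(5)[OF Z] by simp
        moreover have "tau (atau (interpolation t w p)) = interpolation t w p"
          using interpolation_bounds[OF w t] elim(2) c(2) by (intro tau_atau) auto
        ultimately show ?case by (simp add: compose_def)
      qed
    qed
    then show ?thesis using L1_dist_comp[OF Z u h[OF w] m] by simp
  qed
  have "gds_realized \<pi> Z \<phi> (interpolation t ` ?R)"
    unfolding gds_realized_def
  proof (intro conjI ballI allI impI m)
    fix u and e :: real assume u: "u \<in> K_tau Z" and e: "e > 0"
    obtain g where "g \<in> gds_features Z" "L1_dist (gds_measure Z) u (compose (gds_carrier Z) tau g) < e"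
      using K_tau_L1_approx[OF Z u e] by blast
    then obtain w where "w \<in> ?R" "L1_dist (gds_measure Z) u (?h w) < e" by (auto simp: ev F_def)
    then show "\<exists>h\<in>interpolation t ` ?R. L1_dist \<pi> (u \<circ> \<phi>) h < e" using L[OF u] by auto
  next
    fix h' and e :: real assume "h' \<in> interpolation t ` ?R" and e: "e > 0"
    then obtain w where w: "w \<in> ?R" "h' = interpolation t w" by blast
    have "L1_dist \<pi> (?h w \<circ> \<phi>) h' < e" using L[OF h[OF w(1)] w(1)] w(2) e by (simp add: L1_dist_def)
    then show "\<exists>u\<in>K_tau Z. L1_dist \<pi> (u \<circ> \<phi>) h' < e" using h[OF w(1)] by blast
  qed
  then show ?thesis using that Z by blast
qed

end

section \<open>Assembly of the geodesic\<close>

lemma real_gds_realized: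
  assumes Z: "geometric_data_set Z" and \<phi>: "gds_realized M Z \<phi> H"
  shows "\<exists>W :: real gds. geometric_data_set W \<and> (\<exists>\<psi>. gds_realized M W \<psi> H)"
proof -
  obtain W :: "real gds" and \<theta> where "geometric_data_set W" "gds_isomorphism Z W \<theta>"
    using gds_isomorphic_to_real[OF Z] by (auto simp: gds_isomorphic_def)
  then show ?thesis using gds_realized_iso[OF Z _ _ \<phi>] by blast
qed

lemma d_tau_geodesic:
  fixes X Y :: "real gds"
  assumes X: "geometric_data_set X" and Y: "geometric_data_set Y"
  obtains W :: "real \<Rightarrow> real gds" where "\<And>t. t \<in> {0..1} \<Longrightarrow> geometric_data_set (W t)" "W 0 = X" "W 1 = Y"
    "\<And>s t. s \<in> {0..1} \<Longrightarrow> t \<in> {0..1} \<Longrightarrow> d_tau (W s) (W t) = \<bar>s - t\<bar> * d_tau X Y"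
proof -
  obtain \<pi> where \<pi>: "\<pi> \<in> gds_couplings X Y"
    "\<And>u. u \<in> K_tau X \<Longrightarrow> \<exists>v\<in>K_tau Y. L1_dist \<pi> (u \<circ> fst) (v \<circ> snd) \<le> d_tau X Y"
    "\<And>v. v \<in> K_tau Y \<Longrightarrow> \<exists>u\<in>K_tau X. L1_dist \<pi> (u \<circ> fst) (v \<circ> snd) \<le> d_tau X Y"
    using d_tau_attained[OF X Y] by blast
  note c = gds_couplingD[OF X Y \<pi>(1)]
  let ?H = "\<lambda>t. interpolation t ` optimal_pairs \<pi> X Y"
  \<comment> \<open>At the ends the data sets \<open>X\<close> and \<open>Y\<close> themselves are
    taken, realized by the projections; the construction through \<open>atau\<close> is reserved for
    the open interval.\<close>
  have "\<exists>W :: real gds. geometric_data_set W \<and> (\<exists>\<phi>. gds_realized \<pi> W \<phi> (?H t)) \<and>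
      (t = 0 \<longrightarrow> W = X) \<and> (t = 1 \<longrightarrow> W = Y)" if "t \<in> {0..1}" for t
  proof -
    consider "t = 0" | "t = 1" | "0 < t" "t < 1" using \<open>t \<in> {0..1}\<close> by fastforce
    then show ?thesis
    proof cases
      case 1
      then show ?thesis using X realized_left[OF X Y \<pi>] by auto
    next
      case 2
      then show ?thesis using Y realized_right[OF X Y \<pi>] by auto
    next
      case 3
      obtain Z :: "((real \<times> real \<Rightarrow> real) \<Rightarrow> real) gds" and \<phi>
        where "geometric_data_set Z" "gds_realized \<pi> Z \<phi> (?H t)"
        using realized_between[OF X Y \<pi> 3] by blast
      then show ?thesis using real_gds_realized 3 by fastforce
    qed
  qed
  then obtain W :: "real \<Rightarrow> real gds" where W: "\<And>t. t \<in> {0..1} \<Longrightarrow> geometric_data_set (W t)"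
    and re: "\<And>t. t \<in> {0..1} \<Longrightarrow> \<exists>\<phi>. gds_realized \<pi> (W t) \<phi> (?H t)"
    and ends: "W 0 = X" "W 1 = Y"
    by (metis atLeastAtMost_iff order_refl zero_le_one)
  let ?d = "d_tau X Y"
  have le: "d_tau (W s) (W t) \<le> \<bar>s - t\<bar> * ?d" if st: "s \<in> {0..1}" "t \<in> {0..1}" for s t
  proof -
    obtain \<phi> \<psi> where r: "gds_realized \<pi> (W s) \<phi> (?H s)" "gds_realized \<pi> (W t) \<psi> (?H t)"
      using re st by blast
    show ?thesis
      by (rule d_tau_le_realized[OF W[OF st(1)] W[OF st(2)] c(1) r])
        (use interpolation_integrable[OF X Y \<pi>] L1_dist_interpolation[OF X Y \<pi>] in blast)+
  qed
  \<comment> \<open>The path from \<open>X\<close> to \<open>Y\<close> through \<open>W s\<close>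
    and \<open>W t\<close> has length at least \<open>?d\<close>, while its outer pieces have length
    at most s and 1 - t times \<open>?d\<close>. What is left over bounds the middle piece from
    below.\<close>
  have ge: "\<bar>s - t\<bar> * ?d \<le> d_tau (W s) (W t)" if st: "s \<in> {0..1}" "t \<in> {0..1}" "s \<le> t" for s t
  proof -
    have "?d \<le> d_tau (W 0) (W s) + d_tau (W s) (W 1)"
      using d_tau_triangle[OF X W[OF st(1)] Y] ends by simp
    moreover have "d_tau (W s) (W 1) \<le> d_tau (W s) (W t) + d_tau (W t) (W 1)"
      by (rule d_tau_triangle) (use W st in auto)
    moreover have "d_tau (W 0) (W s) \<le> s * ?d" "d_tau (W t) (W 1) \<le> (1 - t) * ?d"
      using le[of 0 s] le[of t 1] st by auto
    moreover have "\<bar>s - t\<bar> * ?d = ?d - s * ?d - (1 - t) * ?d" using st(3) by (simp add: algebra_simps)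
    ultimately show ?thesis by linarith
  qed
  have "d_tau (W s) (W t) = \<bar>s - t\<bar> * ?d" if st: "s \<in> {0..1}" "t \<in> {0..1}" for s t
  proof (cases "s \<le> t")
    case True
    then show ?thesis using le[OF st] ge[OF st] by simp
  next
    case False
    then have "d_tau (W t) (W s) = \<bar>t - s\<bar> * ?d" using le[OF st(2,1)] ge[OF st(2,1)] by simp
    then show ?thesis using d_tau_commute[OF W[OF st(1)] W[OF st(2)]] by (simp add: abs_minus_commute)
  qed
  then show ?thesis using that W ends by blast
qed

theorem theorem3p7:
  fixes X Y :: "real gds set"
  assumes "X \<in> gds_classes" and "Y \<in> gds_classes"
  shows "\<exists>\<gamma> :: real \<Rightarrow> real gds set.
           (\<forall>t\<in>{0..1}. \<gamma> t \<in> gds_classes) \<and> \<gamma> 0 = X \<and> \<gamma> 1 = Y \<and>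
           (\<forall>s\<in>{0..1}. \<forall>t\<in>{0..1}.
              d_tau_class (\<gamma> s) (\<gamma> t) = \<bar>s - t\<bar> * d_tau_class X Y)"
proof -
  obtain A where A: "geometric_data_set A" "X = gds_iso_rel `` {A}"
    using assms(1) unfolding gds_classes_def by (auto elim: quotientE)
  obtain B where B: "geometric_data_set B" "Y = gds_iso_rel `` {B}"
    using assms(2) unfolding gds_classes_def by (auto elim: quotientE)
  obtain W :: "real \<Rightarrow> real gds" where W: "\<And>t. t \<in> {0..1} \<Longrightarrow> geometric_data_set (W t)" "W 0 = A" "W 1 = B"
    and d: "\<And>s t. s \<in> {0..1} \<Longrightarrow> t \<in> {0..1} \<Longrightarrow> d_tau (W s) (W t) = \<bar>s - t\<bar> * d_tau A B"
    using d_tau_geodesic[OF A(1) B(1)] by blast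
  define \<gamma> where "\<gamma> t = gds_iso_rel `` {W t}" for t
  have cl: "gds_iso_rel `` {Z} \<in> gds_classes" "Z \<in> gds_iso_rel `` {Z}" if "geometric_data_set Z" for Z
    using that equiv_class_self[OF equiv_gds_iso_rel] unfolding gds_classes_def by (auto intro: quotientI)
  have "d_tau_class X Y = d_tau A B"
    using d_tau_class_eq[OF assms] cl(2)[OF A(1)] cl(2)[OF B(1)] A(2) B(2) by simp
  moreover have "d_tau_class (\<gamma> s) (\<gamma> t) = d_tau (W s) (W t)" if "s \<in> {0..1}" "t \<in> {0..1}" for s t
    unfolding \<gamma>_def using W(1) that by (intro d_tau_class_eq cl)
  ultimately show ?thesis
    using d W cl A(2) B(2) by (intro exI[of _ \<gamma>]) (auto simp: \<gamma>_def)
qed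

end
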